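(* Locally integrally equivalent subgroups need not be integrally equivalent, and this already occurs for number fields of degree $32$: there exist number fields $K_1$ and $K_2$ of degree $32$ over $\mathbf{Q}$ with a common Galois closure $L$ over $\mathbf{Q}$ such that the subgroups $H_1=\mathrm{Gal}(L/K_1)$ and $H_2=\mathrm{Gal}(L/K_2)$ of $G=\mathrm{Gal}(L/\mathbf{Q})$ are locally integrally equivalent but not integrally equivalent.
   Context: For a finite group $G$, a subgroup $H\le G$ and a commutative ring $R$, $R[H\backslash G]$ denotes the permutation module: the free $R$-module with basis the set of right cosets of $H$ in $G$, with the $R$-linear extension of the right action of $G$ on cosets. Subgroups $H_1,H_2\le G$ are locally integrally equivalent if $\mathbf{Z}_p[H_1\backslash G]\simeq \mathbf{Z}_p[H_2\backslash G]$ as $\mathbf{Z}_p[G]$-modules for every prime $p$ ($\mathbf{Z}_p$ the $p$-adic integers), and integrally equivalent if $\mathbf{Z}[H_1\backslash G]\simeq \mathbf{Z}[H_2\backslash G]$ as $\mathbf{Z}[G]$-modules. *)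

theory Defs
  imports
    Complex_Main
    "HOL-Computational_Algebra.Primes"
    "HOL-Algebra.Algebra"
    "HOL-Algebra.Algebraic_Closure_Type"
begin

section \<open>Permutation modules\<close>

text \<open>
  The free \<open>R\<close>-module on the right cosets of \<open>H\<close> in \<open>G\<close>, an element \<open>\<Sum>\<^sub>C f\<^sub>C C\<close> being
  encoded as its coefficient function \<open>f\<close>. For finite \<open>G\<close>, the only case considered,
  every function on the cosets has finite support. The ring multiplication inherited from
  the record type of modules plays no role.
\<close>
definition perm_module ::
  "('r, 'k) ring_scheme \<Rightarrow> ('g, 'm) monoid_scheme \<Rightarrow> 'g set \<Rightarrow> ('r, 'g set \<Rightarrow> 'r) module"
  where "perm_module R G H =
    \<lparr>carrier = (rcosets\<^bsub>G\<^esub> H) \<rightarrow>\<^sub>E carrier R,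
     monoid.mult = undefined,
     one = undefined,
     ring.zero = (\<lambda>C \<in> rcosets\<^bsub>G\<^esub> H. \<zero>\<^bsub>R\<^esub>),
     ring.add = (\<lambda>f f'. \<lambda>C \<in> rcosets\<^bsub>G\<^esub> H. f C \<oplus>\<^bsub>R\<^esub> f' C),
     module.smult = (\<lambda>r f. \<lambda>C \<in> rcosets\<^bsub>G\<^esub> H. r \<otimes>\<^bsub>R\<^esub> f C)\<rparr>"

text \<open>
  The right action: \<open>(\<Sum>\<^sub>C f\<^sub>C C) g = \<Sum>\<^sub>C f\<^sub>C (C g)\<close>, whose coefficient at \<open>C\<close> is that of
  \<open>f\<close> at \<open>C g\<^sup>-\<^sup>1\<close>.
\<close>
definition perm_act ::
  "('g, 'm) monoid_scheme \<Rightarrow> 'g set \<Rightarrow> ('g set \<Rightarrow> 'r) \<Rightarrow> 'g \<Rightarrow> ('g set \<Rightarrow> 'r)"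
  where "perm_act G H f g = (\<lambda>C \<in> rcosets\<^bsub>G\<^esub> H. f (C #>\<^bsub>G\<^esub> inv\<^bsub>G\<^esub> g))"

text \<open>Isomorphism as modules over the group ring \<open>R[G]\<close>: an \<open>R\<close>-linear bijection that
  commutes with the action of \<open>G\<close>.\<close>
definition perm_modules_isomorphic ::
  "('r, 'k) ring_scheme \<Rightarrow> ('g, 'm) monoid_scheme \<Rightarrow> 'g set \<Rightarrow> 'g set \<Rightarrow> bool"
  where "perm_modules_isomorphic R G H1 H2 \<longleftrightarrow>
    (\<exists>\<phi> \<in> iso (add_monoid (perm_module R G H1)) (add_monoid (perm_module R G H2)).
      (\<forall>r \<in> carrier R. \<forall>f \<in> carrier (perm_module R G H1).
         \<phi> (r \<odot>\<^bsub>perm_module R G H1\<^esub> f) = r \<odot>\<^bsub>perm_module R G H2\<^esub> \<phi> f) \<and>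
      (\<forall>g \<in> carrier G. \<forall>f \<in> carrier (perm_module R G H1).
         \<phi> (perm_act G H1 f g) = perm_act G H2 (\<phi> f) g))"

lemma (in group) rcosets_r_coset_closed:
  assumes "subgroup H G" "C \<in> rcosets H" "g \<in> carrier G"
  shows "C #> g \<in> rcosets H"
  using assms by (auto simp: RCOSETS_def coset_mult_assoc subgroup.subset)

lemma (in group) perm_module_is_module:
  assumes "cring R"
  shows "module R (perm_module R G H)"
proof -
  interpret R: cring R by fact
  show ?thesis
  proof (rule moduleI)
    show "cring R" by fact
    show "abelian_group (perm_module R G H)"
    proof (rule abelian_groupI)
      fix f assume f: "f \<in> carrier (perm_module R G H)"
      have "(\<lambda>C \<in> rcosets H. \<ominus>\<^bsub>R\<^esub> f C) \<in> carrier (perm_module R G H)"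
        using f by (auto simp: perm_module_def)
      moreover have "(\<lambda>C \<in> rcosets H. \<ominus>\<^bsub>R\<^esub> f C) \<oplus>\<^bsub>perm_module R G H\<^esub> f = \<zero>\<^bsub>perm_module R G H\<^esub>"
        using f by (auto simp: perm_module_def PiE_iff R.l_neg intro!: restrict_ext)
      ultimately show "\<exists>f' \<in> carrier (perm_module R G H). f' \<oplus>\<^bsub>perm_module R G H\<^esub> f = \<zero>\<^bsub>perm_module R G H\<^esub>"
        by blast
    qed (auto simp: perm_module_def PiE_iff R.a_assoc R.a_comm R.a_lcomm extensional_def intro!: ext)
  qed (auto simp: perm_module_def PiE_iff R.l_distr R.r_distr R.m_assoc extensional_def intro!: ext)
qed

lemma (in group) perm_act_basis:
  fixes R :: "('r, 'k) ring_scheme"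
  assumes "subgroup H G" "C \<in> rcosets H" "g \<in> carrier G"
  shows "perm_act G H (\<lambda>D \<in> rcosets H. if D = C then \<one>\<^bsub>R\<^esub> else \<zero>\<^bsub>R\<^esub>) g =
    (\<lambda>D \<in> rcosets H. if D = C #> g then \<one>\<^bsub>R\<^esub> else \<zero>\<^bsub>R\<^esub>)"
proof -
  have "D #> inv g = C \<longleftrightarrow> D = C #> g" if "D \<in> rcosets H" for D
  proof -
    have sub: "D \<subseteq> carrier G" "C \<subseteq> carrier G"
      using assms(1,2) that subgroup.rcosets_carrier[OF assms(1) is_group] by auto
    show ?thesis
      using sub assms(3) by (auto simp: coset_mult_assoc coset_mult_one)
  qed
  then show ?thesis
    using assms by (auto simp: perm_act_def rcosets_r_coset_closed intro!: ext)
qed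

section \<open>Integral and local integral equivalence\<close>

text \<open>The \<open>p\<close>-adic integers as the inverse limit of the rings \<open>\<int>/p\<^sup>n\<int>\<close>, residues being
  represented in \<open>{0..<p\<^sup>n}\<close>.\<close>
definition padic_int_ring :: "nat \<Rightarrow> (nat \<Rightarrow> int) ring"
  where "padic_int_ring p =
    \<lparr>carrier = {x. \<forall>n. x n \<in> {0..<int p ^ n} \<and> x (Suc n) mod int p ^ n = x n},
     monoid.mult = (\<lambda>x y n. (x n * y n) mod int p ^ n),
     one = (\<lambda>n. 1 mod int p ^ n),
     ring.zero = (\<lambda>n. 0),
     ring.add = (\<lambda>x y n. (x n + y n) mod int p ^ n)\<rparr>"

lemma padic_int_ring_cring:
  assumes "Factorial_Ring.prime p"
  shows "cring (padic_int_ring p)"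
proof -
  have pos: "0 < int p ^ n" for n
    using assms prime_gt_0_nat by auto
  have tower: "a mod int p ^ Suc n mod int p ^ n = a mod int p ^ n" for a n
    by (rule mod_mod_cancel) simp
  let ?Z = "carrier (padic_int_ring p)"
  have memI: "(\<lambda>n. f n mod int p ^ n) \<in> ?Z"
    if "\<And>n. f (Suc n) mod int p ^ n = f n mod int p ^ n" for f
    unfolding padic_int_ring_def using pos that tower by fastforce
  have red: "x n mod int p ^ n = x n" and step: "x (Suc n) mod int p ^ n = x n" if "x \<in> ?Z" for x n
    using that by (auto simp: padic_int_ring_def)
  have add_closed: "(\<lambda>n. (x n + y n) mod int p ^ n) \<in> ?Z" if "x \<in> ?Z" "y \<in> ?Z" for x y
    by (rule memI) (metis mod_add_eq step[OF that(1)] step[OF that(2)])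
  have mult_closed: "(\<lambda>n. (x n * y n) mod int p ^ n) \<in> ?Z" if "x \<in> ?Z" "y \<in> ?Z" for x y
    by (rule memI) (metis mod_mult_eq step[OF that(1)] step[OF that(2)])
  have uminus_closed: "(\<lambda>n. (- x n) mod int p ^ n) \<in> ?Z" if "x \<in> ?Z" for x
    by (rule memI) (metis mod_minus_eq step[OF that])
  have one_closed: "(\<lambda>n. 1 mod int p ^ n) \<in> ?Z"
    by (rule memI) simp
  have zero_closed: "(\<lambda>n. 0) \<in> ?Z"
    using memI[of "\<lambda>_. 0"] by simp
  show ?thesis
  proof (rule cringI)
    show "abelian_group (padic_int_ring p)"
    proof (rule abelian_groupI)
      fix x assume x: "x \<in> ?Z"
      have "(\<lambda>n. (- x n) mod int p ^ n) \<oplus>\<^bsub>padic_int_ring p\<^esub> x = \<zero>\<^bsub>padic_int_ring p\<^esub>"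
        by (simp add: padic_int_ring_def mod_simps)
      then show "\<exists>y \<in> ?Z. y \<oplus>\<^bsub>padic_int_ring p\<^esub> x = \<zero>\<^bsub>padic_int_ring p\<^esub>"
        using uminus_closed[OF x] by blast
    next
      fix x assume "x \<in> ?Z"
      then show "\<zero>\<^bsub>padic_int_ring p\<^esub> \<oplus>\<^bsub>padic_int_ring p\<^esub> x = x"
        using red by (simp add: padic_int_ring_def)
    next
      show "\<zero>\<^bsub>padic_int_ring p\<^esub> \<in> ?Z"
        using zero_closed by (simp add: padic_int_ring_def)
    next
      fix x y assume "x \<in> ?Z" "y \<in> ?Z"
      then show "x \<oplus>\<^bsub>padic_int_ring p\<^esub> y \<in> ?Z"
        using add_closed by (simp add: padic_int_ring_def)
    qed (simp_all add: padic_int_ring_def mod_simps ac_simps)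
    show "comm_monoid (padic_int_ring p)"
    proof (rule comm_monoidI)
      fix x assume "x \<in> ?Z"
      then show "\<one>\<^bsub>padic_int_ring p\<^esub> \<otimes>\<^bsub>padic_int_ring p\<^esub> x = x"
        using red by (simp add: padic_int_ring_def mod_simps)
    next
      show "\<one>\<^bsub>padic_int_ring p\<^esub> \<in> ?Z"
        using one_closed by (simp add: padic_int_ring_def)
    next
      fix x y assume "x \<in> ?Z" "y \<in> ?Z"
      then show "x \<otimes>\<^bsub>padic_int_ring p\<^esub> y \<in> ?Z"
        using mult_closed by (simp add: padic_int_ring_def)
    qed (simp_all add: padic_int_ring_def mod_simps ac_simps)
  qed (simp add: padic_int_ring_def mod_simps distrib_right)
qed

definition integrally_equivalent :: "('g, 'm) monoid_scheme \<Rightarrow> 'g set \<Rightarrow> 'g set \<Rightarrow> bool"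
  where "integrally_equivalent G H1 H2 \<longleftrightarrow> perm_modules_isomorphic int_ring G H1 H2"

definition locally_integrally_equivalent :: "('g, 'm) monoid_scheme \<Rightarrow> 'g set \<Rightarrow> 'g set \<Rightarrow> bool"
  where "locally_integrally_equivalent G H1 H2 \<longleftrightarrow>
    (\<forall>p::nat. Factorial_Ring.prime p \<longrightarrow> perm_modules_isomorphic (padic_int_ring p) G H1 H2)"

section \<open>Number fields and Galois closures inside the complex numbers\<close>

abbreviation complex_ring :: "complex ring"
  where "complex_ring \<equiv> ring_of_type_algebra"

definition number_field_of_degree :: "nat \<Rightarrow> complex set \<Rightarrow> bool"
  where "number_field_of_degree d K \<longleftrightarrow>
    subfield K complex_ring \<and> ring.dimension complex_ring d \<rat> K"

text \<open>The automorphisms of \<open>L\<close> that fix \<open>F\<close> pointwise, extended by \<open>undefined\<close> outside \<open>L\<close>;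
  the product is \<open>\<sigma> \<tau> = \<sigma> \<circ> \<tau>\<close>.\<close>
definition galois_group :: "complex set \<Rightarrow> complex set \<Rightarrow> (complex \<Rightarrow> complex) monoid"
  where "galois_group L F = (BijGroup L)
    \<lparr>carrier := {\<sigma> \<in> Bij L.
       \<sigma> \<in> ring_iso (complex_ring\<lparr>carrier := L\<rparr>) (complex_ring\<lparr>carrier := L\<rparr>) \<and>
       (\<forall>x \<in> F. \<sigma> x = x)}\<rparr>"

text \<open>Finite Galois extensions, in the sense of Artin: the fixed field of the automorphism
  group is the base field.\<close>
definition galois_extension :: "complex set \<Rightarrow> complex set \<Rightarrow> bool"
  where "galois_extension L F \<longleftrightarrow>
    subfield F complex_ring \<and> subfield L complex_ring \<and> F \<subseteq> L \<and>
    ring.finite_dimension complex_ring F L \<and>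
    {x \<in> L. \<forall>\<sigma> \<in> carrier (galois_group L F). \<sigma> x = x} = F"

definition galois_closure :: "complex set \<Rightarrow> complex set \<Rightarrow> complex set \<Rightarrow> bool"
  where "galois_closure L K F \<longleftrightarrow>
    galois_extension L F \<and> K \<subseteq> L \<and>
    (\<forall>M. galois_extension M F \<and> K \<subseteq> M \<longrightarrow> L \<subseteq> M)"

lemma galois_group_subgroup_BijGroup:
  assumes "subfield L complex_ring" and FL: "F \<subseteq> L"
  shows "subgroup (carrier (galois_group L F)) (BijGroup L)"
proof -
  let ?G = "carrier (galois_group L F)"
  interpret B: group "BijGroup L" by (rule group_BijGroup)
  have mem: "\<sigma> \<in> ?G \<longleftrightarrow> \<sigma> \<in> Bij L \<and> (\<forall>x \<in> L. \<forall>y \<in> L. \<sigma> (x * y) = \<sigma> x * \<sigma> y \<and> \<sigma> (x + y) = \<sigma> x + \<sigma> y) \<and>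
      \<sigma> 1 = 1 \<and> (\<forall>x \<in> F. \<sigma> x = x)" for \<sigma>
    by (auto simp: galois_group_def ring_iso_def ring_hom_def ring_of_type_algebra_def Bij_def
        bij_betwE)
  have sr: "subring L complex_ring"
    using assms(1) by (simp add: subfield_def subdomain_def subcring.axioms(1))
  have L1: "1 \<in> L" and Lm: "x \<in> L \<Longrightarrow> y \<in> L \<Longrightarrow> x * y \<in> L" and La: "x \<in> L \<Longrightarrow> y \<in> L \<Longrightarrow> x + y \<in> L" for x y
    using subringE(3,6,7)[OF sr] by (auto simp: ring_of_type_algebra_def)
  have BL: "\<sigma> x \<in> L" if "\<sigma> \<in> Bij L" "x \<in> L" for \<sigma> x
    using that Bij_imp_funcset by blast
  show "subgroup ?G (BijGroup L)"
  proof (rule B.subgroupI)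
    show "?G \<subseteq> carrier (BijGroup L)"
      using mem by (auto simp: BijGroup_def)
    have "(\<lambda>x \<in> L. x) \<in> ?G"
      using L1 Lm La FL by (auto simp: mem id_Bij)
    then show "?G \<noteq> {}" by blast
  next
    fix \<sigma> assume \<sigma>: "\<sigma> \<in> ?G"
    then have B: "\<sigma> \<in> Bij L" by (simp add: mem)
    then have bij: "bij_betw \<sigma> L L" by (simp add: Bij_def)
    have inv: "inv_into L \<sigma> y = x" if "x \<in> L" "\<sigma> x = y" for x y
      using bij that by (auto simp: bij_betw_def)
    have I: "inv_into L \<sigma> x \<in> L" "\<sigma> (inv_into L \<sigma> x) = x" if "x \<in> L" for x
      using B that by (auto simp: Bij_inv_into_mem bij_betw_inv_into_right[OF bij])
    have "(\<lambda>x \<in> L. inv_into L \<sigma> x) \<in> ?G"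
      unfolding mem
    proof (intro conjI ballI)
      show "(\<lambda>x \<in> L. inv_into L \<sigma> x) \<in> Bij L"
        using B by (rule restrict_inv_into_Bij)
      show "(\<lambda>x \<in> L. inv_into L \<sigma> x) 1 = 1"
        using L1 \<sigma> inv[of 1 1] by (simp add: mem)
    next
      fix x assume "x \<in> F"
      then show "(\<lambda>x \<in> L. inv_into L \<sigma> x) x = x"
        using FL \<sigma> inv[of x x] by (auto simp: mem)
    next
      fix x y assume xy: "x \<in> L" "y \<in> L"
      show "(\<lambda>x \<in> L. inv_into L \<sigma> x) (x * y) = (\<lambda>x \<in> L. inv_into L \<sigma> x) x * (\<lambda>x \<in> L. inv_into L \<sigma> x) y"
        using xy I Lm \<sigma> inv[of "inv_into L \<sigma> x * inv_into L \<sigma> y" "x * y"] by (simp add: mem)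
      show "(\<lambda>x \<in> L. inv_into L \<sigma> x) (x + y) = (\<lambda>x \<in> L. inv_into L \<sigma> x) x + (\<lambda>x \<in> L. inv_into L \<sigma> x) y"
        using xy I La \<sigma> inv[of "inv_into L \<sigma> x + inv_into L \<sigma> y" "x + y"] by (simp add: mem)
    qed
    then show "inv\<^bsub>BijGroup L\<^esub> \<sigma> \<in> ?G"
      using B by (simp add: inv_BijGroup)
  next
    fix \<sigma> \<tau> assume *: "\<sigma> \<in> ?G" "\<tau> \<in> ?G"
    then have B: "\<sigma> \<in> Bij L" "\<tau> \<in> Bij L" by (simp_all add: mem)
    have "compose L \<sigma> \<tau> \<in> ?G"
      using * B L1 Lm La FL BL by (auto simp: mem compose_Bij compose_eq subset_iff)
    then show "\<sigma> \<otimes>\<^bsub>BijGroup L\<^esub> \<tau> \<in> ?G"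
      using B by (simp add: BijGroup_def)
  qed
qed

lemma galois_group_is_group:
  assumes "subfield L complex_ring" "F \<subseteq> L"
  shows "group (galois_group L F)"
  using subgroup.subgroup_is_group[OF galois_group_subgroup_BijGroup[OF assms] group_BijGroup]
  by (simp add: galois_group_def)

lemma galois_group_subgroup:
  assumes "subfield L complex_ring" "F \<subseteq> K" "K \<subseteq> L"
  shows "subgroup (carrier (galois_group L K)) (galois_group L F)"
proof -
  have FL: "F \<subseteq> L" using assms by blast
  have "carrier (galois_group L K) \<subseteq> carrier (galois_group L F)"
    using assms(2) by (auto simp: galois_group_def)
  then have "subgroup (carrier (galois_group L K))
      ((BijGroup L)\<lparr>carrier := carrier (galois_group L F)\<rparr>)"
    using group.subgroup_incl[OF group_BijGroup galois_group_subgroup_BijGroup[OF assms(1,3)]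
        galois_group_subgroup_BijGroup[OF assms(1) FL]] by simp
  then show ?thesis by (simp add: galois_group_def)
qed

end

theory Submission
  imports Defs
begin

text \<open>
  Let \<open>M\<close> be the \<open>S\<^sub>4\<close>-field generated by the square roots \<open>s\<^sub>1, s\<^sub>2, s\<^sub>3\<close> of the conjugates of
  \<open>2\<^sup>1\<^sup>/\<^sup>3 - 1\<close>, whose product is \<open>1\<close>. With \<open>\<gamma> = (s\<^sub>1 + s\<^sub>2) (s\<^sub>2 + s\<^sub>3) (s\<^sub>3 + s\<^sub>1)\<close> the field
  \<open>M(\<surd>(2 \<gamma>))\<close> is the 3-division field of \<open>y\<^sup>2 = x\<^sup>3 + 3 x - 2\<close>, with group \<open>GL\<^sub>2(3)\<close>. Twisting by
  \<open>\<rho> = 6\<^sup>1\<^sup>/\<^sup>4\<close>, let \<open>\<theta> = \<surd>(\<gamma> \<rho>)\<close>; then \<open>K\<^sub>1 = \<rat>(\<theta>)\<close> and \<open>K\<^sub>2 = \<rat>(\<surd>2 \<theta>)\<close> have a common Galois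
  closure \<open>L\<close> of degree 384. Its group is an amalgam of \<open>GL\<^sub>2(3)\<close> and the holomorph of \<open>\<int>/8\<close>, and the
  twist by \<open>\<surd>2\<close> is the one of the Grunwald-Wang phenomenon: \<open>16 = (\<surd>2)\<^sup>8\<close> is an eighth power locally
  almost everywhere, but not globally.

  The conjugates of \<open>\<theta>\<close> are the \<open>32\<close> products of eighth roots of unity with four square roots
  \<open>\<theta>\<^sub>j\<close> of conjugates of \<open>\<gamma> \<rho>\<close>; they form four fibres of size eight. An equivariant integer matrix has, by
  summation over fibres, a \<open>4 \<times> 4\<close> image with diagonal entries \<open>D\<close> and off-diagonal entries \<open>U\<close>. Here
  \<open>D\<close> is even, because the stabiliser of \<open>\<surd>2 \<theta>\<close> has no fixed point in the fibre of \<open>\<theta>\<close>; but an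
  invertible matrix would have \<open>D - U = \<plusminus>1\<close> and \<open>D + 3 U = \<plusminus>1\<close>, forcing \<open>U = 0\<close> and \<open>D = \<plusminus>1\<close>.
  On the other hand there are two pairs of equivariant matrices whose products are \<open>3\<close> and \<open>55\<close>, and these
  give isomorphisms over \<open>\<int>\<^sub>p\<close> for \<open>p \<noteq> 3\<close> and for \<open>p = 3\<close>.
\<close>

section \<open>Subfields of the complex numbers and their embeddings\<close>

text \<open>Since \<open>rho ^ 4 = 6\<close>, the twist makes \<open>th0\<close> an eighth root of
  \<open>6 * gam s1 s2 ^ 4\<close>, and \<open>r2 * th0\<close> is an eighth root of 16 times this
  number. Invariant matrices have eight free entries, one for each orbit of pairs of labels. On the
  fibres such a matrix has the eigenvalues \<open>D - U\<close>, three times, and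
  \<open>D + 3 * U\<close>; invertibility at \<open>p\<close> requires both to be units there. For
  \<open>D = 0\<close>, \<open>U = 1\<close> they are -1 and 3, which excludes only
  \<open>p = 3\<close>; for \<open>D = 2\<close>, \<open>U = 1\<close> they are 1 and 5, which
  serves at 3. The obstacle is to know the group well enough to control all invariant matrices. No
  group order is computed: \<open>L\<close> is a tower of seven quadratic steps over the cubic field
  of \<open>cbrt2\<close>, each shown to be proper, so that every tuple of images of the eight
  generators that respects the defining relations gives an embedding. A few such tuples cut the
  fixed field down to the rationals, and five of them generate the group. Everything about orbits
  and matrices then becomes a computation with 32 labels.\<close>

definition cfield :: "complex set \<Rightarrow> bool" where
  "cfield F \<longleftrightarrow> 1 \<in> F \<and> (\<forall>x\<in>F. \<forall>y\<in>F. x - y \<in> F \<and> x * y \<in> F) \<and> (\<forall>x\<in>F. inverse x \<in> F)"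

lemma complex_ring_simps [simp]:
  "carrier complex_ring = UNIV" "x \<otimes>\<^bsub>complex_ring\<^esub> y = x * y" "x \<oplus>\<^bsub>complex_ring\<^esub> y = x + y"
  "\<one>\<^bsub>complex_ring\<^esub> = 1" "\<zero>\<^bsub>complex_ring\<^esub> = 0"
  by (simp_all add: ring_of_type_algebra_def)

interpretation CR: ring complex_ring by (rule ring_from_type_algebra)

lemma complex_ring_minus [simp]: "\<ominus>\<^bsub>complex_ring\<^esub> x = - x"
  by (rule CR.minus_equality) auto

lemma complex_ring_inv: "x \<noteq> 0 \<Longrightarrow> inv\<^bsub>complex_ring\<^esub> x = inverse x"
  by (rule comm_monoid.comm_inv_char[OF cring.axioms(2)[OF cring_from_type_algebra]]) auto

context
  fixes F assumes F: "cfield F"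
begin

lemma cfield_1: "1 \<in> F" and cfield_diff: "x \<in> F \<Longrightarrow> y \<in> F \<Longrightarrow> x - y \<in> F"
  and cfield_mult: "x \<in> F \<Longrightarrow> y \<in> F \<Longrightarrow> x * y \<in> F" and cfield_inverse: "x \<in> F \<Longrightarrow> inverse x \<in> F"
  using F by (auto simp: cfield_def)

lemma cfield_0: "0 \<in> F" using cfield_diff[OF cfield_1 cfield_1] by simp

lemma cfield_minus: "x \<in> F \<Longrightarrow> - x \<in> F" using cfield_diff[OF cfield_0] by fastforce

lemma cfield_add: "x \<in> F \<Longrightarrow> y \<in> F \<Longrightarrow> x + y \<in> F"
  using cfield_diff[OF _ cfield_minus, of x y] by simp

lemma cfield_divide: "x \<in> F \<Longrightarrow> y \<in> F \<Longrightarrow> x / y \<in> F"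
  by (simp add: divide_inverse cfield_mult cfield_inverse)

lemma cfield_power: "x \<in> F \<Longrightarrow> x ^ n \<in> F"
  by (induction n) (auto simp: cfield_1 cfield_mult)

lemma cfield_of_nat: "of_nat n \<in> F"
  by (induction n) (auto simp: cfield_0 cfield_1 cfield_add)

lemma cfield_numeral: "numeral n \<in> F"
  using cfield_of_nat[of "numeral n"] by simp

lemma cfield_Rats: "\<rat> \<subseteq> F"
proof
  fix x :: complex assume "x \<in> \<rat>"
  then obtain a b :: int where "x = of_int a / of_int b" by (auto elim: Rats_cases')
  moreover have "of_int a \<in> F" for a
    by (cases a rule: int_cases2) (auto simp: cfield_of_nat cfield_minus)
  ultimately show "x \<in> F" by (simp add: cfield_divide)
qed

lemma cfield_of_rat: "of_rat q \<in> F"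
  using cfield_Rats by auto

lemmas cfield_intros = cfield_1 cfield_0 cfield_diff cfield_mult cfield_inverse cfield_minus cfield_add
  cfield_divide cfield_power cfield_of_nat cfield_numeral cfield_of_rat

end

lemma cfield_imp_subfield: assumes "cfield F" shows "subfield F complex_ring"
proof (rule field.subfieldI'[OF field_from_type_algebra CR.subringI])
qed (use assms in \<open>auto simp: cfield_intros complex_ring_inv\<close>)

lemma cfield_iff_subfield: "subfield F complex_ring \<longleftrightarrow> cfield F"
proof
  assume F: "subfield F complex_ring"
  then have s: "subring F complex_ring" by (simp add: subfield_def subdomain_def subcring.axioms(1))
  have sub: "x - y \<in> F" if "x \<in> F" "y \<in> F" for x y
    using subringE(7)[OF s that(1) subringE(5)[OF s that(2)]] by simp
  have inv: "inverse x \<in> F" if "x \<in> F" for x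
  proof (cases "x = 0")
    case False
    then have "x \<in> Units (complex_ring\<lparr>carrier := F\<rparr>)"
      using that subfield.subfield_Units[OF F] by simp
    then obtain y where y: "y \<in> F" "x * y = 1" by (auto simp: Units_def)
    then have "inverse x = y" using False by (simp add: field_simps)
    then show ?thesis using y by simp
  qed (use that in simp)
  show "cfield F"
    using subringE(3,6)[OF s] sub inv by (auto simp: cfield_def)
qed (rule cfield_imp_subfield)

lemma cfield_Rats_cfield: "cfield \<rat>"
  by (auto simp: cfield_def)

text \<open>An embedding of \<open>F\<close> into the complex numbers, carried by a total function
  whose values outside \<open>F\<close> are arbitrary. Injectivity, compatibility with inverses and
  the identity on the rationals follow, so that an extension only has to be checked on 1, sums and
  products.\<close>

definition chom :: "complex set \<Rightarrow> (complex \<Rightarrow> complex) \<Rightarrow> bool" where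
  "chom F \<sigma> \<longleftrightarrow> \<sigma> 1 = 1 \<and> (\<forall>x\<in>F. \<forall>y\<in>F. \<sigma> (x + y) = \<sigma> x + \<sigma> y \<and> \<sigma> (x * y) = \<sigma> x * \<sigma> y)"

context
  fixes F \<sigma> assumes F: "cfield F" and \<sigma>: "chom F \<sigma>"
begin

lemma chom_1: "\<sigma> 1 = 1" and chom_add: "x \<in> F \<Longrightarrow> y \<in> F \<Longrightarrow> \<sigma> (x + y) = \<sigma> x + \<sigma> y"
  and chom_mult: "x \<in> F \<Longrightarrow> y \<in> F \<Longrightarrow> \<sigma> (x * y) = \<sigma> x * \<sigma> y"
  using \<sigma> by (auto simp: chom_def)

lemma chom_0: "\<sigma> 0 = 0"
  using chom_add[OF cfield_0[OF F] cfield_0[OF F]] by simp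

lemma chom_minus: "x \<in> F \<Longrightarrow> \<sigma> (- x) = - \<sigma> x"
  using chom_add[OF _ cfield_minus[OF F], of x x] by (simp add: chom_0 eq_neg_iff_add_eq_0 add.commute)

lemma chom_diff: "x \<in> F \<Longrightarrow> y \<in> F \<Longrightarrow> \<sigma> (x - y) = \<sigma> x - \<sigma> y"
  using chom_add[OF _ cfield_minus[OF F], of x y] by (simp add: chom_minus)

lemma chom_nonzero: "x \<in> F \<Longrightarrow> x \<noteq> 0 \<Longrightarrow> \<sigma> x \<noteq> 0"
  using chom_mult[OF _ cfield_inverse[OF F], of x x] by (auto simp: chom_1)

lemma chom_inj: "inj_on \<sigma> F"
proof (rule inj_onI)
  fix x y assume "x \<in> F" "y \<in> F" "\<sigma> x = \<sigma> y"
  then show "x = y" using chom_nonzero[of "x - y"] by (auto simp: chom_diff cfield_diff[OF F])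
qed

lemma chom_inverse: assumes "x \<in> F" shows "\<sigma> (inverse x) = inverse (\<sigma> x)"
proof (cases "x = 0")
  case False
  then have "\<sigma> x * \<sigma> (inverse x) = 1"
    using chom_mult[OF assms cfield_inverse[OF F assms]] by (simp add: chom_1)
  then show ?thesis using chom_nonzero[OF assms False] by (simp add: field_simps)
qed (simp add: chom_0)

lemma chom_divide: "x \<in> F \<Longrightarrow> y \<in> F \<Longrightarrow> \<sigma> (x / y) = \<sigma> x / \<sigma> y"
  by (simp add: divide_inverse chom_mult chom_inverse cfield_inverse[OF F])

lemma chom_power: "x \<in> F \<Longrightarrow> \<sigma> (x ^ n) = \<sigma> x ^ n"
  by (induction n) (auto simp: chom_1 chom_mult cfield_power[OF F])

lemma chom_of_nat: "\<sigma> (of_nat n) = of_nat n"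
  by (induction n) (auto simp: chom_0 chom_1 chom_add cfield_of_nat[OF F] cfield_1[OF F])

lemma chom_numeral: "\<sigma> (numeral n) = numeral n"
  using chom_of_nat[of "numeral n"] by simp

lemma chom_of_rat: "\<sigma> (of_rat q) = of_rat q"
proof -
  have i: "\<sigma> (of_int a) = of_int a" for a
    by (cases a rule: int_cases2) (auto simp: chom_of_nat chom_minus cfield_of_nat[OF F])
  have "of_int a \<in> F" for a using cfield_of_rat[OF F, of "of_int a"] by simp
  then show ?thesis by (cases q) (simp add: of_rat_rat chom_divide i)
qed

lemmas chom_simps = chom_1 chom_0 chom_add chom_mult chom_minus chom_diff chom_inverse chom_divide
  chom_power chom_of_nat chom_numeral chom_of_rat

end

lemma chom_Rats: "cfield F \<Longrightarrow> chom F \<sigma> \<Longrightarrow> x \<in> \<rat> \<Longrightarrow> \<sigma> x = x"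
  by (auto elim!: Rats_cases simp: chom_of_rat)

lemma chom_subset: "chom F \<sigma> \<Longrightarrow> E \<subseteq> F \<Longrightarrow> chom E \<sigma>"
  by (auto simp: chom_def subset_iff)

section \<open>Quadratic extensions\<close>

definition adj :: "complex set \<Rightarrow> complex \<Rightarrow> complex set" where
  "adj F e = {u + v * e | u v. u \<in> F \<and> v \<in> F}"

lemma adjI: "u \<in> F \<Longrightarrow> v \<in> F \<Longrightarrow> u + v * e \<in> adj F e"
  by (auto simp: adj_def)

lemma adj_subset: assumes "cfield F" shows "F \<subseteq> adj F e"
proof
  fix x assume "x \<in> F"
  then show "x \<in> adj F e" using adjI[of x F 0 e] cfield_0[OF assms] by simp
qed

lemma adj_gen: "cfield F \<Longrightarrow> e \<in> adj F e"
  using adjI[of 0 F 1 e] by (simp add: cfield_intros)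

lemma cfield_adj:
  assumes F: "cfield F" and e: "e\<^sup>2 \<in> F"
  shows "cfield (adj F e)"
  unfolding cfield_def
proof (intro conjI ballI)
  note [intro] = cfield_intros[OF F] e
  show "1 \<in> adj F e" using adj_subset[OF F] cfield_1[OF F] by auto
  fix x assume "x \<in> adj F e"
  then obtain u v where x: "x = u + v * e" "u \<in> F" "v \<in> F" by (auto simp: adj_def)
  show "inverse x \<in> adj F e"
  \<comment> \<open>As \<open>e\<close> may lie in \<open>F\<close>, the norm
    \<open>u\<^sup>2 - v\<^sup>2 * e\<^sup>2\<close> can vanish for nonzero \<open>x\<close>. This
    happens only for \<open>u = v * e\<close>, and then \<open>x = 2 * u\<close> is in
    \<open>F\<close>. Otherwise conjugate over norm is the inverse, even for \<open>x = 0\<close>,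
    where both sides are 0.\<close>
  proof (cases "u = v * e")
    case True
    then have "inverse x = inverse (2 * u)" by (simp add: x)
    also have "\<dots> \<in> F" using x by auto
    finally show ?thesis using adj_subset[OF F] by auto
  next
    case False
    define d where "d = inverse (u\<^sup>2 - v\<^sup>2 * e\<^sup>2)"
    have d: "d \<in> F" unfolding d_def using x by auto
    have "inverse x = (u - v * e) * d"
    proof (cases "x = 0")
      case True
      then have "u = - (v * e)" by (simp add: x eq_neg_iff_add_eq_0)
      then have "u\<^sup>2 = v\<^sup>2 * e\<^sup>2" by (simp add: power_mult_distrib)
      then show ?thesis using True by (simp add: d_def)
    next
      case nz: False
      have "u\<^sup>2 - v\<^sup>2 * e\<^sup>2 = x * (u - v * e)" by (simp add: x algebra_simps power2_eq_square)
      then have "d = inverse x * inverse (u - v * e)" by (simp add: d_def)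
      then show ?thesis using False by simp
    qed
    also have "\<dots> = u * d + (- v * d) * e" by (simp add: algebra_simps)
    also have "\<dots> \<in> adj F e" using x d by (intro adjI) auto
    finally show ?thesis .
  qed
  fix y assume "y \<in> adj F e"
  then obtain a b where y: "y = a + b * e" "a \<in> F" "b \<in> F" by (auto simp: adj_def)
  have "x - y = (u - a) + (v - b) * e" by (simp add: x y algebra_simps)
  also have "\<dots> \<in> adj F e" using x y by (intro adjI) auto
  finally show "x - y \<in> adj F e" .
  have "x * y = (u * a + v * b * e\<^sup>2) + (u * b + v * a) * e"
    by (simp add: x y algebra_simps power2_eq_square)
  also have "\<dots> \<in> adj F e" using x y by (intro adjI) auto
  finally show "x * y \<in> adj F e" .
qed

lemma adj_unique:
  assumes "cfield F" "e \<notin> F" "u \<in> F" "v \<in> F" "a \<in> F" "b \<in> F" "u + v * e = a + b * e"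
  shows "u = a \<and> v = b"
proof -
  have "v = b"
  proof (rule ccontr)
    assume "v \<noteq> b"
    then have "e = (a - u) / (v - b)" using assms(7) by (simp add: field_simps)
    then show False using assms by (metis cfield_diff cfield_divide)
  qed
  then show ?thesis using assms(7) by simp
qed

text \<open>Coordinates with respect to 1 and \<open>e\<close> are unique in a proper quadratic
  step, so \<open>e\<close> may be sent to either square root of
  \<open>\<sigma> (e\<^sup>2)\<close>. This choice of sign at each step is the source of all
  automorphisms below.\<close>

lemma adj_hom_extend:
  assumes F: "cfield F" and e: "e \<notin> F" "e\<^sup>2 \<in> F" and \<sigma>: "chom F \<sigma>" and y: "y\<^sup>2 = \<sigma> (e\<^sup>2)"
  shows "\<exists>\<tau>. chom (adj F e) \<tau> \<and> \<tau> e = y \<and> (\<forall>u\<in>F. \<tau> u = \<sigma> u)"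
proof -
  note [simp] = cfield_intros[OF F] chom_simps[OF F \<sigma>] and [simp] = e
  define \<tau> where "\<tau> x = (THE z. \<exists>u\<in>F. \<exists>v\<in>F. x = u + v * e \<and> z = \<sigma> u + \<sigma> v * y)" for x
  have \<tau>: "\<tau> (u + v * e) = \<sigma> u + \<sigma> v * y" if "u \<in> F" "v \<in> F" for u v
    unfolding \<tau>_def using that adj_unique[OF F e(1)] by (intro the_equality) (blast, metis)
  have \<tau>F: "\<tau> u = \<sigma> u" if "u \<in> F" for u
    using \<tau>[of u 0] that by simp
  have "\<tau> e = y" using \<tau>[of 0 1] by simp
  moreover have "chom (adj F e) \<tau>"
    unfolding chom_def
  proof (intro conjI ballI)
    show "\<tau> 1 = 1" by (simp add: \<tau>F)
    fix x z assume "x \<in> adj F e" "z \<in> adj F e"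
    then obtain u v a b where x: "x = u + v * e" "u \<in> F" "v \<in> F" and z: "z = a + b * e" "a \<in> F" "b \<in> F"
      by (auto simp: adj_def)
    have s: "x + z = (u + a) + (v + b) * e" by (simp add: x z algebra_simps)
    have "\<tau> (x + z) = (\<sigma> u + \<sigma> a) + (\<sigma> v + \<sigma> b) * y"
      unfolding s using x z \<tau>[of "u + a" "v + b"] by simp
    also have "\<dots> = (\<sigma> u + \<sigma> v * y) + (\<sigma> a + \<sigma> b * y)" by (simp add: algebra_simps)
    finally show "\<tau> (x + z) = \<tau> x + \<tau> z" using x z by (simp add: \<tau>)
    have "x * z = (u * a + v * b * e\<^sup>2) + (u * b + v * a) * e"
      by (simp add: x z algebra_simps power2_eq_square)
    then have "\<tau> (x * z) = (\<sigma> u * \<sigma> a + \<sigma> v * \<sigma> b * y\<^sup>2) + (\<sigma> u * \<sigma> b + \<sigma> v * \<sigma> a) * y"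
      using x z by (simp add: \<tau> y)
    also have "\<dots> = (\<sigma> u + \<sigma> v * y) * (\<sigma> a + \<sigma> b * y)" by (simp add: algebra_simps power2_eq_square)
    also have "\<dots> = \<tau> x * \<tau> z" using x z by (simp add: \<tau>)
    finally show "\<tau> (x * z) = \<tau> x * \<tau> z" .
  qed
  ultimately show ?thesis using \<tau>F by blast
qed

text \<open>Kummer theory for one quadratic step: \<open>r\<^sup>2\<close> contains the mixed term
  \<open>2 * u * v * e\<close>, so if \<open>u\<close> and \<open>v\<close> are both nonzero,
  \<open>e\<close> and with it \<open>r\<close> lie in \<open>F\<close>.\<close>

lemma sqrt_in_adj:
  assumes F: "cfield F" and e: "e\<^sup>2 \<in> F" and r: "r\<^sup>2 \<in> F" "r \<in> adj F e"
  shows "r \<in> F \<or> (\<exists>v\<in>F. r = v * e)"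
proof -
  note [intro] = cfield_intros[OF F]
  obtain u v where x: "r = u + v * e" "u \<in> F" "v \<in> F" using r by (auto simp: adj_def)
  show ?thesis
  proof (cases "u = 0 \<or> v = 0")
    case False
    have "r\<^sup>2 = u\<^sup>2 + v\<^sup>2 * e\<^sup>2 + 2 * u * v * e" by (simp add: x algebra_simps power2_eq_square)
    then have "e = (r\<^sup>2 - u\<^sup>2 - v\<^sup>2 * e\<^sup>2) / (2 * u * v)" using False by (simp add: field_simps)
    also have "\<dots> \<in> F" using x e r by auto
    finally show ?thesis using x by auto
  qed (use x in auto)
qed

lemma adj_fixed:
  assumes F: "cfield F" and e: "e\<^sup>2 \<in> F" and \<sigma>: "chom (adj F e) \<sigma>" "\<And>u. u \<in> F \<Longrightarrow> \<sigma> u = u" "\<sigma> e = - e"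
    and x: "x \<in> adj F e" "\<sigma> x = x"
  shows "x \<in> F"
proof -
  obtain u v where uv: "x = u + v * e" "u \<in> F" "v \<in> F" using x by (auto simp: adj_def)
  have "\<sigma> x = u - v * e"
    using uv adj_subset[OF F, of e] adj_gen[OF F, of e] \<sigma>(2,3)
    by (auto simp: chom_simps[OF cfield_adj[OF F e] \<sigma>(1)] subset_iff cfield_mult[OF cfield_adj[OF F e]])
  then have "v * e = 0" using x uv by auto
  then show ?thesis using uv by auto
qed

lemma adj_finite_dimension:
  assumes F: "cfield F" and d: "CR.finite_dimension \<rat> F" and e: "e\<^sup>2 \<in> F"
  shows "CR.finite_dimension \<rat> (adj F e)"
proof -
  have "CR.Span F [e] = {v * e | v. v \<in> F}"
    by (auto simp: CR.line_extension_mem_iff)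
  then have "x \<in> adj F e \<longleftrightarrow> x \<in> CR.Span F [1, e]" for x
    unfolding adj_def by (simp add: CR.line_extension_mem_iff) metis
  then have "adj F e = CR.Span F [1, e]" by blast
  then have "CR.finite_dimension F (adj F e)"
    using CR.Span_finite_dimension[OF cfield_imp_subfield[OF F], of "[1, e]"] by simp
  then show ?thesis
    using CR.telescopic_base_dim(1)[OF cfield_imp_subfield[OF cfield_Rats_cfield] cfield_imp_subfield[OF F] d] by simp
qed


section \<open>Simple extensions of the rationals\<close>

definition rpoly :: "rat poly \<Rightarrow> complex \<Rightarrow> complex" where
  "rpoly p = poly (map_poly of_rat p)"

lemma rpoly_0 [simp]: "rpoly 0 x = 0"
  and rpoly_pCons [simp]: "rpoly (pCons a p) x = of_rat a + x * rpoly p x"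
  by (simp_all add: rpoly_def map_poly_pCons)

lemma rpoly_add [simp]: "rpoly (p + q) x = rpoly p x + rpoly q x"
  by (induction p q rule: poly_induct2) (auto simp: of_rat_add algebra_simps)

lemma rpoly_smult [simp]: "rpoly (smult a p) x = of_rat a * rpoly p x"
  by (induction p) (auto simp: of_rat_mult algebra_simps)

lemma rpoly_mult [simp]: "rpoly (p * q) x = rpoly p x * rpoly q x"
  by (induction p) (auto simp: algebra_simps)

lemma rpoly_1 [simp]: "rpoly 1 x = 1"
  by (simp add: one_pCons)

lemma rpoly_diff [simp]: "rpoly (p - q) x = rpoly p x - rpoly q x"
  using rpoly_add[of "p - q" q x] by simp

lemma rpoly_monom [simp]: "rpoly (monom a n) x = of_rat a * x ^ n"
  by (simp add: rpoly_def map_poly_monom poly_monom)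

lemma rpoly_hom:
  assumes "cfield F" "chom F \<sigma>" "x \<in> F"
  shows "rpoly p x \<in> F \<and> \<sigma> (rpoly p x) = rpoly p (\<sigma> x)"
  using assms by (induction p) (auto simp: chom_simps[OF assms(1,2)] cfield_intros)

text \<open>A generator of the ideal of rational polynomials that vanish at \<open>x\<close>. It is
  determined up to a scalar and not normalised to be monic.\<close>

definition min_poly :: "rat poly \<Rightarrow> complex \<Rightarrow> bool" where
  "min_poly m x \<longleftrightarrow> m \<noteq> 0 \<and> (\<forall>p. rpoly p x = 0 \<longleftrightarrow> m dvd p)"

lemma min_polyI:
  assumes m: "m \<noteq> 0" "rpoly m x = 0" and min: "\<And>p. p \<noteq> 0 \<Longrightarrow> rpoly p x = 0 \<Longrightarrow> degree m \<le> degree p"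
  shows "min_poly m x"
  unfolding min_poly_def
proof (intro conjI allI iffI)
  fix p assume p: "rpoly p x = 0"
  have "rpoly (p mod m) x = rpoly p x - rpoly (p div m) x * rpoly m x"
    by (metis minus_div_mult_eq_mod rpoly_diff rpoly_mult)
  then have "rpoly (p mod m) x = 0" using p m by simp
  then have "p mod m = 0" using min[of "p mod m"] degree_mod_less[OF m(1), of p] by fastforce
  then show "m dvd p" by auto
qed (use m in auto)

text \<open>The ring of rational polynomials in \<open>x\<close>, which for algebraic
  \<open>x\<close> is the field generated by \<open>x\<close>.\<close>

definition qadj :: "complex \<Rightarrow> complex set" where
  "qadj x = range (\<lambda>p. rpoly p x)"

lemma qadj_gen: "x \<in> qadj x"
  unfolding qadj_def by (rule range_eqI[of _ _ "[:0, 1:]"]) simp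

lemma qadj_minimal: "cfield M \<Longrightarrow> x \<in> M \<Longrightarrow> qadj x \<subseteq> M"
  using rpoly_hom[of M id x] by (auto simp: qadj_def chom_def)

lemma cfield_qadj:
  assumes m: "min_poly m x"
  shows "cfield (qadj x)"
  unfolding cfield_def
proof (intro conjI ballI)
  show "1 \<in> qadj x" unfolding qadj_def by (rule range_eqI[of _ _ 1]) simp
  fix y assume "y \<in> qadj x"
  then obtain p where p: "y = rpoly p x" by (auto simp: qadj_def)
  show "inverse y \<in> qadj x"
  proof (cases "y = 0")
    case True
    then show ?thesis unfolding qadj_def by (intro range_eqI[of _ _ 0]) simp
  next
    case False
    obtain u v where uv: "u * p + v * m = gcd p m"
      using bezout_coefficients_fst_snd by blast
    have "rpoly m x = 0" using m by (simp add: min_poly_def)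
    then have g: "rpoly (gcd p m) x = rpoly u x * y"
      using arg_cong[OF uv, of "\<lambda>q. rpoly q x"] by (simp add: p)
    \<comment> \<open>The gcd does not vanish at \<open>x\<close>, since otherwise \<open>m\<close>
      would divide it and hence \<open>p\<close>. So the cofactor \<open>h\<close> vanishes there,
      is a multiple of \<open>m\<close>, and leaves degree 0 for the gcd: \<open>p\<close> is
      invertible modulo \<open>m\<close>.\<close>
    obtain h where h: "m = gcd p m * h" by (metis dvd_def gcd_dvd2)
    have "rpoly (gcd p m) x \<noteq> 0"
      using m False p by (meson dvd_trans gcd_dvd1 min_poly_def)
    then have "rpoly h x = 0" using arg_cong[OF h, of "\<lambda>q. rpoly q x"] \<open>rpoly m x = 0\<close> by simp
    then have "m dvd h" using m by (simp add: min_poly_def)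
    then have "degree m \<le> degree h" using m h by (metis dvd_imp_degree_le min_poly_def mult_zero_right)
    moreover have "degree m = degree (gcd p m) + degree h"
      using m h by (metis degree_mult_eq min_poly_def mult_eq_0_iff)
    ultimately obtain c where c: "gcd p m = [:c:]" by (metis add_le_same_cancel2 degree_eq_zeroE le_zero_eq)
    have c0: "of_rat c \<noteq> (0::complex)" using c \<open>rpoly (gcd p m) x \<noteq> 0\<close> by simp
    have gc: "of_rat c = rpoly u x * y" using g unfolding c by simp
    then have "rpoly u x \<noteq> 0" using c0 by auto
    then have "inverse y = of_rat (inverse c) * rpoly u x"
      using False by (simp add: of_rat_inverse gc)
    then show ?thesis unfolding qadj_def by (intro range_eqI[of _ _ "smult (inverse c) u"]) simp
  qed
  fix z assume "z \<in> qadj x"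
  then obtain q where q: "z = rpoly q x" by (auto simp: qadj_def)
  show "y - z \<in> qadj x" "y * z \<in> qadj x"
    unfolding qadj_def p q by (metis rangeI rpoly_diff) (metis rangeI rpoly_mult)
qed

lemma qadj_hom_extend:
  assumes m: "min_poly m x" and y: "rpoly m y = 0"
  shows "\<exists>\<tau>. chom (qadj x) \<tau> \<and> \<tau> x = y"
proof -
  define \<tau> where "\<tau> z = rpoly (SOME p. z = rpoly p x) y" for z
  have \<tau>: "\<tau> (rpoly p x) = rpoly p y" for p
  proof -
    define q where "q = (SOME q. rpoly p x = rpoly q x)"
    have "rpoly p x = rpoly q x" unfolding q_def by (rule someI) simp
    then have "rpoly (p - q) x = 0" by simp
    then have "m dvd p - q" using m unfolding min_poly_def by blast
    then obtain r where r: "p - q = m * r" by (auto elim: dvdE)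
    have "rpoly (p - q) y = 0" unfolding r by (simp add: y)
    then show ?thesis by (simp add: \<tau>_def q_def)
  qed
  have "chom (qadj x) \<tau>"
    unfolding chom_def
  proof (intro conjI ballI)
    show "\<tau> 1 = 1" using \<tau>[of 1] by simp
    fix a b assume "a \<in> qadj x" "b \<in> qadj x"
    then obtain p q where "a = rpoly p x" "b = rpoly q x" by (auto simp: qadj_def)
    then show "\<tau> (a + b) = \<tau> a + \<tau> b" "\<tau> (a * b) = \<tau> a * \<tau> b"
      using \<tau>[of "p + q"] \<tau>[of "p * q"] by (simp_all add: \<tau>)
  qed
  moreover have "\<tau> x = y" using \<tau>[of "[:0, 1:]"] by simp
  ultimately show ?thesis by blast
qed

text \<open>\<open>E n\<close> collects the values of polynomials of degree below \<open>n\<close>.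
  For \<open>n < degree m\<close> the power \<open>x ^ n\<close> adds one dimension, because a
  relation would be a nonzero polynomial of degree \<open>n\<close> divisible by \<open>m\<close>;
  for \<open>n = degree m\<close> division by \<open>m\<close> shows that \<open>E n\<close> is
  everything.\<close>

lemma qadj_dimension:
  assumes m: "min_poly m x"
  shows "CR.dimension (degree m) \<rat> (qadj x)"
proof -
  define E where "E n = {rpoly p x | p. p = 0 \<or> degree p < n}" for n
  have "n \<le> degree m \<Longrightarrow> CR.dimension n \<rat> (E n)" for n
  proof (induction n)
    case 0
    have "E 0 = {\<zero>\<^bsub>complex_ring\<^esub>}" by (auto simp: E_def intro: exI[of _ 0])
    then show ?case using CR.zero_dim by simp
  next
    case (Suc n)
    have "x ^ n \<notin> E n"
    proof
      assume "x ^ n \<in> E n"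
      then obtain p where p: "x ^ n = rpoly p x" "p = 0 \<or> degree p < n" by (auto simp: E_def)
      then have d: "degree (monom 1 n - p) = n"
        using degree_add_eq_left[of "- p" "monom 1 n"] by (auto simp: degree_monom_eq)
      have "rpoly (monom 1 n - p) x = 0" using p by simp
      then have "m dvd monom 1 n - p" using m unfolding min_poly_def by blast
      moreover have "monom 1 n - p \<noteq> 0"
      proof
        assume "monom 1 n - p = 0"
        then have "p = monom 1 n" by simp
        then show False using p(2) by (simp add: degree_monom_eq)
      qed
      ultimately show False using d Suc.prems dvd_imp_degree_le[of m "monom 1 n - p"] by simp
    qed
    then have "CR.dimension (Suc n) \<rat> (CR.line_extension \<rat> (x ^ n) (E n))"
      using Suc by (intro CR.Suc_dim) auto
    moreover have "CR.line_extension \<rat> (x ^ n) (E n) = E (Suc n)"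
    proof (intro equalityI subsetI)
      fix y assume "y \<in> CR.line_extension \<rat> (x ^ n) (E n)"
      then obtain a p where y: "y = rpoly (monom a n + p) x" "p = 0 \<or> degree p < n"
        by (auto simp: CR.line_extension_mem_iff E_def elim!: Rats_cases)
      have "degree (monom a n + p) < Suc n"
        using y(2) by (metis degree_add_le degree_monom_le le_imp_less_Suc less_imp_le_nat degree_0 zero_le)
      then show "y \<in> E (Suc n)" using y(1) unfolding E_def by blast
    next
      fix y assume "y \<in> E (Suc n)"
      then obtain p where p: "y = rpoly p x" "degree p < Suc n"
        unfolding E_def using degree_0 rpoly_0 by fastforce
      define q where "q = p - monom (coeff p n) n"
      have "coeff q i = 0" if "n \<le> i" for i
        using that p by (cases "i = n") (auto simp: q_def coeff_eq_0)
      then have "q = 0 \<or> degree q < n" by (metis leading_coeff_0_iff not_le)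
      then have "rpoly q x \<in> E n" by (auto simp: E_def)
      moreover have "y = of_rat (coeff p n) * x ^ n + rpoly q x" by (simp add: p q_def)
      ultimately show "y \<in> CR.line_extension \<rat> (x ^ n) (E n)"
        unfolding CR.line_extension_mem_iff by (intro bexI[of _ "of_rat (coeff p n)"] bexI[of _ "rpoly q x"]) auto
    qed
    ultimately show ?case by simp
  qed
  moreover have "E (degree m) = qadj x"
  proof -
    have "rpoly p x \<in> E (degree m)" for p
    proof -
      have "rpoly p x = rpoly (p div m) x * rpoly m x + rpoly (p mod m) x"
        by (metis div_mult_mod_eq rpoly_add rpoly_mult)
      moreover have "rpoly m x = 0" using m by (simp add: min_poly_def)
      ultimately have "rpoly p x = rpoly (p mod m) x" by simp
      moreover have "p mod m = 0 \<or> degree (p mod m) < degree m"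
        using m by (intro degree_mod_less) (simp add: min_poly_def)
      ultimately show ?thesis by (auto simp: E_def)
    qed
    then show ?thesis by (auto simp: E_def qadj_def)
  qed
  ultimately show ?thesis by (metis order_refl)
qed

section \<open>Galois extensions of the rationals\<close>

abbreviation Gal :: "complex set \<Rightarrow> (complex \<Rightarrow> complex) set" where
  "Gal L \<equiv> carrier (galois_group L \<rat>)"

lemma Gal_mem:
  assumes L: "cfield L"
  shows "\<sigma> \<in> Gal L \<longleftrightarrow> \<sigma> \<in> extensional L \<and> bij_betw \<sigma> L L \<and> chom L \<sigma>"
proof -
  have Q: "\<forall>x\<in>\<rat>. \<sigma> x = x" if "chom L \<sigma>" using chom_Rats[OF L that] by blast
  have "\<sigma> \<in> Gal L \<longleftrightarrow> \<sigma> \<in> extensional L \<and> bij_betw \<sigma> L L \<and> \<sigma> \<in> L \<rightarrow> L \<and> chom L \<sigma> \<and> (\<forall>x\<in>\<rat>. \<sigma> x = x)"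
    by (simp add: galois_group_def Bij_def ring_iso_def ring_hom_def chom_def) blast
  then show ?thesis
    using Q bij_betw_imp_funcset by blast
qed

lemma galois_group_mult:
  assumes "cfield L" "\<sigma> \<in> Gal L" "\<tau> \<in> Gal L"
  shows "\<sigma> \<otimes>\<^bsub>galois_group L \<rat>\<^esub> \<tau> = compose L \<sigma> \<tau>"
  using assms by (auto simp: galois_group_def BijGroup_def)

lemma galois_group_group: "cfield L \<Longrightarrow> group (galois_group L \<rat>)"
  by (rule galois_group_is_group) (auto simp: cfield_iff_subfield cfield_Rats)

lemma Gal_closed: "cfield L \<Longrightarrow> \<sigma> \<in> Gal L \<Longrightarrow> x \<in> L \<Longrightarrow> \<sigma> x \<in> L"
  by (auto simp: Gal_mem bij_betwE)

lemma Gal_chom: "cfield L \<Longrightarrow> \<sigma> \<in> Gal L \<Longrightarrow> chom L \<sigma>"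
  by (simp add: Gal_mem)

lemma Gal_apply_mult:
  "cfield L \<Longrightarrow> \<sigma> \<in> Gal L \<Longrightarrow> \<tau> \<in> Gal L \<Longrightarrow> x \<in> L \<Longrightarrow> (\<sigma> \<otimes>\<^bsub>galois_group L \<rat>\<^esub> \<tau>) x = \<sigma> (\<tau> x)"
  by (simp add: galois_group_mult compose_eq)

lemma Gal_apply_one: assumes "cfield L" "x \<in> L" shows "\<one>\<^bsub>galois_group L \<rat>\<^esub> x = x"
  using assms by (simp add: galois_group_def BijGroup_def)

lemma Gal_apply_inv:
  assumes L: "cfield L" and \<sigma>: "\<sigma> \<in> Gal L" and x: "x \<in> L"
  shows "(inv\<^bsub>galois_group L \<rat>\<^esub> \<sigma>) (\<sigma> x) = x"
proof -
  interpret G: group "galois_group L \<rat>" using galois_group_group[OF L] .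
  have "(inv\<^bsub>galois_group L \<rat>\<^esub> \<sigma> \<otimes>\<^bsub>galois_group L \<rat>\<^esub> \<sigma>) x = x"
    using \<sigma> x L by (simp add: Gal_apply_one)
  then show ?thesis using Gal_apply_mult[OF L G.inv_closed[OF \<sigma>] \<sigma> x] by simp
qed

text \<open>An automorphism that fixes \<open>x\<close> fixes every rational polynomial in
  \<open>x\<close>. In this form the subgroups of the theorem become point stabilisers.\<close>

lemma Gal_qadj:
  assumes L: "cfield L" and x: "x \<in> L"
  shows "carrier (galois_group L (qadj x)) = {\<sigma> \<in> Gal L. \<sigma> x = x}"
proof -
  have "\<sigma> y = y" if "\<sigma> x = x" "chom L \<sigma>" "y \<in> qadj x" for \<sigma> y
    using that rpoly_hom[OF L that(2) x] by (auto simp: qadj_def)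
  moreover have "carrier (galois_group L (qadj x)) = {\<sigma> \<in> Gal L. \<forall>y\<in>qadj x. \<sigma> y = y}"
  proof -
    have "\<sigma> \<in> Gal L" if "\<sigma> \<in> carrier (galois_group L (qadj x))" for \<sigma>
      using that unfolding Gal_mem[OF L]
      by (auto simp: galois_group_def Bij_def ring_iso_def ring_hom_def chom_def)
    then show ?thesis by (auto simp: galois_group_def)
  qed
  ultimately show ?thesis using Gal_chom[OF L] qadj_gen[of x] by auto
qed

lemma finite_rpoly_roots: "p \<noteq> 0 \<Longrightarrow> finite {y. rpoly p y = 0}"
  unfolding rpoly_def by (rule poly_roots_finite) (simp add: map_poly_eq_0_iff)

text \<open>Polynomials of HOL-Algebra are coefficient lists with the leading coefficient in front.
  The claims on coefficients carry the nonzero leading entry over, so that a nontrivial relation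
  stays nontrivial.\<close>

lemma eval_as_rpoly:
  "set p \<subseteq> \<rat> \<Longrightarrow> \<exists>q. rpoly q x = CR.eval p x \<and> (\<forall>i\<ge>length p. coeff q i = 0) \<and>
    (p \<noteq> [] \<longrightarrow> of_rat (coeff q (length p - 1)) = hd p)"
proof (induction p)
  case (Cons a p)
  then obtain q where q: "rpoly q x = CR.eval p x" "\<forall>i\<ge>length p. coeff q i = 0"
    by auto
  obtain r where r: "a = of_rat r" using Cons.prems by (auto elim: Rats_cases)
  have pow: "x [^]\<^bsub>complex_ring\<^esub> (n::nat) = x ^ n" for n
    by (induction n) (auto simp: CR.nat_pow_Suc)
  show ?case
    by (rule exI[of _ "monom r (length p) + q"]) (auto simp: q r pow)
qed (auto intro!: exI[of _ 0])

lemma finite_dimension_imp_rpoly: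
  assumes L: "cfield L" and d: "CR.finite_dimension \<rat> L" and x: "x \<in> L"
  shows "\<exists>p. p \<noteq> 0 \<and> rpoly p x = 0"
proof -
  have Q: "subfield \<rat> complex_ring" by (rule cfield_imp_subfield[OF cfield_Rats_cfield])
  have "subring L complex_ring"
    using cfield_imp_subfield[OF L] by (simp add: subfield_def subdomain_def subcring.axioms(1))
  then have "(CR.algebraic over \<rat>) x"
    using CR.finite_dimension_imp_algebraic[OF Q _ d x] by simp
  then obtain p where p: "p \<in> carrier (\<rat>[X]\<^bsub>complex_ring\<^esub>)" "p \<noteq> []" "CR.eval p x = 0"
    using domain.algebraicE[OF field.axioms(1)[OF field_from_type_algebra] subfieldE(1)[OF Q], of x] by auto
  then have "set p \<subseteq> \<rat>" "hd p \<noteq> 0"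
    by (auto simp: univ_poly_def polynomial_def)
  with eval_as_rpoly[OF this(1), of x] p show ?thesis
    by (metis coeff_0 of_rat_0)
qed

text \<open>Surjectivity is the point: an element of \<open>L\<close> is a root of some nonzero
  rational polynomial, and the injective map \<open>\<sigma>\<close> permutes the finite set of
  roots of this polynomial in \<open>L\<close>.\<close>

lemma Gal_restrict:
  assumes L: "cfield L" and d: "CR.finite_dimension \<rat> L" and \<sigma>: "chom L \<sigma>" "\<sigma> ` L \<subseteq> L"
  shows "restrict \<sigma> L \<in> Gal L"
proof -
  have inj: "inj_on \<sigma> L" by (rule chom_inj[OF L \<sigma>(1)])
  have "x \<in> \<sigma> ` L" if x: "x \<in> L" for x
  proof -
    obtain p where p: "p \<noteq> 0" "rpoly p x = 0" using finite_dimension_imp_rpoly[OF L d x] by blast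
    define R where "R = {y \<in> L. rpoly p y = 0}"
    have fin: "finite R" using finite_rpoly_roots[OF p(1)] by (simp add: R_def)
    have "\<sigma> ` R \<subseteq> R" using \<sigma> rpoly_hom[OF L \<sigma>(1)] chom_0[OF L \<sigma>(1)] by (auto simp: R_def) metis
    then have "\<sigma> ` R = R"
      using fin inj by (intro endo_inj_surj) (auto simp: R_def inj_on_def)
    then show ?thesis using x p by (auto simp: R_def)
  qed
  then have "bij_betw \<sigma> L L" using inj \<sigma>(2) by (auto simp: bij_betw_def)
  then have "bij_betw (restrict \<sigma> L) L L" by (simp cong: bij_betw_cong)
  moreover have "chom L (restrict \<sigma> L)"
    using \<sigma>(1) by (auto simp: chom_def cfield_intros[OF L])
  ultimately show ?thesis by (simp add: Gal_mem[OF L])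
qed

definition conjugates :: "complex set \<Rightarrow> complex \<Rightarrow> complex set" where
  "conjugates L x = {\<sigma> x | \<sigma>. \<sigma> \<in> Gal L}"

lemma coeff_prod_hom:
  assumes L: "cfield L" and \<sigma>: "chom L \<sigma>" and S: "finite S" "S \<subseteq> L"
  shows "coeff (\<Prod>y\<in>S. [:- y, 1:]) i \<in> L \<and>
    coeff (\<Prod>y\<in>S. [:- \<sigma> y, 1:]) i = \<sigma> (coeff (\<Prod>y\<in>S. [:- y, 1:]) i)"
  using S
proof (induction S arbitrary: i rule: finite_induct)
  case empty
  then show ?case by (simp add: coeff_1 cfield_intros[OF L] chom_simps[OF L \<sigma>])
next
  case (insert y S)
  then have IH: "coeff (\<Prod>y\<in>S. [:- y, 1:]) i \<in> L"
      "coeff (\<Prod>y\<in>S. [:- \<sigma> y, 1:]) i = \<sigma> (coeff (\<Prod>y\<in>S. [:- y, 1:]) i)" for i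
    by auto
  show ?case
    using insert.hyps insert.prems
    by (cases i) (auto simp: IH coeff_pCons cfield_intros[OF L] chom_simps[OF L \<sigma>])
qed

lemma galois_extension_cfield: "galois_extension L \<rat> \<Longrightarrow> cfield L"
  by (simp add: galois_extension_def cfield_iff_subfield)

text \<open>The polynomial \<open>P\<close> with the conjugates as simple roots is mapped to itself
  by the group, so its coefficients lie in the fixed field \<rat>. A rational polynomial that
  vanishes at \<open>x\<close> vanishes at all conjugates, so none of smaller degree does. The
  degree of the field of \<open>x\<close> is thus the size of an orbit.\<close>

lemma conjugates_min_poly:
  assumes gal: "galois_extension L \<rat>" and x: "x \<in> L"
  shows "finite (conjugates L x) \<and>
    (\<exists>m. min_poly m x \<and> degree m = card (conjugates L x) \<and> {y. rpoly m y = 0} = conjugates L x)"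
proof -
  have L: "cfield L" and d: "CR.finite_dimension \<rat> L"
    and fixed: "{x \<in> L. \<forall>\<sigma>\<in>Gal L. \<sigma> x = x} = \<rat>"
    using gal by (auto simp: galois_extension_def cfield_iff_subfield)
  interpret G: group "galois_group L \<rat>" using galois_group_group[OF L] .
  have roots: "conjugates L x \<subseteq> {y. rpoly p y = 0}" if "rpoly p x = 0" for p
    using that rpoly_hom[OF L Gal_chom[OF L] x, of _ p] chom_0[OF L Gal_chom[OF L]]
    by (auto simp: conjugates_def)
  obtain p where "p \<noteq> 0" "rpoly p x = 0" using finite_dimension_imp_rpoly[OF L d x] by blast
  then have fin: "finite (conjugates L x)"
    using roots finite_rpoly_roots finite_subset by metis
  have OL: "conjugates L x \<subseteq> L" using x Gal_closed[OF L] by (auto simp: conjugates_def)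
  define P where "P = (\<Prod>y\<in>conjugates L x. [:- y, 1:])"
  have "coeff P i \<in> \<rat>" for i
  proof -
    have "\<sigma> (coeff P i) = coeff P i" if \<sigma>: "\<sigma> \<in> Gal L" for \<sigma>
    proof -
      have inj: "inj_on \<sigma> (conjugates L x)"
        using chom_inj[OF L Gal_chom[OF L \<sigma>]] OL by (rule inj_on_subset)
      have "\<sigma> ` conjugates L x \<subseteq> conjugates L x"
      proof
        fix y assume "y \<in> \<sigma> ` conjugates L x"
        then obtain \<tau> where "\<tau> \<in> Gal L" "y = \<sigma> (\<tau> x)" by (auto simp: conjugates_def)
        then show "y \<in> conjugates L x"
          using Gal_apply_mult[OF L \<sigma> _ x, of \<tau>] G.m_closed[OF \<sigma>, of \<tau>] unfolding conjugates_def
          by (metis (mono_tags, lifting) mem_Collect_eq)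
      qed
      then have "\<sigma> ` conjugates L x = conjugates L x"
        using fin inj by (intro endo_inj_surj) auto
      then have "P = (\<Prod>y\<in>conjugates L x. [:- \<sigma> y, 1:])"
        unfolding P_def using prod.reindex[OF inj, of "\<lambda>y. [:- y, 1:]"] by simp
      then show ?thesis
        using coeff_prod_hom[OF L Gal_chom[OF L \<sigma>] fin OL, of i] by (simp add: P_def)
    qed
    moreover have "coeff P i \<in> L"
      using coeff_prod_hom[OF L _ fin OL, of id i] by (simp add: P_def chom_def)
    ultimately show ?thesis using fixed by blast
  qed
  then have "\<forall>i. \<exists>q. coeff P i = of_rat q" by (auto elim: Rats_cases)
  then obtain q where q: "\<And>i. coeff P i = of_rat (q i)" by metis
  define m where "m = Abs_poly q"
  have "\<forall>\<^sub>\<infinity>i. q i = 0"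
    unfolding MOST_nat using q coeff_eq_0[of P] by (metis of_rat_eq_0_iff)
  then have "map_poly of_rat m = P"
    by (intro poly_eqI) (simp add: m_def coeff_map_poly Abs_poly_inverse q)
  then have mP: "rpoly m = poly P" "degree m = degree P"
    by (auto simp: rpoly_def degree_map_poly)
  have dP: "degree P = card (conjugates L x)"
    unfolding P_def by (subst degree_prod_eq_sum_degree) auto
  have mr: "{y. rpoly m y = 0} = conjugates L x"
    using fin by (auto simp: mP P_def poly_prod)
  have x_in: "x \<in> conjugates L x"
    using Gal_apply_one[OF L x] G.one_closed unfolding conjugates_def
    by (metis (mono_tags, lifting) mem_Collect_eq)
  have "min_poly m x"
  proof (rule min_polyI)
    show "m \<noteq> 0"
    proof
      assume "m = 0"
      then have "conjugates L x = UNIV" using mr by auto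
      then show False using fin infinite_UNIV_char_0 by metis
    qed
    show "rpoly m x = 0" using mr x_in by blast
    fix p :: "rat poly" assume p: "p \<noteq> 0" "rpoly p x = 0"
    have "card (conjugates L x) \<le> card {y. rpoly p y = 0}"
      using roots[OF p(2)] finite_rpoly_roots[OF p(1)] by (rule card_mono[rotated])
    also have "\<dots> \<le> degree p"
      using card_poly_roots_bound[of "map_poly of_rat p :: complex poly"] p(1)
      by (simp add: rpoly_def map_poly_eq_0_iff degree_map_poly)
    finally show "degree m \<le> degree p" by (simp add: mP dP)
  qed
  moreover have "degree m = card (conjugates L x)" by (simp add: mP(2) dP)
  ultimately show ?thesis using fin mr by blast
qed

lemma galois_extension_normal:
  assumes L: "galois_extension L \<rat>" "x \<in> L" and M: "galois_extension M \<rat>" "x \<in> M"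
  shows "conjugates L x \<subseteq> M"
proof -
  obtain m where m: "min_poly m x" "{y. rpoly m y = 0} = conjugates M x" using conjugates_min_poly[OF M] by blast
  obtain m' where m': "min_poly m' x" "{y. rpoly m' y = 0} = conjugates L x" using conjugates_min_poly[OF L] by blast
  have "m' dvd m" using m m' by (auto simp: min_poly_def)
  then have "conjugates L x \<subseteq> conjugates M x"
    unfolding m(2)[symmetric] m'(2)[symmetric] by (auto elim!: dvdE)
  also have "\<dots> \<subseteq> M" using M Gal_closed[OF galois_extension_cfield[OF M(1)]] by (auto simp: conjugates_def)
  finally show ?thesis .
qed

text \<open>A Galois extension containing \<open>x\<close> contains all conjugates of
  \<open>x\<close>, by comparison of minimal polynomials; so it suffices that these generate
  \<open>L\<close>.\<close>

lemma galois_closure_qadj: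
  assumes L: "galois_extension L \<rat>" "x \<in> L"
    and gen: "\<And>M. cfield M \<Longrightarrow> conjugates L x \<subseteq> M \<Longrightarrow> L \<subseteq> M"
  shows "galois_closure L (qadj x) \<rat>"
  unfolding galois_closure_def
  using assms qadj_minimal[OF galois_extension_cfield[OF L(1)] L(2)]
    galois_extension_normal[OF L] galois_extension_cfield qadj_gen[of x] by blast

lemma number_field_qadj:
  assumes L: "galois_extension L \<rat>" "x \<in> L"
  shows "number_field_of_degree (card (conjugates L x)) (qadj x)"
  unfolding number_field_of_degree_def
  using conjugates_min_poly[OF L] cfield_qadj qadj_dimension cfield_imp_subfield by metis

section \<open>Permutation modules of transitive actions\<close>

text \<open>A left action on points models the right action on cosets: \<open>x\<close> corresponds
  to the coset of all \<open>g\<close> that carry \<open>x\<close> to the base point, and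
  \<open>act g x\<close> to this coset times the inverse of \<open>g\<close>. With the inverse built
  into \<open>perm_act\<close>, acting on a coefficient function is evaluation at
  \<open>act g x\<close>.\<close>

locale pointed_action = group G for G (structure) +
  fixes V :: "'x set" and act :: "'a \<Rightarrow> 'x \<Rightarrow> 'x" and x0 :: 'x
  assumes finite_V: "finite V" and x0: "x0 \<in> V"
    and act_closed: "g \<in> carrier G \<Longrightarrow> x \<in> V \<Longrightarrow> act g x \<in> V"
    and act_mult: "g \<in> carrier G \<Longrightarrow> h \<in> carrier G \<Longrightarrow> x \<in> V \<Longrightarrow> act (g \<otimes> h) x = act g (act h x)"
    and act_one: "x \<in> V \<Longrightarrow> act \<one> x = x"
    and act_transitive: "x \<in> V \<Longrightarrow> \<exists>g\<in>carrier G. act g x = x0"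
begin

definition stab :: "'a set" where "stab = {g \<in> carrier G. act g x0 = x0}"

definition coset_at :: "'x \<Rightarrow> 'a set" where "coset_at x = {g \<in> carrier G. act g x = x0}"

definition point_at :: "'a set \<Rightarrow> 'x" where "point_at = inv_into V coset_at"

lemma act_inv: "g \<in> carrier G \<Longrightarrow> x \<in> V \<Longrightarrow> act (inv g) (act g x) = x"
  using act_mult[of "inv g" g x] by (simp add: act_one)

lemma act_inv': "g \<in> carrier G \<Longrightarrow> x \<in> V \<Longrightarrow> act g (act (inv g) x) = x"
  using act_mult[of g "inv g" x] by (simp add: act_one)

lemma coset_at_translate:
  assumes "g \<in> carrier G" "x \<in> V"
  shows "coset_at x #> inv g = coset_at (act g x)"
proof (intro equalityI subsetI)
  fix h assume "h \<in> coset_at x #> inv g"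
  then obtain k where k: "k \<in> carrier G" "act k x = x0" "h = k \<otimes> inv g"
    by (auto simp: r_coset_def coset_at_def)
  then show "h \<in> coset_at (act g x)"
    using assms by (simp add: coset_at_def act_mult act_closed act_inv)
next
  fix h assume h: "h \<in> coset_at (act g x)"
  then have "h = (h \<otimes> g) \<otimes> inv g" "h \<otimes> g \<in> coset_at x"
    using assms by (auto simp: coset_at_def act_mult m_assoc)
  then show "h \<in> coset_at x #> inv g" by (auto simp: r_coset_def)
qed

lemma coset_at_x0: "coset_at x0 = stab"
  by (simp add: coset_at_def stab_def)

lemma coset_at_bij: "bij_betw coset_at V (rcosets stab)"
proof -
  have "inj_on coset_at V"
  proof (rule inj_onI)
    fix x y assume xy: "x \<in> V" "y \<in> V" "coset_at x = coset_at y"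
    obtain g where g: "g \<in> carrier G" "act g x = x0" using act_transitive[OF xy(1)] by blast
    then have "act g y = x0" using xy by (auto simp: coset_at_def)
    then show "x = y" using act_inv[OF g(1) xy(1)] act_inv[OF g(1) xy(2)] g by simp
  qed
  moreover have "coset_at ` V = rcosets stab"
  proof (intro equalityI subsetI)
    fix C assume "C \<in> coset_at ` V"
    then obtain x where x: "x \<in> V" "C = coset_at x" by auto
    obtain g where g: "g \<in> carrier G" "act g x = x0" using act_transitive[OF x(1)] by blast
    have "C = stab #> g"
      using coset_at_translate[of "inv g" x0] g x act_inv[OF g(1) x(1)] x0 by (simp add: coset_at_x0)
    then show "C \<in> rcosets stab" using g by (auto simp: RCOSETS_def)
  next
    fix C assume "C \<in> rcosets stab"
    then obtain g where g: "g \<in> carrier G" "C = stab #> g" by (auto simp: RCOSETS_def)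
    then have "C = coset_at (act (inv g) x0)"
      using coset_at_translate[of "inv g" x0] x0 by (simp add: coset_at_x0)
    then show "C \<in> coset_at ` V" using g x0 act_closed by auto
  qed
  ultimately show ?thesis by (simp add: bij_betw_def)
qed

lemma coset_at_closed: "x \<in> V \<Longrightarrow> coset_at x \<in> rcosets stab"
  using coset_at_bij by (auto simp: bij_betw_def)

lemma point_coset_at [simp]: "x \<in> V \<Longrightarrow> point_at (coset_at x) = x"
  unfolding point_at_def using coset_at_bij by (simp add: bij_betw_def)

lemma coset_at_eq_iff: "x \<in> V \<Longrightarrow> y \<in> V \<Longrightarrow> coset_at x = coset_at y \<longleftrightarrow> x = y"
  using point_coset_at by metis

lemma rcosets_cases:
  assumes "C \<in> rcosets stab" obtains x where "x \<in> V" "C = coset_at x"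
  using assms coset_at_bij by (auto simp: bij_betw_def)

lemma sum_act:
  assumes "g \<in> carrier G"
  shows "(\<Sum>x\<in>V. F (act g x)) = (\<Sum>x\<in>V. F x)"
  by (rule sum.reindex_bij_witness[of _ "act (inv g)" "act g"])
    (use assms in \<open>auto simp: act_closed act_inv act_inv'\<close>)

lemma perm_act_coset_at:
  "g \<in> carrier G \<Longrightarrow> x \<in> V \<Longrightarrow> perm_act G stab f g (coset_at x) = f (coset_at (act g x))"
  by (simp add: perm_act_def coset_at_closed coset_at_translate)

end

section \<open>Integer matrices as maps between two permutation modules\<close>

locale two_actions = a1: pointed_action G V act1 x1 + a2: pointed_action G W act2 x2
  for G (structure) and V :: "'x set" and act1 :: "'a \<Rightarrow> 'x \<Rightarrow> 'x" and x1
    and W :: "'y set" and act2 :: "'a \<Rightarrow> 'y \<Rightarrow> 'y" and x2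
begin

text \<open>Constancy on the orbits of the diagonal action, that is, equivariance of the linear map
  with matrix \<open>M\<close>.\<close>

definition invariant :: "('x \<Rightarrow> 'y \<Rightarrow> int) \<Rightarrow> bool" where
  "invariant M \<longleftrightarrow> (\<forall>g\<in>carrier G. \<forall>x\<in>V. \<forall>y\<in>W. M (act1 g x) (act2 g y) = M x y)"

end

lemma sum_mod_cong:
  "(\<And>x. x \<in> S \<Longrightarrow> u x mod m = w x mod m) \<Longrightarrow> sum u S mod m = sum w S mod (m::int)"
  by (metis (mono_tags, lifting) mod_sum_eq sum.cong)

lemma mod_mult_congs:
  "a mod m = b mod m \<Longrightarrow> c * a mod m = c * b mod (m::int)"
  "a mod m = b mod m \<Longrightarrow> c mod m = d mod m \<Longrightarrow> a * c mod m = b * d mod (m::int)"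
  by (metis mod_mult_right_eq, metis mod_mult_eq)

text \<open>An inverse of \<open>m\<close> modulo \<open>p ^ n\<close> is unique once reduced to
  \<open>{0..<p ^ n}\<close>; therefore the inverses for different \<open>n\<close> are
  automatically compatible.\<close>

lemma padic_unit:
  assumes p: "Factorial_Ring.prime p" and m: "coprime m (int p)"
  shows "\<exists>u \<in> carrier (padic_int_ring p). \<forall>n. (u n * m) mod int p ^ n = 1 mod int p ^ n"
proof -
  have pos: "0 < int p ^ n" for n using p prime_gt_0_nat by auto
  have cop: "coprime m (int p ^ n)" for n using m by simp
  have "\<exists>u. u \<in> {0..<int p ^ n} \<and> (u * m) mod int p ^ n = 1 mod int p ^ n" for n
  proof -
    obtain a b where "a * m + b * int p ^ n = 1"
      using cop[of n] bezout_int[of m "int p ^ n"] by (auto simp: coprime_iff_gcd_eq_1)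
    then have "a * m mod int p ^ n = 1 mod int p ^ n" by (metis mod_mult_self1 mult.commute)
    then have "(a mod int p ^ n * m) mod int p ^ n = 1 mod int p ^ n" by (simp add: mod_mult_left_eq)
    then show ?thesis using pos[of n] by (intro exI[of _ "a mod int p ^ n"]) auto
  qed
  then obtain u where u: "\<And>n. u n \<in> {0..<int p ^ n}" "\<And>n. (u n * m) mod int p ^ n = 1 mod int p ^ n"
    by metis
  have "u (Suc n) mod int p ^ n = u n" for n
  proof -
    have d: "int p ^ n dvd int p ^ Suc n" by simp
    have "(u (Suc n) * m) mod int p ^ n = 1 mod int p ^ n"
      using u(2)[of "Suc n"] by (metis d mod_mod_cancel)
    then have "(u (Suc n) * m) mod int p ^ n = (u n * m) mod int p ^ n"
      using u(2)[of n] by simp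
    then have "int p ^ n dvd (u (Suc n) - u n) * m"
      by (simp add: mod_eq_dvd_iff left_diff_distrib)
    then have "int p ^ n dvd u (Suc n) - u n"
      using cop[of n] by (metis coprime_commute coprime_dvd_mult_left_iff)
    then have "u (Suc n) mod int p ^ n = u n mod int p ^ n" by (simp add: mod_eq_dvd_iff)
    then show ?thesis using u(1)[of n] by simp
  qed
  then have "u \<in> carrier (padic_int_ring p)" using u(1) by (simp add: padic_int_ring_def)
  then show ?thesis using u(2) by blast
qed

context two_actions begin

text \<open>The map \<open>u * M\<close> for a \<open>p\<close>-adic scalar \<open>u\<close> given
  by residues; \<open>u\<close> will be 1 in one direction and the inverse of an integer in the
  other. Later only congruences between the \<open>u n\<close> are asked for, as the constant
  sequence 1 is not reduced at \<open>n = 0\<close>, where the modulus is 1.\<close>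

definition padic_map :: "nat \<Rightarrow> (nat \<Rightarrow> int) \<Rightarrow> ('x \<Rightarrow> 'y \<Rightarrow> int) \<Rightarrow> ('a set \<Rightarrow> nat \<Rightarrow> int) \<Rightarrow> 'a set \<Rightarrow> nat \<Rightarrow> int"
  where "padic_map p u M f = (\<lambda>D \<in> rcosets a2.stab.
    (\<lambda>n. (u n * (\<Sum>x\<in>V. M x (a2.point_at D) * f (a1.coset_at x) n)) mod int p ^ n))"

lemma padic_map_at:
  "y \<in> W \<Longrightarrow> padic_map p u M f (a2.coset_at y) n =
    (u n * (\<Sum>x\<in>V. M x y * f (a1.coset_at x) n)) mod int p ^ n"
  by (simp add: padic_map_def a2.coset_at_closed)

lemma padic_map_closed:
  assumes p: "Factorial_Ring.prime p"
    and u: "\<And>n. u (Suc n) mod int p ^ n = u n mod int p ^ n"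
    and f: "f \<in> carrier (perm_module (padic_int_ring p) G a1.stab)"
  shows "padic_map p u M f \<in> carrier (perm_module (padic_int_ring p) G a2.stab)"
proof -
  have pos: "0 < int p ^ n" for n using p prime_gt_0_nat by auto
  have fx: "f (a1.coset_at x) (Suc n) mod int p ^ n = f (a1.coset_at x) n mod int p ^ n" if "x \<in> V" for x n
  proof -
    have "f (a1.coset_at x) \<in> carrier (padic_int_ring p)"
      using f a1.coset_at_closed[OF that] by (auto simp: perm_module_def)
    then show ?thesis by (auto simp: padic_int_ring_def)
  qed
  have "(u (Suc n) * (\<Sum>x\<in>V. M x y * f (a1.coset_at x) (Suc n))) mod int p ^ Suc n mod int p ^ n
      = (u n * (\<Sum>x\<in>V. M x y * f (a1.coset_at x) n)) mod int p ^ n" for y n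
  proof -
    have s: "(\<Sum>x\<in>V. M x y * f (a1.coset_at x) (Suc n)) mod int p ^ n = (\<Sum>x\<in>V. M x y * f (a1.coset_at x) n) mod int p ^ n"
      by (rule sum_mod_cong) (rule mod_mult_congs(1)[OF fx])
    have "(u (Suc n) * (\<Sum>x\<in>V. M x y * f (a1.coset_at x) (Suc n))) mod int p ^ Suc n mod int p ^ n
      = (u (Suc n) * (\<Sum>x\<in>V. M x y * f (a1.coset_at x) (Suc n))) mod int p ^ n"
      by (rule mod_mod_cancel) simp
    also have "\<dots> = (u n * (\<Sum>x\<in>V. M x y * f (a1.coset_at x) n)) mod int p ^ n"
      by (rule mod_mult_congs(2)[OF u s])
    finally show ?thesis .
  qed
  then show ?thesis
    using pos by (auto simp: perm_module_def padic_map_def padic_int_ring_def)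
qed

end

lemma (in two_actions) padic_map_inverse:
  assumes p: "Factorial_Ring.prime p"
    and MN: "\<And>x z. x \<in> V \<Longrightarrow> z \<in> V \<Longrightarrow> (\<Sum>y\<in>W. M x y * N y z) = (if x = z then m else 0)"
    and u: "\<And>n. (u n * v n * m) mod int p ^ n = 1 mod int p ^ n"
    and f: "f \<in> carrier (perm_module (padic_int_ring p) G a1.stab)"
  shows "two_actions.padic_map G W act2 x2 V act1 x1 p v N (padic_map p u M f) = f"
proof -
  interpret r: two_actions G W act2 x2 V act1 x1 ..
  have fp: "f C \<in> carrier (padic_int_ring p)" if "C \<in> rcosets a1.stab" for C
    using f that by (auto simp: perm_module_def)
  have "r.padic_map p v N (padic_map p u M f) (a1.coset_at z) n = f (a1.coset_at z) n" if z: "z \<in> V" for z n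
  proof -
    let ?q = "int p ^ n" and ?f = "\<lambda>x. f (a1.coset_at x) n"
    have "r.padic_map p v N (padic_map p u M f) (a1.coset_at z) n
        = (v n * (\<Sum>y\<in>W. N y z * ((u n * (\<Sum>x\<in>V. M x y * ?f x)) mod ?q))) mod ?q"
      using z by (simp add: r.padic_map_at padic_map_at)
    also have "\<dots> = (v n * (\<Sum>y\<in>W. N y z * (u n * (\<Sum>x\<in>V. M x y * ?f x)))) mod ?q"
    proof -
      have "(\<Sum>y\<in>W. N y z * ((u n * (\<Sum>x\<in>V. M x y * ?f x)) mod ?q)) mod ?q =
          (\<Sum>y\<in>W. N y z * (u n * (\<Sum>x\<in>V. M x y * ?f x))) mod ?q"
        by (rule sum_mod_cong) (simp add: mod_mult_right_eq)
      then show ?thesis by (rule mod_mult_congs(1))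
    qed
    also have "(\<Sum>y\<in>W. N y z * (u n * (\<Sum>x\<in>V. M x y * ?f x))) = u n * (\<Sum>x\<in>V. (\<Sum>y\<in>W. M x y * N y z) * ?f x)"
    proof -
      have "(\<Sum>y\<in>W. N y z * (u n * (\<Sum>x\<in>V. M x y * ?f x))) = u n * (\<Sum>y\<in>W. \<Sum>x\<in>V. M x y * N y z * ?f x)"
        by (simp add: sum_distrib_left mult_ac)
      also have "(\<Sum>y\<in>W. \<Sum>x\<in>V. M x y * N y z * ?f x) = (\<Sum>x\<in>V. \<Sum>y\<in>W. M x y * N y z * ?f x)"
        by (rule sum.swap)
      finally show ?thesis by (simp add: sum_distrib_right)
    qed
    also have "(\<Sum>x\<in>V. (\<Sum>y\<in>W. M x y * N y z) * ?f x) = (\<Sum>x\<in>V. if x = z then m * ?f x else 0)"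
      by (rule sum.cong) (auto simp: MN[OF _ z])
    also have "\<dots> = m * ?f z" using z a1.finite_V by simp
    also have "(v n * (u n * (m * ?f z))) mod ?q = ((u n * v n * m) * ?f z) mod ?q"
      by (simp add: mult_ac)
    also have "\<dots> = ?f z mod ?q" using mod_mult_congs(2)[OF u[of n] refl[of "?f z mod ?q"]] by simp
    also have "\<dots> = ?f z" using fp[OF a1.coset_at_closed[OF z]] by (auto simp: padic_int_ring_def)
    finally show ?thesis .
  qed
  moreover have "f \<in> extensional (rcosets a1.stab)"
    using f by (auto simp: perm_module_def PiE_def)
  ultimately show ?thesis
    by (intro extensionalityI[of _ "rcosets a1.stab"])
      (simp add: r.padic_map_def, assumption, metis a1.rcosets_cases ext)
qed

text \<open>Both products being the scalar \<open>m\<close>, the matrix \<open>N\<close> divided by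
  \<open>m\<close> inverts \<open>M\<close> over the \<open>p\<close>-adic integers. A single pair
  of integer matrices thus serves all primes that do not divide \<open>m\<close>.\<close>

lemma (in two_actions) padic_isomorphic:
  assumes p: "Factorial_Ring.prime p" and m: "coprime m (int p)" and M: "invariant M"
    and MN: "\<And>x z. x \<in> V \<Longrightarrow> z \<in> V \<Longrightarrow> (\<Sum>y\<in>W. M x y * N y z) = (if x = z then m else 0)"
    and NM: "\<And>x z. x \<in> W \<Longrightarrow> z \<in> W \<Longrightarrow> (\<Sum>y\<in>V. N x y * M y z) = (if x = z then m else 0)"
  shows "perm_modules_isomorphic (padic_int_ring p) G a1.stab a2.stab"
proof -
  interpret r: two_actions G W act2 x2 V act1 x1 ..
  obtain v where v: "v \<in> carrier (padic_int_ring p)" "\<And>n. (v n * m) mod int p ^ n = 1 mod int p ^ n"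
    using padic_unit[OF p m] by blast
  let ?P1 = "perm_module (padic_int_ring p) G a1.stab" and ?P2 = "perm_module (padic_int_ring p) G a2.stab"
  let ?\<phi> = "padic_map p (\<lambda>_. 1) M" and ?\<psi> = "r.padic_map p v N"
  have vS: "v (Suc n) mod int p ^ n = v n mod int p ^ n" for n
    using v(1) by (auto simp: padic_int_ring_def)
  have closed: "?\<phi> f \<in> carrier ?P2" if "f \<in> carrier ?P1" for f
    by (rule padic_map_closed[OF p _ that]) simp
  have closed': "?\<psi> f \<in> carrier ?P1" if "f \<in> carrier ?P2" for f
    by (rule r.padic_map_closed[OF p _ that]) (rule vS)
  have "bij_betw ?\<phi> (carrier ?P1) (carrier ?P2)"
  proof (rule bij_betw_byWitness[where f' = ?\<psi>])
    show "\<forall>f\<in>carrier ?P1. ?\<psi> (?\<phi> f) = f"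
      using padic_map_inverse[OF p MN, where u = "\<lambda>_. 1" and v = v] v(2) by simp
    show "\<forall>f\<in>carrier ?P2. ?\<phi> (?\<psi> f) = f"
      using r.padic_map_inverse[OF p NM, where v = "\<lambda>_. 1" and u = v] v(2) by simp
  qed (use closed closed' in auto)
  moreover have ext: "f = f'" if "f \<in> carrier ?P2" "f' \<in> carrier ?P2"
      "\<And>y n. y \<in> W \<Longrightarrow> f (a2.coset_at y) n = f' (a2.coset_at y) n" for f f'
  proof (rule extensionalityI[of _ "rcosets a2.stab"])
    show "f \<in> extensional (rcosets a2.stab)" "f' \<in> extensional (rcosets a2.stab)"
      using that(1,2) by (auto simp: perm_module_def PiE_def)
    show "f C = f' C" if "C \<in> rcosets a2.stab" for C
      using that \<open>\<And>y n. y \<in> W \<Longrightarrow> f (a2.coset_at y) n = f' (a2.coset_at y) n\<close>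
      by (auto elim!: a2.rcosets_cases)
  qed
  have "?\<phi> \<in> hom (add_monoid ?P1) (add_monoid ?P2)"
  proof (rule homI)
    fix f f' assume f: "f \<in> carrier (add_monoid ?P1)" "f' \<in> carrier (add_monoid ?P1)"
    interpret M1: module "padic_int_ring p" ?P1 by (rule a1.perm_module_is_module[OF padic_int_ring_cring[OF p]])
    interpret M2: module "padic_int_ring p" ?P2 by (rule a1.perm_module_is_module[OF padic_int_ring_cring[OF p]])
    have "?\<phi> (f \<oplus>\<^bsub>?P1\<^esub> f') = ?\<phi> f \<oplus>\<^bsub>?P2\<^esub> ?\<phi> f'"
    proof (rule ext)
      show "?\<phi> (f \<oplus>\<^bsub>?P1\<^esub> f') \<in> carrier ?P2" using f by (intro closed) auto
      show "?\<phi> f \<oplus>\<^bsub>?P2\<^esub> ?\<phi> f' \<in> carrier ?P2" using f closed by auto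
      fix y n assume y: "y \<in> W"
      have "(\<Sum>x\<in>V. M x y * ((f (a1.coset_at x) n + f' (a1.coset_at x) n) mod int p ^ n)) mod int p ^ n =
          (\<Sum>x\<in>V. M x y * (f (a1.coset_at x) n + f' (a1.coset_at x) n)) mod int p ^ n"
        by (rule sum_mod_cong) (simp add: mod_mult_right_eq)
      then show "?\<phi> (f \<oplus>\<^bsub>?P1\<^esub> f') (a2.coset_at y) n = (?\<phi> f \<oplus>\<^bsub>?P2\<^esub> ?\<phi> f') (a2.coset_at y) n"
        using y by (simp add: padic_map_at perm_module_def a1.coset_at_closed a2.coset_at_closed
            padic_int_ring_def mod_add_eq sum.distrib distrib_left)
    qed
    then show "?\<phi> (f \<otimes>\<^bsub>add_monoid ?P1\<^esub> f') = ?\<phi> f \<otimes>\<^bsub>add_monoid ?P2\<^esub> ?\<phi> f'" by simp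
  qed (use closed in simp)
  ultimately have iso: "?\<phi> \<in> iso (add_monoid ?P1) (add_monoid ?P2)"
    by (simp add: iso_def)
  have smult: "?\<phi> (r \<odot>\<^bsub>?P1\<^esub> f) = r \<odot>\<^bsub>?P2\<^esub> ?\<phi> f"
    if r: "r \<in> carrier (padic_int_ring p)" and f: "f \<in> carrier ?P1" for r f
  proof (rule ext)
    interpret M1: module "padic_int_ring p" ?P1 by (rule a1.perm_module_is_module[OF padic_int_ring_cring[OF p]])
    interpret M2: module "padic_int_ring p" ?P2 by (rule a1.perm_module_is_module[OF padic_int_ring_cring[OF p]])
    show "?\<phi> (r \<odot>\<^bsub>?P1\<^esub> f) \<in> carrier ?P2" using r f by (intro closed) auto
    show "r \<odot>\<^bsub>?P2\<^esub> ?\<phi> f \<in> carrier ?P2" using r f closed by auto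
    fix y n assume y: "y \<in> W"
    have "(\<Sum>x\<in>V. M x y * ((r n * f (a1.coset_at x) n) mod int p ^ n)) mod int p ^ n =
        (\<Sum>x\<in>V. r n * (M x y * f (a1.coset_at x) n)) mod int p ^ n"
      by (rule sum_mod_cong) (simp add: mod_mult_right_eq mult_ac)
    then show "?\<phi> (r \<odot>\<^bsub>?P1\<^esub> f) (a2.coset_at y) n = (r \<odot>\<^bsub>?P2\<^esub> ?\<phi> f) (a2.coset_at y) n"
      using y by (simp add: padic_map_at perm_module_def a1.coset_at_closed a2.coset_at_closed
          padic_int_ring_def mod_mult_right_eq sum_distrib_left)
  qed
  have act: "?\<phi> (perm_act G a1.stab f g) = perm_act G a2.stab (?\<phi> f) g"
    if g: "g \<in> carrier G" and f: "f \<in> carrier ?P1" for g f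
  proof (rule extensionalityI[of _ "rcosets a2.stab"])
    show "?\<phi> (perm_act G a1.stab f g) \<in> extensional (rcosets a2.stab)" by (simp add: padic_map_def)
    show "perm_act G a2.stab (?\<phi> f) g \<in> extensional (rcosets a2.stab)" by (simp add: perm_act_def)
    fix C assume "C \<in> rcosets a2.stab"
    then obtain y where y: "y \<in> W" "C = a2.coset_at y" by (rule a2.rcosets_cases)
    have "(\<Sum>x\<in>V. M x y * perm_act G a1.stab f g (a1.coset_at x) n) =
        (\<Sum>x\<in>V. M x (act2 g y) * f (a1.coset_at x) n)" for n
    proof -
      have "(\<Sum>x\<in>V. M x y * perm_act G a1.stab f g (a1.coset_at x) n) =
          (\<Sum>x\<in>V. M (act1 g x) (act2 g y) * f (a1.coset_at (act1 g x)) n)"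
        using M g y by (intro sum.cong) (auto simp: a1.perm_act_coset_at invariant_def)
      also have "\<dots> = (\<Sum>x\<in>V. M x (act2 g y) * f (a1.coset_at x) n)"
        using a1.sum_act[OF g, of "\<lambda>x. M x (act2 g y) * f (a1.coset_at x) n"] .
      finally show ?thesis .
    qed
    then show "?\<phi> (perm_act G a1.stab f g) C = perm_act G a2.stab (?\<phi> f) g C"
      using y g by (simp add: fun_eq_iff a2.perm_act_coset_at padic_map_at a2.act_closed)
  qed
  show ?thesis
    unfolding perm_modules_isomorphic_def using iso smult act by blast
qed


text \<open>\<open>M x y\<close> is the coefficient at \<open>y\<close> of the image of the basis
  element \<open>\<delta> x\<close>. The action of \<open>g\<close> carries
  \<open>\<delta> (act1 g x)\<close> to \<open>\<delta> x\<close>, and this turns equivariance of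
  \<open>\<phi>\<close> into invariance of \<open>M\<close>.\<close>

lemma (in two_actions) equivariant_matrix:
  fixes \<phi> :: "('a set \<Rightarrow> int) \<Rightarrow> 'a set \<Rightarrow> int"
  defines "P1 \<equiv> perm_module int_ring G a1.stab" and "P2 \<equiv> perm_module int_ring G a2.stab"
  assumes hom: "\<phi> \<in> hom (add_monoid P1) (add_monoid P2)"
    and smult: "\<And>r f. f \<in> carrier P1 \<Longrightarrow> \<phi> (r \<odot>\<^bsub>P1\<^esub> f) = r \<odot>\<^bsub>P2\<^esub> \<phi> f"
    and act: "\<And>g f. g \<in> carrier G \<Longrightarrow> f \<in> carrier P1 \<Longrightarrow> \<phi> (perm_act G a1.stab f g) = perm_act G a2.stab (\<phi> f) g"
  shows "\<exists>M. invariant M \<and> (\<forall>f\<in>carrier P1. \<forall>y\<in>W. \<phi> f (a2.coset_at y) = (\<Sum>x\<in>V. f (a1.coset_at x) * M x y))"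
proof -
  define \<delta> where "\<delta> x = (\<lambda>C\<in>rcosets a1.stab. if C = a1.coset_at x then 1 else 0 :: int)" for x
  define M where "M x y = \<phi> (\<delta> x) (a2.coset_at y)" for x y
  have P1: "f \<in> carrier P1 \<longleftrightarrow> f \<in> extensional (rcosets a1.stab)" for f
    by (auto simp: P1_def perm_module_def PiE_def)
  have \<delta>: "\<delta> x \<in> carrier P1" for x by (simp add: P1 \<delta>_def)
  have add: "f \<oplus>\<^bsub>P1\<^esub> f' = (\<lambda>C\<in>rcosets a1.stab. f C + f' C)" "r \<odot>\<^bsub>P1\<^esub> f = (\<lambda>C\<in>rcosets a1.stab. r * f C)"
    for f f' r by (simp_all add: P1_def perm_module_def)
  have add2: "(h \<oplus>\<^bsub>P2\<^esub> h') (a2.coset_at y) = h (a2.coset_at y) + h' (a2.coset_at y)"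
      "(r \<odot>\<^bsub>P2\<^esub> h) (a2.coset_at y) = r * h (a2.coset_at y)" if "y \<in> W" for h h' r y
    using that by (simp_all add: P2_def perm_module_def a2.coset_at_closed)
  have \<phi>_add: "\<phi> (f \<oplus>\<^bsub>P1\<^esub> f') = \<phi> f \<oplus>\<^bsub>P2\<^esub> \<phi> f'" if "f \<in> carrier P1" "f' \<in> carrier P1" for f f'
    using hom_mult[OF hom, of f f'] that by simp
  \<comment> \<open>\<open>f\<close> truncated to the cosets of the points in \<open>S\<close>;
    adding one point at a time turns additivity into the expansion of \<open>f\<close> in the
    basis.\<close>
  define cut where "cut f S = (\<lambda>C\<in>rcosets a1.stab. if a1.point_at C \<in> S then f C else 0)"
    for f :: "'a set \<Rightarrow> int" and S
  have expand: "\<phi> (cut f S) (a2.coset_at y) =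
      (\<Sum>x\<in>S. f (a1.coset_at x) * M x y)"
    if S: "S \<subseteq> V" and f: "f \<in> carrier P1" and y: "y \<in> W" for S f y
    using finite_subset[OF S a1.finite_V] S
  proof (induction S rule: finite_induct)
    case empty
    let ?z = "\<lambda>C\<in>rcosets a1.stab. 0 :: int"
    have "0 \<odot>\<^bsub>P1\<^esub> ?z = ?z" by (auto simp: add fun_eq_iff)
    then have "\<phi> ?z (a2.coset_at y) = 0"
      using smult[of ?z 0] add2(2)[OF y, of 0 "\<phi> ?z"] by (simp add: P1)
    moreover have "cut f {} = ?z" by (simp add: cut_def)
    ultimately show ?case by (simp only: sum.empty)
  next
    case (insert x S)
    have "cut f (insert x S) = (f (a1.coset_at x) \<odot>\<^bsub>P1\<^esub> \<delta> x) \<oplus>\<^bsub>P1\<^esub> cut f S"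
    proof
      fix C
      show "cut f (insert x S) C = ((f (a1.coset_at x) \<odot>\<^bsub>P1\<^esub> \<delta> x) \<oplus>\<^bsub>P1\<^esub> cut f S) C"
      proof (cases "C \<in> rcosets a1.stab")
        case True
        then obtain u where u: "u \<in> V" "C = a1.coset_at u" by (rule a1.rcosets_cases)
        have "C = a1.coset_at x \<longleftrightarrow> u = x"
          using u insert.prems by (simp add: a1.coset_at_eq_iff)
        then show ?thesis using u insert.hyps True by (auto simp: add \<delta>_def cut_def)
      qed (simp add: add cut_def)
    qed
    moreover have "f (a1.coset_at x) \<odot>\<^bsub>P1\<^esub> \<delta> x \<in> carrier P1" "cut f S \<in> carrier P1"
      by (simp_all add: P1 add cut_def)
    ultimately have "\<phi> (cut f (insert x S)) = (f (a1.coset_at x) \<odot>\<^bsub>P2\<^esub> \<phi> (\<delta> x)) \<oplus>\<^bsub>P2\<^esub> \<phi> (cut f S)"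
      by (simp add: \<phi>_add smult[OF \<delta>])
    then show ?case using insert y by (simp add: add2 M_def)
  qed
  have "\<phi> f (a2.coset_at y) = (\<Sum>x\<in>V. f (a1.coset_at x) * M x y)" if f: "f \<in> carrier P1" and y: "y \<in> W" for f y
  proof -
    have "cut f V = f"
    proof (rule extensionalityI[of _ "rcosets a1.stab"])
      show "f \<in> extensional (rcosets a1.stab)" using f by (simp add: P1)
    qed (auto elim!: a1.rcosets_cases simp: a1.coset_at_closed cut_def)
    then show ?thesis using expand[OF order_refl f y] by simp
  qed
  moreover have "invariant M"
    unfolding invariant_def
  proof (intro ballI)
    fix g x y assume g: "g \<in> carrier G" and x: "x \<in> V" and y: "y \<in> W"
    have "perm_act G a1.stab (\<delta> (act1 g x)) g = \<delta> x"
    proof (rule extensionalityI[of _ "rcosets a1.stab"])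
      fix C assume "C \<in> rcosets a1.stab"
      then obtain u where u: "u \<in> V" "C = a1.coset_at u" by (rule a1.rcosets_cases)
      have "a1.coset_at (act1 g u) = a1.coset_at (act1 g x) \<longleftrightarrow> a1.coset_at u = a1.coset_at x"
        using u x g by (metis a1.coset_at_eq_iff a1.act_inv a1.act_closed)
      then show "perm_act G a1.stab (\<delta> (act1 g x)) g C = \<delta> x C"
        using u g by (simp add: a1.perm_act_coset_at \<delta>_def a1.coset_at_closed a1.act_closed)
    qed (simp_all add: perm_act_def \<delta>_def)
    then have "\<phi> (\<delta> x) = perm_act G a2.stab (\<phi> (\<delta> (act1 g x))) g"
      using act[OF g \<delta>, of "act1 g x"] by simp
    then show "M (act1 g x) (act2 g y) = M x y"
      using g y by (simp add: M_def a2.perm_act_coset_at)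
  qed
  ultimately show ?thesis by blast
qed

lemma (in two_actions) integral_matrices:
  assumes "perm_modules_isomorphic int_ring G a1.stab a2.stab"
  shows "\<exists>M N. invariant M \<and> two_actions.invariant G W act2 V act1 N \<and>
    (\<forall>x\<in>V. \<forall>z\<in>V. (\<Sum>y\<in>W. M x y * N y z) = (if x = z then 1 else 0))"
proof -
  interpret r: two_actions G W act2 x2 V act1 x1 ..
  let ?P1 = "perm_module int_ring G a1.stab" and ?P2 = "perm_module int_ring G a2.stab"
  obtain \<phi> where iso: "\<phi> \<in> iso (add_monoid ?P1) (add_monoid ?P2)"
    and smult: "\<And>r f. f \<in> carrier ?P1 \<Longrightarrow> \<phi> (r \<odot>\<^bsub>?P1\<^esub> f) = r \<odot>\<^bsub>?P2\<^esub> \<phi> f"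
    and act: "\<And>g f. g \<in> carrier G \<Longrightarrow> f \<in> carrier ?P1 \<Longrightarrow> \<phi> (perm_act G a1.stab f g) = perm_act G a2.stab (\<phi> f) g"
    using assms by (auto simp: perm_modules_isomorphic_def)
  have bij: "bij_betw \<phi> (carrier ?P1) (carrier ?P2)" and hom: "\<phi> \<in> hom (add_monoid ?P1) (add_monoid ?P2)"
    using iso by (auto simp: iso_def)
  define \<psi> where "\<psi> = inv_into (carrier ?P1) \<phi>"
  interpret M1: module int_ring ?P1 by (rule a1.perm_module_is_module) (rule int.is_cring)
  interpret M2: module int_ring ?P2 by (rule a1.perm_module_is_module) (rule int.is_cring)
  have \<psi>: "\<psi> (\<phi> f) = f" if "f \<in> carrier ?P1" for f
    using that bij by (simp add: \<psi>_def bij_betw_inv_into_left)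
  have \<phi>: "\<psi> h \<in> carrier ?P1" "\<phi> (\<psi> h) = h" if "h \<in> carrier ?P2" for h
    using that bij bij_betw_inv_into[OF bij] by (auto simp: \<psi>_def bij_betw_inv_into_right bij_betw_def)
  have pa: "perm_act G a1.stab f g \<in> carrier ?P1" for f :: "'a set \<Rightarrow> int" and g
    by (auto simp: perm_module_def perm_act_def)
  obtain M where M: "invariant M" "\<And>f y. f \<in> carrier ?P1 \<Longrightarrow> y \<in> W \<Longrightarrow>
      \<phi> f (a2.coset_at y) = (\<Sum>x\<in>V. f (a1.coset_at x) * M x y)"
    using equivariant_matrix[OF hom smult act] by blast
  have "\<psi> \<in> hom (add_monoid ?P2) (add_monoid ?P1)"
    using group.iso_set_sym[OF abelian_group.a_group[OF M1.abelian_group_axioms] iso] by (simp add: \<psi>_def iso_def)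
  moreover have "\<psi> (r \<odot>\<^bsub>?P2\<^esub> h) = r \<odot>\<^bsub>?P1\<^esub> \<psi> h" if "h \<in> carrier ?P2" for r h
    using \<psi>[of "r \<odot>\<^bsub>?P1\<^esub> \<psi> h"] smult[of "\<psi> h" r] \<phi>[OF that] by simp
  moreover have "\<psi> (perm_act G a2.stab h g) = perm_act G a1.stab (\<psi> h) g"
    if "g \<in> carrier G" "h \<in> carrier ?P2" for g h
    using \<psi>[OF pa, of "\<psi> h" g] act[of g "\<psi> h"] \<phi>[OF that(2)] that(1) by simp
  ultimately obtain N where N: "r.invariant N" "\<And>h z. h \<in> carrier ?P2 \<Longrightarrow> z \<in> V \<Longrightarrow>
      \<psi> h (a1.coset_at z) = (\<Sum>y\<in>W. h (a2.coset_at y) * N y z)"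
    using r.equivariant_matrix[of \<psi>] by blast
  have "(\<Sum>y\<in>W. M x y * N y z) = (if x = z then 1 else 0)" if x: "x \<in> V" and z: "z \<in> V" for x z
  proof -
    define \<delta> where "\<delta> = (\<lambda>C\<in>rcosets a1.stab. if C = a1.coset_at x then 1 else 0 :: int)"
    have d: "\<delta> (a1.coset_at u) = (if u = x then 1 else 0)" if "u \<in> V" for u
      using that x by (simp add: \<delta>_def a1.coset_at_closed a1.coset_at_eq_iff)
    have \<delta>: "\<delta> \<in> carrier ?P1" by (auto simp: perm_module_def \<delta>_def)
    have "\<phi> \<delta> (a2.coset_at y) = M x y" if "y \<in> W" for y
    proof -
      have "\<phi> \<delta> (a2.coset_at y) = (\<Sum>u\<in>V. if u = x then M u y else 0)"
        unfolding M(2)[OF \<delta> that] by (rule sum.cong) (auto simp: d)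
      then show ?thesis using x a1.finite_V by simp
    qed
    then have "\<psi> (\<phi> \<delta>) (a1.coset_at z) = (\<Sum>y\<in>W. M x y * N y z)"
      using N(2)[OF _ z, of "\<phi> \<delta>"] bij \<delta> by (simp add: bij_betwE)
    then show ?thesis using \<psi>[OF \<delta>] d[OF z] by auto
  qed
  then show ?thesis using M(1) N(1) by blast
qed

section \<open>A tower of radical extensions\<close>

lemma rat_root_integral:
  assumes "q ^ n = (of_int a :: rat)" "n > 0"
  shows "\<exists>k. q = of_int k"
proof -
  obtain c b where cb: "quotient_of q = (c, b)" by force
  then have b: "b > 0" "coprime c b" and q: "q = of_int c / of_int b"
    using quotient_of_denom_pos quotient_of_coprime quotient_of_div by auto
  have "(of_int c :: rat) ^ n = of_int a * of_int b ^ n"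
    using assms(1) b by (simp add: q power_divide field_simps)
  then have e: "c ^ n = a * b ^ n" by (metis of_int_eq_iff of_int_mult of_int_power)
  have "coprime (c ^ n) b" using b(2) by simp
  moreover have "b dvd c ^ n" unfolding e using assms(2) by (simp add: dvd_power)
  ultimately have "is_unit b" by (metis coprime_absorb_right coprime_commute)
  then have "b = 1" using b(1) by simp
  then show ?thesis using q by auto
qed

text \<open>The bound 9 covers -1, \<plusminus>2, \<plusminus>3 and \<plusminus>6, the numbers that
  must not become squares in the lower part of the tower.\<close>

lemma no_rat_sqrt:
  assumes "(q::rat)\<^sup>2 = of_int a" "a < 9" shows "a = 0 \<or> a = 1 \<or> a = 4"
proof -
  obtain k where k: "q = of_int k" using rat_root_integral[OF assms(1)] by auto
  then have "k\<^sup>2 = a" using assms(1) by (metis of_int_eq_iff of_int_power)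
  then have "\<bar>k\<bar>\<^sup>2 < 3\<^sup>2" "\<bar>k\<bar>\<^sup>2 = a" using assms(2) by auto
  then have "\<bar>k\<bar> < 3" by (meson power2_less_imp_less zero_le_numeral)
  then have "k = 0 \<or> k = 1 \<or> k = - 1 \<or> k = 2 \<or> k = - 2" by linarith
  then show ?thesis using \<open>k\<^sup>2 = a\<close> by auto
qed

lemma no_rat_cbrt2: "(q::rat) ^ 3 \<noteq> 2"
proof
  assume q: "q ^ 3 = 2"
  obtain k where k: "q = of_int k" using rat_root_integral[of q 3 2] q by auto
  then have k3: "k ^ 3 = 2" using q by (metis of_int_eq_iff of_int_power of_int_numeral)
  then have "even k" by (metis even_numeral even_power)
  then obtain l where "k = 2 * l" by (auto elim: evenE)
  then have "2 * (2 * l ^ 3) = (1 :: int)" using k3 by (simp add: power3_eq_cube)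
  then show False by presburger
qed

section \<open>The cubic field generated by \<open>cbrt2\<close>\<close>

definition cbrt2 :: complex where "cbrt2 = of_real (root 3 2)"

lemma cbrt2_cubed: "cbrt2 ^ 3 = 2"
  by (simp add: cbrt2_def flip: of_real_power)

lemma cbrt2_not_rat: "cbrt2 \<noteq> of_rat q"
proof
  assume "cbrt2 = of_rat q"
  then have "of_rat (q ^ 3) = (of_rat 2 :: complex)" using cbrt2_cubed by (simp add: of_rat_power)
  then show False using no_rat_cbrt2[of q] by (simp only: of_rat_eq_iff)
qed

lemma cbrt2_independent:
  assumes "of_rat x + of_rat y * cbrt2 + of_rat z * cbrt2\<^sup>2 = 0"
  shows "x = 0 \<and> y = 0 \<and> z = 0"
proof -
  have lin: "x = 0 \<and> y = 0" if "of_rat x + of_rat y * cbrt2 = 0" for x y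
  proof -
    have "y = 0"
    proof (rule ccontr)
      assume "y \<noteq> 0"
      then have "cbrt2 = of_rat (- x / y)"
        using that by (simp add: of_rat_minus of_rat_divide field_simps eq_neg_iff_add_eq_0)
      then show False using cbrt2_not_rat by blast
    qed
    then show ?thesis using that by simp
  qed
  have "z = 0"
  proof (rule ccontr)
    assume z: "z \<noteq> 0"
    define a b where "a = - y / z" and "b = - x / z"
    have sq: "cbrt2\<^sup>2 = of_rat b + of_rat a * cbrt2"
    proof -
      have "of_rat z * cbrt2\<^sup>2 = - of_rat x - of_rat y * cbrt2" using assms by (simp add: algebra_simps eq_neg_iff_add_eq_0)
      then show ?thesis using z by (simp add: a_def b_def of_rat_minus of_rat_divide field_simps)
    qed
    \<comment> \<open>Multiplying the relation by \<open>cbrt2\<close> and reducing again gives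
      \<open>a * b = 2\<close> and \<open>b = - a\<^sup>2\<close>, so \<open>- a\<close> would be a
      rational cube root of 2.\<close>
    have "2 = cbrt2 * cbrt2\<^sup>2" using cbrt2_cubed by (simp add: power3_eq_cube power2_eq_square mult.assoc)
    also have "\<dots> = of_rat b * cbrt2 + of_rat a * (cbrt2 * cbrt2)" unfolding sq by (simp add: algebra_simps)
    also have "cbrt2 * cbrt2 = cbrt2\<^sup>2" by (simp add: power2_eq_square)
    also have "of_rat b * cbrt2 + of_rat a * cbrt2\<^sup>2 = of_rat (a * b) + of_rat (b + a\<^sup>2) * cbrt2"
      unfolding sq by (simp add: of_rat_mult of_rat_add algebra_simps power2_eq_square)
    finally have "of_rat (a * b - 2) + of_rat (b + a\<^sup>2) * cbrt2 = 0"
      unfolding of_rat_diff by (simp add: diff_add_eq)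
    then have "a * b = 2" "b = - a\<^sup>2" using lin by fastforce+
    then have "(- a) ^ 3 = 2" by (simp add: power3_eq_cube power2_eq_square)
    then show False using no_rat_cbrt2 by blast
  qed
  then show ?thesis using assms lin by simp
qed

lemma cbrt2_min_poly: "min_poly [:-2, 0, 0, 1:] cbrt2"
proof (rule min_polyI)
  show "rpoly [:-2, 0, 0, 1:] cbrt2 = 0"
    using cbrt2_cubed by (simp add: of_rat_minus power3_eq_cube mult.assoc)
  fix p :: "rat poly" assume p: "p \<noteq> 0" "rpoly p cbrt2 = 0"
  show "degree [:-2, 0, 0, 1::rat:] \<le> degree p"
  proof (rule ccontr)
    assume "\<not> ?thesis"
    then have d: "degree p < 3" by (simp add: eval_nat_numeral)
    obtain x q where q: "p = pCons x q" by (cases p)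
    obtain y r where r: "q = pCons y r" by (cases q)
    obtain z t where t: "r = pCons z t" by (cases r)
    have "t = 0" using d by (auto simp: q r t split: if_splits)
    then show False using p cbrt2_independent[of x y z] by (simp add: q r t algebra_simps power2_eq_square)
  qed
qed simp

definition F0 :: "complex set" where "F0 = qadj cbrt2"

lemma cfield_F0: "cfield F0"
  unfolding F0_def by (rule cfield_qadj[OF cbrt2_min_poly])

lemma F0_cases:
  assumes "v \<in> F0"
  obtains x y z where "v = of_rat x + of_rat y * cbrt2 + of_rat z * cbrt2\<^sup>2"
proof -
  obtain p where p: "v = rpoly p cbrt2" using assms by (auto simp: F0_def qadj_def)
  have "\<exists>x y z. rpoly p cbrt2 = of_rat x + of_rat y * cbrt2 + of_rat z * cbrt2\<^sup>2"
  proof (induction p)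
    case 0
    show ?case by (intro exI[of _ 0]) simp
  next
    case (pCons a p)
    then obtain x y z where "rpoly p cbrt2 = of_rat x + of_rat y * cbrt2 + of_rat z * cbrt2\<^sup>2" by blast
    then have "rpoly (pCons a p) cbrt2 = of_rat a + of_rat x * cbrt2 + of_rat y * cbrt2\<^sup>2 + of_rat z * cbrt2 ^ 3"
      by (simp add: algebra_simps power2_eq_square power3_eq_cube)
    also have "\<dots> = of_rat (a + 2 * z) + of_rat x * cbrt2 + of_rat y * cbrt2\<^sup>2"
      by (simp add: cbrt2_cubed of_rat_add of_rat_mult)
    finally show ?case by blast
  qed
  then show ?thesis using that p by blast
qed

lemma cbrt2_square:
  "(of_rat x + of_rat y * cbrt2 + of_rat z * cbrt2\<^sup>2)\<^sup>2 =
    of_rat (x\<^sup>2 + 4 * y * z) + of_rat (2 * x * y + 2 * z\<^sup>2) * cbrt2 + of_rat (y\<^sup>2 + 2 * x * z) * cbrt2\<^sup>2"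
proof -
  have "(of_rat x + of_rat y * cbrt2 + of_rat z * cbrt2\<^sup>2)\<^sup>2 =
    of_rat (x\<^sup>2) + of_rat (2 * x * y) * cbrt2 + of_rat (y\<^sup>2 + 2 * x * z) * cbrt2\<^sup>2
    + of_rat (2 * y * z) * cbrt2 ^ 3 + of_rat (z\<^sup>2) * (cbrt2 * cbrt2 ^ 3)"
    by (simp add: of_rat_add of_rat_mult of_rat_power algebra_simps power2_eq_square power3_eq_cube)
  then show ?thesis by (simp add: cbrt2_cubed of_rat_add of_rat_mult algebra_simps)
qed

lemma cbrt2_coeffs_unique:
  assumes "of_rat x + of_rat y * cbrt2 + of_rat z * cbrt2\<^sup>2 = of_rat a + of_rat b * cbrt2 + of_rat c * cbrt2\<^sup>2"
  shows "x = a \<and> y = b \<and> z = c"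
  using cbrt2_independent[of "x - a" "y - b" "z - c"] assms by (simp add: of_rat_diff algebra_simps)

text \<open>A cubic field contains no new square roots of rationals. In coordinates, if the
  coefficients of \<open>cbrt2\<close> and \<open>cbrt2\<^sup>2\<close> in the square vanish and
  \<open>z \<noteq> 0\<close>, then \<open>- z / x\<close> is a cube root of 2.\<close>

lemma F0_sqrt_rat:
  assumes "v \<in> F0" "v\<^sup>2 = of_rat c"
  shows "\<exists>q. c = q\<^sup>2"
proof -
  obtain x y z where v: "v = of_rat x + of_rat y * cbrt2 + of_rat z * cbrt2\<^sup>2" using assms(1) by (rule F0_cases)
  have e: "x\<^sup>2 + 4 * y * z = c" "2 * x * y + 2 * z\<^sup>2 = 0" "y\<^sup>2 + 2 * x * z = 0"
    using cbrt2_coeffs_unique[of "x\<^sup>2 + 4 * y * z" "2 * x * y + 2 * z\<^sup>2" "y\<^sup>2 + 2 * x * z" c 0 0]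
      assms(2) unfolding v cbrt2_square by auto
  have xy: "x * y = - z\<^sup>2" using e(2) by simp
  have "z = 0"
  proof (rule ccontr)
    assume z: "z \<noteq> 0"
    then have x: "x \<noteq> 0" using xy by auto
    have "z * z ^ 3 = (x * y)\<^sup>2" by (simp add: xy power2_eq_square power3_eq_cube)
    also have "\<dots> = x\<^sup>2 * y\<^sup>2" by (simp add: power_mult_distrib)
    also have "y\<^sup>2 = - 2 * x * z" using e(3) by simp
    also have "x\<^sup>2 * (- 2 * x * z) = z * (- 2 * x ^ 3)" by (simp add: power2_eq_square power3_eq_cube)
    finally have "z * z ^ 3 = z * (- 2 * x ^ 3)" .
    then have "z ^ 3 = - 2 * x ^ 3" using z by (simp only: mult_cancel_left) simp
    then have "(- z / x) ^ 3 = 2" using x by (simp add: power_divide field_simps)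
    then show False using no_rat_cbrt2 by blast
  qed
  moreover from this have "y = 0" using e(3) by simp
  ultimately show ?thesis using e(1) by auto
qed

lemma rat_triple_primitive:
  assumes "(x, y, z) \<noteq> (0, 0, 0::rat)"
  shows "\<exists>t a b c. x = t * of_int a \<and> y = t * of_int b \<and> z = t * of_int c \<and> \<not> (even a \<and> even b \<and> even c)"
proof -
  have int: "\<exists>t a' b' c'. of_int a = t * of_int a' \<and> of_int b = t * of_int b' \<and> of_int c = (t::rat) * of_int c'
      \<and> \<not> (even a' \<and> even b' \<and> even c')" if "(a, b, c) \<noteq> (0, 0, 0)" for a b c :: int
    using that
  proof (induction "nat (\<bar>a\<bar> + \<bar>b\<bar> + \<bar>c\<bar>)" arbitrary: a b c rule: less_induct)
    case less
    show ?case
    proof (cases "even a \<and> even b \<and> even c")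
      case True
      then obtain u v w where e: "a = 2 * u" "b = 2 * v" "c = 2 * w" by (auto elim!: evenE)
      have "nat (\<bar>u\<bar> + \<bar>v\<bar> + \<bar>w\<bar>) < nat (\<bar>a\<bar> + \<bar>b\<bar> + \<bar>c\<bar>)" "(u, v, w) \<noteq> (0, 0, 0)"
        using less.prems e by auto
      from less.hyps[OF this] obtain t a' b' c' where
        "of_int u = t * of_int a'" "of_int v = t * of_int b'" "of_int w = (t::rat) * of_int c'" "\<not> (even a' \<and> even b' \<and> even c')"
        by blast
      then show ?thesis by (intro exI[of _ "2 * t"] exI[of _ a'] exI[of _ b'] exI[of _ c']) (simp add: e)
    next
      case False
      then show ?thesis by (intro exI[of _ 1] exI[of _ a] exI[of _ b] exI[of _ c]) auto
    qed
  qed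
  obtain a b where x: "x = of_int a / of_int b" "b > 0" by (metis quotient_of_denom_pos quotient_of_div surj_pair)
  obtain c d where y: "y = of_int c / of_int d" "d > 0" by (metis quotient_of_denom_pos quotient_of_div surj_pair)
  obtain e f where z: "z = of_int e / of_int f" "f > 0" by (metis quotient_of_denom_pos quotient_of_div surj_pair)
  let ?D = "of_int (b * d * f) :: rat"
  have D: "?D \<noteq> 0" using x y z by simp
  have eq: "x = of_int (a * d * f) / ?D" "y = of_int (c * b * f) / ?D" "z = of_int (e * b * d) / ?D"
    using x y z by (simp_all add: field_simps)
  have "(a * d * f, c * b * f, e * b * d) \<noteq> (0, 0, 0)" using assms x y z by auto
  from int[OF this] obtain t a' b' c' where "of_int (a * d * f) = t * of_int a'" "of_int (c * b * f) = t * of_int b'"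
    "of_int (e * b * d) = (t::rat) * of_int c'" "\<not> (even a' \<and> even b' \<and> even c')" by blast
  then show ?thesis unfolding eq
    by (intro exI[of _ "t / ?D"] exI[of _ a'] exI[of _ b'] exI[of _ c']) simp
qed

text \<open>The coefficients -1, 1, 0 of \<open>cbrt2 - 1\<close> yield two quadratic equations free
  of \<open>c\<close>: the sum of the first two coefficients of \<open>v\<^sup>2\<close> vanishes,
  and so does the third. Homogeneity allows an integer solution that is not entirely even, and
  reduction modulo 2 makes all three coordinates even.\<close>

lemma F0_sqrt_unit:
  assumes "v \<in> F0" "of_rat c * v\<^sup>2 = cbrt2 - 1"
  shows False
proof -
  obtain x y z where v: "v = of_rat x + of_rat y * cbrt2 + of_rat z * cbrt2\<^sup>2" using assms(1) by (rule F0_cases)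
  have "of_rat (c * (x\<^sup>2 + 4 * y * z)) + of_rat (c * (2 * x * y + 2 * z\<^sup>2)) * cbrt2 + of_rat (c * (y\<^sup>2 + 2 * x * z)) * cbrt2\<^sup>2
      = of_rat (- 1) + of_rat 1 * cbrt2 + of_rat 0 * cbrt2\<^sup>2"
    using assms(2) unfolding v cbrt2_square of_rat_mult[of c] by (simp add: of_rat_minus algebra_simps)
  then have e: "c * (x\<^sup>2 + 4 * y * z) = - 1" "c * (2 * x * y + 2 * z\<^sup>2) = 1" "c * (y\<^sup>2 + 2 * x * z) = 0"
    using cbrt2_coeffs_unique by blast+
  then have c: "c \<noteq> 0" and nz: "(x, y, z) \<noteq> (0, 0, 0)" by auto
  obtain t a b d where abd: "x = t * of_int a" "y = t * of_int b" "z = t * of_int d" "\<not> (even a \<and> even b \<and> even d)"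
    using rat_triple_primitive[OF nz] by blast
  have t: "t \<noteq> 0" using nz abd by auto
  have "c * (x\<^sup>2 + 4 * y * z + (2 * x * y + 2 * z\<^sup>2)) = 0" using e(1,2) by (simp add: distrib_left)
  then have "x\<^sup>2 + 4 * y * z + (2 * x * y + 2 * z\<^sup>2) = 0" using c by (simp only: mult_eq_0_iff) simp
  then have "t\<^sup>2 * of_int (a\<^sup>2 + 4 * b * d + (2 * a * b + 2 * d\<^sup>2)) = 0"
    by (simp add: abd power2_eq_square algebra_simps)
  then have 1: "a\<^sup>2 + 4 * b * d + (2 * a * b + 2 * d\<^sup>2) = 0" using t by (simp only: mult_eq_0_iff of_int_eq_0_iff) simp
  have "y\<^sup>2 + 2 * x * z = 0" using e(3) c by simp
  then have "t\<^sup>2 * of_int (b\<^sup>2 + 2 * a * d) = 0"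
    by (simp only: abd) (simp add: power2_eq_square algebra_simps)
  then have 2: "b\<^sup>2 + 2 * a * d = 0" using t by (simp only: mult_eq_0_iff of_int_eq_0_iff) simp
  have "a\<^sup>2 = 2 * (- (2 * b * d + a * b + d\<^sup>2))" using 1 by (simp add: algebra_simps)
  then have "even (a\<^sup>2)" by (metis dvd_triv_left)
  then obtain a' where a: "a = 2 * a'" by (auto elim: evenE)
  have "b\<^sup>2 = 2 * (- (a * d))" using 2 by (simp add: algebra_simps)
  then have "even (b\<^sup>2)" by (metis dvd_triv_left)
  then obtain b' where b: "b = 2 * b'" by (auto elim: evenE)
  have "2 * (2 * (a'\<^sup>2 + 2 * b' * d + 2 * a' * b') + d\<^sup>2) = 0" using 1 by (simp add: a b power2_eq_square algebra_simps)
  then have "d\<^sup>2 = 2 * (- (a'\<^sup>2 + 2 * b' * d + 2 * a' * b'))" by simp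
  then have "even (d\<^sup>2)" by (metis dvd_triv_left)
  then show False using abd(4) by (simp add: a b)
qed

lemma no_sqrt_in_F0:
  assumes "v \<in> F0" "v\<^sup>2 = of_int a * of_rat (b\<^sup>2)" "b \<noteq> 0" "a < 9"
  shows "a = 0 \<or> a = 1 \<or> a = 4"
proof -
  have "v\<^sup>2 = of_rat (of_int a * b\<^sup>2)" using assms(2) by (simp add: of_rat_mult)
  then obtain q where "of_int a * b\<^sup>2 = q\<^sup>2" using F0_sqrt_rat assms(1) by blast
  then have "(q / b)\<^sup>2 = of_int a" using assms(3) by (simp add: power_divide nonzero_divide_eq_eq)
  then show ?thesis using no_rat_sqrt assms(4) by blast
qed

section \<open>The generators of \<open>L\<close> and the tower of fields\<close>

definition r2 :: complex where "r2 = of_real (sqrt 2)"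
definition r3 :: complex where "r3 = of_real (sqrt 3)"
definition rho :: complex where "rho = csqrt (r2 * r3)"
text \<open>A primitive cube root of unity when \<open>i\<^sup>2 = - 1\<close> and
  \<open>b\<^sup>2 = 3\<close>. Both \<open>om\<close> and \<open>gam\<close> take their ingredients
  as arguments so that the same formulas describe the images under an embedding; in
  \<open>gam\<close> the third square root is \<open>1 / (u * v)\<close>.\<close>

definition om :: "complex \<Rightarrow> complex \<Rightarrow> complex" where "om i b = (- 1 + i * b) / 2"
definition s1 :: complex where "s1 = csqrt (cbrt2 - 1)"
definition s2 :: complex where "s2 = csqrt (om \<i> r3 * cbrt2 - 1)"
definition gam :: "complex \<Rightarrow> complex \<Rightarrow> complex" where
  "gam u v = (u + v) * (v + 1 / (u * v)) * (1 / (u * v) + u)"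
definition th0 :: complex where "th0 = csqrt (gam s1 s2 * rho)"

lemma squares: "r2\<^sup>2 = 2" "r3\<^sup>2 = 3" "rho\<^sup>2 = r2 * r3" "s1\<^sup>2 = cbrt2 - 1" "s2\<^sup>2 = om \<i> r3 * cbrt2 - 1"
    "th0\<^sup>2 = gam s1 s2 * rho"
  by (simp_all add: r2_def r3_def rho_def s1_def s2_def th0_def flip: of_real_power)

definition F1 where "F1 = adj F0 \<i>"
definition F2 where "F2 = adj F1 r2"
definition F3 where "F3 = adj F2 r3"
definition F4 where "F4 = adj F3 rho"
definition F5 where "F5 = adj F4 s1"
definition F6 where "F6 = adj F5 s2"
definition L where "L = adj F6 th0"

lemma cfield_F1: "cfield F1"
  unfolding F1_def by (rule cfield_adj[OF cfield_F0]) (simp add: cfield_intros[OF cfield_F0])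

lemma cfield_F2: "cfield F2"
  unfolding F2_def by (rule cfield_adj[OF cfield_F1]) (simp add: squares cfield_intros[OF cfield_F1])

lemma cfield_F3: "cfield F3"
  unfolding F3_def by (rule cfield_adj[OF cfield_F2]) (simp add: squares cfield_intros[OF cfield_F2])

lemma tower_mono: "F0 \<subseteq> F1" "F1 \<subseteq> F2" "F2 \<subseteq> F3" "F3 \<subseteq> F4"
  using adj_subset[OF cfield_F0, of \<i>] adj_subset[OF cfield_F1, of r2]
    adj_subset[OF cfield_F2, of r3] adj_subset[OF cfield_F3, of rho]
  by (simp_all only: F1_def F2_def F3_def F4_def)

lemma F3_gens: "cbrt2 \<in> F3" "\<i> \<in> F3" "r2 \<in> F3" "r3 \<in> F3"
proof -
  have "\<i> \<in> F1" "r2 \<in> F2" "r3 \<in> F3"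
    using adj_gen[OF cfield_F0, of \<i>] adj_gen[OF cfield_F1, of r2] adj_gen[OF cfield_F2, of r3]
    by (simp_all only: F1_def F2_def F3_def)
  then show "cbrt2 \<in> F3" "\<i> \<in> F3" "r2 \<in> F3" "r3 \<in> F3"
    using tower_mono qadj_gen[of cbrt2] by (auto simp: F0_def)
qed

lemma om_in: "cfield F \<Longrightarrow> \<i> \<in> F \<Longrightarrow> r3 \<in> F \<Longrightarrow> om \<i> r3 \<in> F"
  by (simp add: om_def cfield_intros)

lemma cfield_F4: "cfield F4"
  unfolding F4_def by (rule cfield_adj[OF cfield_F3]) (simp add: squares cfield_intros[OF cfield_F3] F3_gens)

lemma F4_gens: "cbrt2 \<in> F4" "\<i> \<in> F4" "r2 \<in> F4" "r3 \<in> F4" "rho \<in> F4"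
  using F3_gens tower_mono adj_gen[OF cfield_F3, of rho] by (auto simp: F4_def)

lemma cfield_F5: "cfield F5"
  unfolding F5_def by (rule cfield_adj[OF cfield_F4]) (simp add: squares cfield_intros[OF cfield_F4] F4_gens)

lemma F5_gens: "cbrt2 \<in> F5" "\<i> \<in> F5" "r2 \<in> F5" "r3 \<in> F5" "rho \<in> F5" "s1 \<in> F5"
  using F4_gens adj_subset[OF cfield_F4, of s1] adj_gen[OF cfield_F4, of s1] by (auto simp: F5_def)

lemma s2_square_in: "cfield F \<Longrightarrow> cbrt2 \<in> F \<Longrightarrow> \<i> \<in> F \<Longrightarrow> r3 \<in> F \<Longrightarrow> s2\<^sup>2 \<in> F"
  by (simp add: squares om_def cfield_intros)

lemma cfield_F6: "cfield F6"
  unfolding F6_def by (rule cfield_adj[OF cfield_F5]) (simp add: s2_square_in cfield_F5 F5_gens)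

lemma F6_gens: "cbrt2 \<in> F6" "\<i> \<in> F6" "r2 \<in> F6" "r3 \<in> F6" "rho \<in> F6" "s1 \<in> F6" "s2 \<in> F6"
  using F5_gens adj_subset[OF cfield_F5, of s2] adj_gen[OF cfield_F5, of s2] by (auto simp: F6_def)

lemma th0_square_in: "th0\<^sup>2 \<in> F6"
  by (simp add: squares gam_def cfield_intros[OF cfield_F6] F6_gens)

lemma cfield_L: "cfield L"
  unfolding L_def by (rule cfield_adj[OF cfield_F6 th0_square_in])

lemma L_gens: "cbrt2 \<in> L" "\<i> \<in> L" "r2 \<in> L" "r3 \<in> L" "rho \<in> L" "s1 \<in> L" "s2 \<in> L" "th0 \<in> L"
  using F6_gens adj_subset[OF cfield_F6, of th0] adj_gen[OF cfield_F6, of th0] by (auto simp: L_def)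

subsection \<open>Each step of the tower is proper\<close>

lemma sqrt_in_F1:
  assumes "x \<in> F1" "x\<^sup>2 \<in> F0"
  shows "\<exists>v\<in>F0. x\<^sup>2 = v\<^sup>2 \<or> x\<^sup>2 = - v\<^sup>2"
  using sqrt_in_adj[OF cfield_F0, of \<i> x] assms
  by (auto simp: F1_def power_mult_distrib cfield_intros[OF cfield_F0])

lemma sqrt_in_F2:
  assumes "x \<in> F2" "x\<^sup>2 \<in> F0"
  shows "\<exists>v\<in>F0. \<exists>c\<in>{1, -1, 2, -2}. x\<^sup>2 = of_int c * v\<^sup>2"
proof -
  have x2: "x\<^sup>2 \<in> F1" using assms tower_mono by blast
  from sqrt_in_adj[OF cfield_F1, of r2 x] x2 assms(1) have "x \<in> F1 \<or> (\<exists>u\<in>F1. x = u * r2)"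
    by (simp add: F2_def squares cfield_intros[OF cfield_F1])
  then show ?thesis
  proof
    assume "x \<in> F1"
    then obtain v where "v \<in> F0" "x\<^sup>2 = v\<^sup>2 \<or> x\<^sup>2 = - v\<^sup>2" using sqrt_in_F1 assms by blast
    then show ?thesis by (intro bexI[of _ v]) auto
  next
    assume "\<exists>u\<in>F1. x = u * r2"
    then obtain u where u: "u \<in> F1" "x = u * r2" by blast
    then have x: "x\<^sup>2 = 2 * u\<^sup>2" by (simp add: power_mult_distrib squares)
    then have "u\<^sup>2 = x\<^sup>2 / 2" by simp
    also have "\<dots> \<in> F0" using assms(2) by (simp add: cfield_intros[OF cfield_F0])
    finally have "u\<^sup>2 \<in> F0" .
    then obtain v where "v \<in> F0" "u\<^sup>2 = v\<^sup>2 \<or> u\<^sup>2 = - v\<^sup>2" using sqrt_in_F1 u by blast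
    then show ?thesis unfolding x by (intro bexI[of _ v]) auto
  qed
qed

text \<open>Iterated Kummer steps: an element of \<open>F0\<close> that becomes a square in
  \<open>F3\<close> is a square of \<open>F0\<close> up to a factor built from -1, 2 and 3. For the
  application to \<open>cbrt2 - 1\<close> it is enough that this factor is rational.\<close>

lemma sqrt_in_F3:
  assumes "x \<in> F3" "x\<^sup>2 \<in> F0"
  shows "\<exists>v\<in>F0. \<exists>c. x\<^sup>2 = of_rat c * v\<^sup>2"
proof -
  have x2: "x\<^sup>2 \<in> F2" using assms tower_mono by blast
  from sqrt_in_adj[OF cfield_F2, of r3 x] x2 assms(1) have "x \<in> F2 \<or> (\<exists>u\<in>F2. x = u * r3)"
    by (simp add: F3_def squares cfield_intros[OF cfield_F2])
  then show ?thesis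
  proof
    assume "x \<in> F2"
    then obtain v c where "v \<in> F0" "x\<^sup>2 = of_int c * v\<^sup>2" using sqrt_in_F2 assms by blast
    then show ?thesis by (intro bexI[of _ v] exI[of _ "of_int c"]) auto
  next
    assume "\<exists>u\<in>F2. x = u * r3"
    then obtain u where u: "u \<in> F2" "x = u * r3" by blast
    then have x: "x\<^sup>2 = 3 * u\<^sup>2" by (simp add: power_mult_distrib squares)
    then have "u\<^sup>2 = x\<^sup>2 / 3" by simp
    also have "\<dots> \<in> F0" using assms(2) by (simp add: cfield_intros[OF cfield_F0])
    finally have "u\<^sup>2 \<in> F0" .
    then obtain v c where "v \<in> F0" "u\<^sup>2 = of_int c * v\<^sup>2" using sqrt_in_F2 u by blast
    then show ?thesis unfolding x by (intro bexI[of _ v] exI[of _ "of_int (3 * c)"]) (auto simp: of_rat_mult)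
  qed
qed

lemma ii_notin_F0: "\<i> \<notin> F0"
  using no_sqrt_in_F0[of \<i> "-1" 1] by auto

lemma r2_notin_F1: "r2 \<notin> F1"
proof
  assume "r2 \<in> F1"
  then obtain v where v: "v \<in> F0" "2 = v\<^sup>2 \<or> 2 = - v\<^sup>2"
    using sqrt_in_F1[of r2] by (auto simp: squares cfield_intros[OF cfield_F0])
  have "v\<^sup>2 = of_int 2 * of_rat (1\<^sup>2) \<or> v\<^sup>2 = of_int (- 2) * of_rat (1\<^sup>2)"
    using v(2) by (auto simp: minus_equation_iff)
  then show False using no_sqrt_in_F0[OF v(1), of 2 1] no_sqrt_in_F0[OF v(1), of "-2" 1] by auto
qed

text \<open>By \<open>sqrt_in_F2\<close> one of \<plusminus>3 and \<plusminus>6 would be a square in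
  \<open>F0\<close>, up to the square 1/4 that arises from dividing by 2.\<close>

lemma rat_notin_F2:
  assumes "x \<in> F2" "x\<^sup>2 = of_int a" "a = 3 \<or> a = - 3"
  shows False
proof -
  have "x\<^sup>2 \<in> F0" using assms(2) cfield_of_rat[OF cfield_F0, of "of_int a"] by simp
  then obtain v c where v: "v \<in> F0" "c \<in> {1, -1, 2, -2}" "x\<^sup>2 = of_int c * v\<^sup>2" using sqrt_in_F2 assms(1) by blast
  have e: "of_int c * v\<^sup>2 = of_int a" using v assms(2) by simp
  consider "c = 1" | "c = -1" | "c = 2" | "c = -2" using v(2) by blast
  then show False
  proof cases
    case 1
    then show ?thesis using no_sqrt_in_F0[OF v(1), of a 1] e assms(3) by auto
  next
    case 2
    then have "v\<^sup>2 = - of_int a" using e by (simp add: minus_equation_iff)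
    then show ?thesis using no_sqrt_in_F0[OF v(1), of "- a" 1] assms(3) by auto
  next
    case 3
    then have "v\<^sup>2 = of_int (2 * a) * of_rat ((1 / 2)\<^sup>2)" using e by (simp add: of_rat_divide power_divide field_simps)
    then show ?thesis using no_sqrt_in_F0[OF v(1), of "2 * a" "1 / 2"] assms(3) by auto
  next
    case 4
    then have "v\<^sup>2 = - of_int a / 2" using e by (simp add: field_simps minus_equation_iff)
    then have "v\<^sup>2 = of_int (- 2 * a) * of_rat ((1 / 2)\<^sup>2)" by (simp add: of_rat_divide power_divide)
    then show ?thesis using no_sqrt_in_F0[OF v(1), of "- 2 * a" "1 / 2"] assms(3) by auto
  qed
qed

lemma r3_notin_F2: "r3 \<notin> F2"
  using rat_notin_F2[of r3 3] by (auto simp: squares)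

text \<open>Comparing the parts without \<open>r3\<close> in \<open>(u + v r3)\<^sup>2 = w r3\<close> gives \<open>u\<^sup>2 = -3 v\<^sup>2\<close>, but \<open>-3\<close> is not
  a square in \<open>F2\<close>.\<close>
lemma no_sqrt_multiple_r3:
  assumes "x \<in> F3" "x\<^sup>2 = w * r3" "w \<in> F2"
  shows "w = 0"
proof -
  note [intro] = cfield_intros[OF cfield_F2]
  obtain u v where uv: "x = u + v * r3" "u \<in> F2" "v \<in> F2" using assms(1) by (auto simp: F3_def adj_def)
  have "x\<^sup>2 = (u\<^sup>2 + v\<^sup>2 * r3\<^sup>2) + (2 * u * v) * r3" by (simp add: uv algebra_simps power2_eq_square)
  then have "(u\<^sup>2 + 3 * v\<^sup>2) + (2 * u * v) * r3 = 0 + w * r3" using assms(2) by (simp add: squares)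
  then have e: "u\<^sup>2 + 3 * v\<^sup>2 = 0" "2 * u * v = w"
    using adj_unique[OF cfield_F2 r3_notin_F2, of "u\<^sup>2 + 3 * v\<^sup>2" "2 * u * v" 0 w] uv assms(3) by auto
  show ?thesis
  proof (cases "v = 0")
    case False
    have "(u / v)\<^sup>2 = - 3" using e(1) False by (simp add: power_divide field_simps eq_neg_iff_add_eq_0)
    then show ?thesis using rat_notin_F2[of "u / v" "- 3"] uv by auto
  qed (use e in auto)
qed

lemma r2_nz [simp]: "r2 \<noteq> 0" and r3_nz [simp]: "r3 \<noteq> 0" and rho_nz [simp]: "rho \<noteq> 0"
  using squares by auto

lemma rho_notin_F3: "rho \<notin> F3"
proof
  assume "rho \<in> F3"
  moreover have "r2 \<in> F2" using adj_gen[OF cfield_F1] by (simp add: F2_def)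
  ultimately show False using no_sqrt_multiple_r3[of rho r2] by (simp add: squares)
qed

lemma cbrt2_ne_1 [simp]: "cbrt2 \<noteq> 1"
  using cbrt2_cubed by auto

lemma s1_notin_F3: "x \<in> F3 \<Longrightarrow> x\<^sup>2 \<noteq> cbrt2 - 1"
proof
  assume x: "x \<in> F3" "x\<^sup>2 = cbrt2 - 1"
  have "cbrt2 \<in> F0" by (simp add: F0_def qadj_gen)
  then have "x\<^sup>2 \<in> F0" using x by (simp add: cfield_intros[OF cfield_F0])
  then show False using sqrt_in_F3[OF x(1)] F0_sqrt_unit x(2) by metis
qed

text \<open>A root in \<open>F4\<close> outside \<open>F3\<close> would be \<open>v * rho\<close>.
  As \<open>rho\<^sup>2 = r2 * r3\<close> and the inverse of \<open>r3\<close> is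
  \<open>r3 / 3\<close>, then \<open>v\<^sup>2\<close> would be \<open>r3\<close> times a nonzero
  element of \<open>F2\<close>, which \<open>no_sqrt_multiple_r3\<close> excludes.\<close>

lemma no_sqrt_in_F4: "x \<in> F4 \<Longrightarrow> x\<^sup>2 \<noteq> cbrt2 - 1"
proof
  assume x: "x \<in> F4" "x\<^sup>2 = cbrt2 - 1"
  have "x\<^sup>2 \<in> F3" using x(2) F3_gens by (simp add: cfield_intros[OF cfield_F3])
  then have "x \<in> F3 \<or> (\<exists>v\<in>F3. x = v * rho)"
    using sqrt_in_adj[OF cfield_F3, of rho x] x(1) F3_gens by (simp add: F4_def squares cfield_intros[OF cfield_F3])
  then obtain v where v: "v \<in> F3" "x = v * rho" using s1_notin_F3 x(2) by blast
  then have vr: "v\<^sup>2 * (r2 * r3) = cbrt2 - 1" using x(2) by (simp add: power_mult_distrib squares)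
  have "v\<^sup>2 = v\<^sup>2 * r2\<^sup>2 * r3\<^sup>2 / 6" by (simp add: squares)
  also have "\<dots> = (v\<^sup>2 * (r2 * r3)) * r2 / 6 * r3" by (simp add: power2_eq_square)
  also have "\<dots> = ((cbrt2 - 1) * r2 / 6) * r3" by (simp only: vr)
  finally have "v\<^sup>2 = ((cbrt2 - 1) * r2 / 6) * r3" .
  moreover have "cbrt2 \<in> F2" "r2 \<in> F2"
    using tower_mono qadj_gen[of cbrt2] adj_gen[OF cfield_F1] by (auto simp: F0_def F2_def)
  ultimately have "(cbrt2 - 1) * r2 / 6 = 0"
    by (intro no_sqrt_multiple_r3[OF v(1)]) (simp_all only: cfield_intros[OF cfield_F2])
  then show False by simp
qed

lemma s1_notin_F4: "s1 \<notin> F4"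
  using no_sqrt_in_F4[of s1] by (auto simp: squares)

section \<open>Embeddings of the fields in the tower\<close>

lemma chom_adj_image:
  assumes "cfield F" "e\<^sup>2 \<in> F" "chom (adj F e) \<sigma>" "cfield M" "\<sigma> ` F \<subseteq> M" "\<sigma> e \<in> M"
  shows "\<sigma> ` adj F e \<subseteq> M"
proof
  fix y assume "y \<in> \<sigma> ` adj F e"
  then obtain u v where uv: "y = \<sigma> (u + v * e)" "u \<in> F" "v \<in> F" by (auto simp: adj_def)
  note E = cfield_adj[OF assms(1,2)] and sub = adj_subset[OF assms(1), of e] and e = adj_gen[OF assms(1), of e]
  have "u \<in> adj F e" "v \<in> adj F e" "v * e \<in> adj F e"
    using uv sub e cfield_mult[OF E] by auto
  then have "y = \<sigma> u + \<sigma> v * \<sigma> e" using uv(1) e by (simp add: chom_simps[OF E assms(3)])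
  then show "y \<in> M" using uv assms(5,6) by (auto intro!: cfield_intros[OF assms(4)])
qed

lemma chom_adj_eq:
  assumes "cfield F" "e\<^sup>2 \<in> F" "chom (adj F e) \<sigma>" "chom (adj F e) \<tau>" "\<And>u. u \<in> F \<Longrightarrow> \<sigma> u = \<tau> u" "\<sigma> e = \<tau> e"
    and x: "x \<in> adj F e"
  shows "\<sigma> x = \<tau> x"
proof -
  obtain u v where uv: "x = u + v * e" "u \<in> F" "v \<in> F" using x by (auto simp: adj_def)
  note E = cfield_adj[OF assms(1,2)] and sub = adj_subset[OF assms(1), of e] and e = adj_gen[OF assms(1), of e]
  have "u \<in> adj F e" "v \<in> adj F e" "v * e \<in> adj F e"
    using uv sub e cfield_mult[OF E] by auto
  then show ?thesis
    using uv e assms(5,6) by (simp add: chom_simps[OF E assms(3)] chom_simps[OF E assms(4)])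
qed

lemma F0_hom_exists: "d ^ 3 = 2 \<Longrightarrow> \<exists>\<sigma>. chom F0 \<sigma> \<and> \<sigma> cbrt2 = d"
  unfolding F0_def by (rule qadj_hom_extend[OF cbrt2_min_poly]) (simp add: of_rat_minus power3_eq_cube mult.assoc)

lemma tower_squares:
  "\<i>\<^sup>2 \<in> F0" "r2\<^sup>2 \<in> F1" "r3\<^sup>2 \<in> F2" "rho\<^sup>2 \<in> F3" "s1\<^sup>2 \<in> F4" "s2\<^sup>2 \<in> F5" "th0\<^sup>2 \<in> F6"
  using th0_square_in s2_square_in[OF cfield_F5] F5_gens F4_gens F3_gens
  by (auto simp: squares(1-4) cfield_intros[OF cfield_F0] cfield_intros[OF cfield_F1]
      cfield_intros[OF cfield_F2] cfield_intros[OF cfield_F3] cfield_intros[OF cfield_F4])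

lemma F4_hom_exists:
  assumes d: "d ^ 3 = 2" and i: "i\<^sup>2 = - 1" and a: "a\<^sup>2 = 2" and b: "b\<^sup>2 = 3" and r: "r\<^sup>2 = a * b"
  shows "\<exists>\<sigma>. chom F4 \<sigma> \<and> \<sigma> cbrt2 = d \<and> \<sigma> \<i> = i \<and> \<sigma> r2 = a \<and> \<sigma> r3 = b \<and> \<sigma> rho = r"
proof -
  obtain \<sigma>0 where 0: "chom F0 \<sigma>0" "\<sigma>0 cbrt2 = d" using F0_hom_exists[OF d] by blast
  have "cbrt2 \<in> F0" by (simp add: F0_def qadj_gen)
  note simps = chom_simps cfield_intros
  obtain \<sigma>1 where 1: "chom F1 \<sigma>1" "\<sigma>1 \<i> = i" "\<forall>u\<in>F0. \<sigma>1 u = \<sigma>0 u"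
    using adj_hom_extend[OF cfield_F0 ii_notin_F0 tower_squares(1) 0(1), of i] i
    by (auto simp: F1_def chom_simps[OF cfield_F0 0(1)] cfield_intros[OF cfield_F0])
  obtain \<sigma>2 where 2: "chom F2 \<sigma>2" "\<sigma>2 r2 = a" "\<forall>u\<in>F1. \<sigma>2 u = \<sigma>1 u"
    using adj_hom_extend[OF cfield_F1 r2_notin_F1 tower_squares(2) 1(1), of a] a
    by (auto simp: F2_def squares(1) chom_simps[OF cfield_F1 1(1)])
  obtain \<sigma>3 where 3: "chom F3 \<sigma>3" "\<sigma>3 r3 = b" "\<forall>u\<in>F2. \<sigma>3 u = \<sigma>2 u"
    using adj_hom_extend[OF cfield_F2 r3_notin_F2 tower_squares(3) 2(1), of b] b
    by (auto simp: F3_def squares(2) chom_simps[OF cfield_F2 2(1)])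
  have g: "\<i> \<in> F1" "r2 \<in> F2"
    using adj_gen[OF cfield_F0] adj_gen[OF cfield_F1] by (auto simp: F1_def F2_def)
  have vals3: "\<sigma>3 cbrt2 = d" "\<sigma>3 \<i> = i" "\<sigma>3 r2 = a"
    using \<open>cbrt2 \<in> F0\<close> g tower_mono(1,2) 0(2) 1(2,3) 2(2,3) 3(3) by (simp_all add: subset_iff)
  obtain \<sigma>4 where 4: "chom F4 \<sigma>4" "\<sigma>4 rho = r" "\<forall>u\<in>F3. \<sigma>4 u = \<sigma>3 u"
    using adj_hom_extend[OF cfield_F3 rho_notin_F3 tower_squares(4) 3(1), of r] r
    by (auto simp: F4_def squares(3) chom_simps[OF cfield_F3 3(1)] F3_gens vals3(3) 3(2))
  then show ?thesis using vals3 3(2) F3_gens by auto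
qed

lemma qadj_hom_image:
  assumes "chom (qadj x) \<sigma>" "min_poly m x" "cfield M" "\<sigma> x \<in> M"
  shows "\<sigma> ` qadj x \<subseteq> M"
proof
  fix y assume "y \<in> \<sigma> ` qadj x"
  then obtain p where "y = \<sigma> (rpoly p x)" by (auto simp: qadj_def)
  then have "y = rpoly p (\<sigma> x)" using rpoly_hom[OF cfield_qadj[OF assms(2)] assms(1) qadj_gen] by simp
  then show "y \<in> M" using rpoly_hom[of M id "\<sigma> x" p] assms(3,4) by (simp add: chom_def)
qed

lemma F0_subset_F4: "F0 \<subseteq> F4" and F1_subset_F4: "F1 \<subseteq> F4" and F2_subset_F4: "F2 \<subseteq> F4"
  using tower_mono by auto

lemma F4_hom_image:
  assumes \<sigma>: "chom F4 \<sigma>" and M: "cfield M"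
    and g: "\<sigma> cbrt2 \<in> M" "\<sigma> \<i> \<in> M" "\<sigma> r2 \<in> M" "\<sigma> r3 \<in> M" "\<sigma> rho \<in> M"
  shows "\<sigma> ` F4 \<subseteq> M"
proof -
  have 0: "\<sigma> ` F0 \<subseteq> M"
    using qadj_hom_image[of cbrt2 \<sigma>, OF _ cbrt2_min_poly M g(1)] chom_subset[OF \<sigma> F0_subset_F4] by (simp add: F0_def)
  have 1: "\<sigma> ` F1 \<subseteq> M"
    using chom_adj_image[OF cfield_F0 tower_squares(1) _ M 0 g(2)] chom_subset[OF \<sigma> F1_subset_F4] by (simp add: F1_def)
  have 2: "\<sigma> ` F2 \<subseteq> M"
    using chom_adj_image[OF cfield_F1 tower_squares(2) _ M 1 g(3)] chom_subset[OF \<sigma> F2_subset_F4] by (simp add: F2_def)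
  have 3: "\<sigma> ` F3 \<subseteq> M"
    using chom_adj_image[OF cfield_F2 tower_squares(3) _ M 2 g(4)] chom_subset[OF \<sigma> tower_mono(4)] by (simp add: F3_def)
  show ?thesis
    using chom_adj_image[OF cfield_F3 tower_squares(4) _ M 3 g(5)] \<sigma> by (simp add: F4_def)
qed

definition ww :: complex where "ww = om \<i> r3"

lemma ww: "ww\<^sup>2 = - 1 - ww" "ww ^ 3 = 1"
proof -
  have "(\<i> * r3)\<^sup>2 = - 3" by (simp add: power_mult_distrib squares)
  moreover have "ww\<^sup>2 = (1 - 2 * (\<i> * r3) + (\<i> * r3)\<^sup>2) / 4"
    by (simp add: ww_def om_def power2_eq_square field_simps)
  ultimately show 1: "ww\<^sup>2 = - 1 - ww" by (simp add: ww_def om_def field_simps)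
  have "ww ^ 3 = ww * ww\<^sup>2" by (simp add: power3_eq_cube power2_eq_square)
  also have "\<dots> = ww * (- 1 - ww)" by (simp only: 1)
  also have "\<dots> = - ww - ww\<^sup>2" by (simp add: algebra_simps power2_eq_square)
  finally show "ww ^ 3 = 1" by (simp add: 1)
qed

lemma norm_cbrt2_minus_1: "(cbrt2 - 1) * (ww * cbrt2 - 1) * (ww\<^sup>2 * cbrt2 - 1) = 1"
proof -
  have "(cbrt2 - 1) * (ww * cbrt2 - 1) * (ww\<^sup>2 * cbrt2 - 1) =
      ww ^ 3 * cbrt2 ^ 3 - (ww + ww\<^sup>2 + ww ^ 3) * cbrt2\<^sup>2 + (1 + ww + ww\<^sup>2) * cbrt2 - 1"
    by (simp add: algebra_simps power2_eq_square power3_eq_cube)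
  then show ?thesis by (simp add: ww cbrt2_cubed)
qed

lemma s1_nz [simp]: "s1 \<noteq> 0"
  using squares(4) by auto

lemma s2_nz [simp]: "s2 \<noteq> 0"
  using squares(5) norm_cbrt2_minus_1 by (auto simp flip: ww_def)

text \<open>Let \<open>b1\<close>, \<open>b2\<close>, \<open>b3\<close> be the conjugates of
  \<open>cbrt2 - 1\<close>, with product 1. Neither \<open>b2\<close> nor \<open>b1 * b2\<close> may
  be a square in \<open>F4\<close>. The embedding \<open>\<tau>\<close> of \<open>F4\<close> into
  itself sends \<open>b1\<close> to \<open>b3\<close> and \<open>b2\<close> to \<open>b1\<close>,
  and in both cases it produces a forbidden square root of \<open>b1\<close>.\<close>

lemma s2_notin_F5: "s2 \<notin> F5"
proof
  assume "s2 \<in> F5"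
  have d: "(ww\<^sup>2 * cbrt2) ^ 3 = 2"
  proof -
    have "(ww\<^sup>2 * cbrt2) ^ 3 = (ww ^ 3)\<^sup>2 * cbrt2 ^ 3" by (simp add: power_mult_distrib flip: power_mult)
    then show ?thesis by (simp add: ww cbrt2_cubed)
  qed
  obtain \<tau> where \<tau>: "chom F4 \<tau>" "\<tau> cbrt2 = ww\<^sup>2 * cbrt2" "\<tau> \<i> = \<i>" "\<tau> r2 = r2" "\<tau> r3 = r3" "\<tau> rho = rho"
    using F4_hom_exists[OF d, of \<i> r2 r3 rho] by (auto simp: squares)
  have wF: "ww \<in> F4" unfolding ww_def by (intro om_in cfield_F4 F4_gens)
  have "\<tau> ` F4 \<subseteq> F4"
    by (rule F4_hom_image[OF \<tau>(1) cfield_F4])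
      (auto simp: \<tau> F4_gens wF intro!: cfield_intros[OF cfield_F4])
  then have im: "\<tau> x \<in> F4" if "x \<in> F4" for x using that by blast
  note hs = chom_simps[OF cfield_F4 \<tau>(1)] and [simp] = cfield_intros[OF cfield_F4] F4_gens
  have \<tau>w: "\<tau> ww = ww" by (simp add: ww_def om_def hs \<tau>)
  have w4: "ww * (ww * ww) = 1" using ww(2) by (simp add: power3_eq_cube mult.assoc)
  have \<tau>b: "\<tau> (cbrt2 - 1) = ww\<^sup>2 * cbrt2 - 1" "\<tau> (ww * cbrt2 - 1) = cbrt2 - 1"
    using w4 by (simp_all add: hs \<tau> \<tau>w wF power2_eq_square)
  have s2sq: "s2\<^sup>2 = ww * cbrt2 - 1" by (simp add: squares ww_def)
  have "s2 \<in> F4 \<or> (\<exists>v\<in>F4. s2 = v * s1)"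
    using sqrt_in_adj[OF cfield_F4 tower_squares(5), of s2] \<open>s2 \<in> F5\<close> s2_square_in[OF cfield_F4]
    by (simp add: F5_def)
  then show False
  proof
    assume "s2 \<in> F4"
    then have "(\<tau> s2)\<^sup>2 = cbrt2 - 1" using \<tau>b(2) by (simp flip: hs(9) add: s2sq)
    then show False using no_sqrt_in_F4[OF im[OF \<open>s2 \<in> F4\<close>]] by simp
  next
    assume "\<exists>v\<in>F4. s2 = v * s1"
    then obtain v where v: "v \<in> F4" "s2 = v * s1" by blast
    define b1 b2 b3 where b: "b1 = cbrt2 - 1" "b2 = ww * cbrt2 - 1" "b3 = ww\<^sup>2 * cbrt2 - 1"
    have prod: "b1 * b2 * b3 = 1" using norm_cbrt2_minus_1 by (simp add: b)
    then have nz: "b1 \<noteq> 0" "b2 \<noteq> 0" "b3 \<noteq> 0" by auto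
    have bF: "b1 \<in> F4" "b2 \<in> F4" by (auto simp: b wF)
    have "s2\<^sup>2 = v\<^sup>2 * s1\<^sup>2" unfolding v(2) by (rule power_mult_distrib)
    then have v2: "v\<^sup>2 * b1 = b2" unfolding s2sq squares(4) b by simp
    have "v \<noteq> 0" using v by auto
    have "\<tau> (v\<^sup>2 * b1) = \<tau> b2" using v2 by simp
    then have tv2: "(\<tau> v)\<^sup>2 * b3 = b1" using v(1) bF \<tau>b by (simp add: hs b)
    \<comment> \<open>The quotient \<open>(\<tau> v)\<^sup>2 / v\<^sup>2\<close> is
      \<open>b1\<^sup>2 / (b2 * b3)\<close>, which equals \<open>b1 ^ 3\<close> because the product
      of the conjugates is 1; dividing by \<open>b1\<^sup>2\<close> leaves
      \<open>b1\<close>.\<close>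
    define y where "y = \<tau> v / (b1 * v)"
    have "y\<^sup>2 * (b1\<^sup>2 * (v\<^sup>2 * b1) * b3) = b1 * ((\<tau> v)\<^sup>2 * b3)"
      using nz \<open>v \<noteq> 0\<close> by (simp add: y_def power_divide power_mult_distrib field_simps)
    then have "y\<^sup>2 * (b1 * (b1 * b2 * b3)) = b1 * b1" unfolding v2 tv2 by (simp add: power2_eq_square mult_ac)
    then have "y\<^sup>2 = b1" using nz by (simp add: prod)
    moreover have "y \<in> F4" using v(1) bF im by (simp add: y_def)
    ultimately show False using no_sqrt_in_F4 by (simp add: b)
  qed
qed

lemma F6_hom_exists:
  assumes d: "d ^ 3 = 2" and i: "i\<^sup>2 = - 1" and a: "a\<^sup>2 = 2" and b: "b\<^sup>2 = 3" and r: "r\<^sup>2 = a * b"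
    and u: "u\<^sup>2 = d - 1" and v: "v\<^sup>2 = om i b * d - 1"
  shows "\<exists>\<sigma>. chom F6 \<sigma> \<and> \<sigma> cbrt2 = d \<and> \<sigma> \<i> = i \<and> \<sigma> r2 = a \<and> \<sigma> r3 = b \<and> \<sigma> rho = r \<and> \<sigma> s1 = u \<and> \<sigma> s2 = v"
proof -
  obtain \<sigma>4 where 4: "chom F4 \<sigma>4" "\<sigma>4 cbrt2 = d" "\<sigma>4 \<i> = i" "\<sigma>4 r2 = a" "\<sigma>4 r3 = b" "\<sigma>4 rho = r"
    using F4_hom_exists[OF d i a b r] by blast
  obtain \<sigma>5 where 5: "chom F5 \<sigma>5" "\<sigma>5 s1 = u" "\<forall>u\<in>F4. \<sigma>5 u = \<sigma>4 u"
    using adj_hom_extend[OF cfield_F4 s1_notin_F4 tower_squares(5) 4(1), of u] u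
    by (auto simp: F5_def squares(4) chom_simps[OF cfield_F4 4(1)] F4_gens cfield_intros[OF cfield_F4] 4)
  have vals5: "\<sigma>5 cbrt2 = d" "\<sigma>5 \<i> = i" "\<sigma>5 r2 = a" "\<sigma>5 r3 = b" "\<sigma>5 rho = r"
    using 5(3) 4 F4_gens by auto
  obtain \<sigma>6 where 6: "chom F6 \<sigma>6" "\<sigma>6 s2 = v" "\<forall>u\<in>F5. \<sigma>6 u = \<sigma>5 u"
    using adj_hom_extend[OF cfield_F5 s2_notin_F5 tower_squares(6) 5(1), of v] v
    by (auto simp: F6_def squares(5) om_def chom_simps[OF cfield_F5 5(1)] F5_gens cfield_intros[OF cfield_F5] vals5)
  then show ?thesis using 5(2) vals5 F5_gens by auto
qed

lemma F4_subset_F6: "F4 \<subseteq> F6" and F5_subset_F6: "F5 \<subseteq> F6"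
  using adj_subset[OF cfield_F4, of s1] adj_subset[OF cfield_F5, of s2] by (auto simp: F5_def F6_def)

lemma F6_hom_image:
  assumes \<sigma>: "chom F6 \<sigma>" and M: "cfield M"
    and g: "\<sigma> cbrt2 \<in> M" "\<sigma> \<i> \<in> M" "\<sigma> r2 \<in> M" "\<sigma> r3 \<in> M" "\<sigma> rho \<in> M" "\<sigma> s1 \<in> M" "\<sigma> s2 \<in> M"
  shows "\<sigma> ` F6 \<subseteq> M"
proof -
  have 4: "\<sigma> ` F4 \<subseteq> M"
    using F4_hom_image[OF chom_subset[OF \<sigma> F4_subset_F6] M g(1-5)] .
  have 5: "\<sigma> ` F5 \<subseteq> M"
    using chom_adj_image[OF cfield_F4 tower_squares(5) _ M 4 g(6)] chom_subset[OF \<sigma> F5_subset_F6] by (simp add: F5_def)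
  show ?thesis
    using chom_adj_image[OF cfield_F5 tower_squares(6) _ M 5 g(7)] \<sigma> by (simp add: F6_def)
qed

section \<open>The conjugates of \<open>gam s1 s2\<close> and their square roots\<close>

definition s3 :: complex where "s3 = 1 / (s1 * s2)"

lemma s_squares: "s1\<^sup>2 = cbrt2 - 1" "s2\<^sup>2 = ww * cbrt2 - 1" "s3\<^sup>2 = ww\<^sup>2 * cbrt2 - 1"
proof -
  show 1: "s1\<^sup>2 = cbrt2 - 1" and 2: "s2\<^sup>2 = ww * cbrt2 - 1" by (simp_all add: squares ww_def)
  have "s1\<^sup>2 * s2\<^sup>2 * (ww\<^sup>2 * cbrt2 - 1) = 1" using norm_cbrt2_minus_1 by (simp add: 1 2)
  then show "s3\<^sup>2 = ww\<^sup>2 * cbrt2 - 1" by (simp add: s3_def power_divide power_mult_distrib field_simps)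
qed

lemma s_prod: "s1 * s2 * s3 = 1" "s3 \<noteq> 0"
  by (simp_all add: s3_def)

lemma s_inverse: "1 / (s1 * s2) = s3" "1 / (s2 * s3) = s1" "1 / (s1 * s3) = s2"
  by (simp_all add: s3_def)

lemma ii_r3: "\<i> * r3 = ww - ww\<^sup>2" "ww * ww\<^sup>2 = 1" "ww \<noteq> 1" "ww \<noteq> 0"
proof -
  show 1: "\<i> * r3 = ww - ww\<^sup>2" by (simp add: ww) (simp add: ww_def om_def field_simps)
  show "ww * ww\<^sup>2 = 1" using ww(2) by (simp add: power3_eq_cube power2_eq_square mult.assoc)
  show "ww \<noteq> 1" "ww \<noteq> 0" using 1 by auto
qed

lemma cbrt2_nz [simp]: "cbrt2 \<noteq> 0"
  using cbrt2_cubed by auto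

lemma ww_distinct: "ww\<^sup>2 \<noteq> 1" "ww\<^sup>2 \<noteq> ww"
  using ii_r3 by auto

lemma s_sums_nz: "s1 + s2 \<noteq> 0" "s2 + s3 \<noteq> 0" "s1 + s3 \<noteq> 0" "s3 + s1 \<noteq> 0"
proof -
  have *: "x + y \<noteq> 0" if "x\<^sup>2 \<noteq> y\<^sup>2" for x y :: complex using that by (auto simp: add_eq_0_iff)
  show "s1 + s2 \<noteq> 0" "s2 + s3 \<noteq> 0" "s1 + s3 \<noteq> 0" "s3 + s1 \<noteq> 0"
    by (rule *; use ww_distinct ii_r3(3) in \<open>auto simp: s_squares\<close>)+
qed

text \<open>\<open>gam\<close> is symmetric in the three roots, so only sign changes affect it.
  Those that keep the product \<open>s1 * s2 * s3\<close> are four in number, one for each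
  fibre.\<close>

lemma gam_s: "gam s1 s2 = (s1 + s2) * (s2 + s3) * (s3 + s1)" "gam s2 s3 = gam s1 s2" "gam s1 s3 = gam s1 s2"
  "gam (- s1) (- s2) = - ((s1 + s2) * (s3 - s2) * (s3 - s1))"
  "gam (- s1) s2 = - ((s1 + s3) * (s2 - s1) * (s2 - s3))"
  "gam s1 (- s2) = - ((s2 + s3) * (s1 - s2) * (s1 - s3))"
  by (simp_all add: gam_def s_inverse) (simp_all add: algebra_simps)

lemma gam_nz: "gam s1 s2 \<noteq> 0"
  by (simp add: gam_s s_sums_nz)

lemma th0_sq: "th0\<^sup>2 = gam s1 s2 * rho" and th0_nz [simp]: "th0 \<noteq> 0"
proof -
  show "th0\<^sup>2 = gam s1 s2 * rho" by (rule squares)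
  then show "th0 \<noteq> 0" using gam_nz by auto
qed

text \<open>The product of two conjugates of \<open>gam s1 s2\<close> is a square in
  \<open>F6\<close>; for the conjugates that belong to \<open>th0\<close> and \<open>th3\<close> it
  is the square of \<open>(s1 + s2) * (s1\<^sup>2 - s2\<^sup>2)\<close>. Its root times
  \<open>rho\<close>, divided by \<open>th0\<close>, is a square root of the other conjugate times
  \<open>rho\<close>, and lies in \<open>L\<close> by construction.\<close>

definition th1 where "th1 = rho * (\<i> * r3) * cbrt2 * (s2 + s3) / th0"
definition th2 where "th2 = rho * (\<i> * r3) * (ww * cbrt2) * (s1 + s3) / th0"
definition th3 where "th3 = rho * (\<i> * r3) * (ww\<^sup>2 * cbrt2) * (s1 + s2) / th0"

lemma s_diffs:
  "s2\<^sup>2 - s3\<^sup>2 = \<i> * r3 * cbrt2" "s3\<^sup>2 - s1\<^sup>2 = \<i> * r3 * (ww * cbrt2)" "s1\<^sup>2 - s2\<^sup>2 = \<i> * r3 * (ww\<^sup>2 * cbrt2)"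
proof -
  show "s2\<^sup>2 - s3\<^sup>2 = \<i> * r3 * cbrt2" unfolding s_squares ii_r3(1) by (simp add: algebra_simps)
  have "\<i> * r3 * (ww * cbrt2) = (ww\<^sup>2 - ww * ww\<^sup>2) * cbrt2"
    unfolding ii_r3(1) by (simp add: algebra_simps power2_eq_square)
  then show "s3\<^sup>2 - s1\<^sup>2 = \<i> * r3 * (ww * cbrt2)" unfolding s_squares ii_r3(2) by (simp add: algebra_simps)
  have "\<i> * r3 * (ww\<^sup>2 * cbrt2) = (ww * ww\<^sup>2 - ww * (ww * ww\<^sup>2)) * cbrt2"
    unfolding ii_r3(1) by (simp add: algebra_simps power2_eq_square)
  then show "s1\<^sup>2 - s2\<^sup>2 = \<i> * r3 * (ww\<^sup>2 * cbrt2)" unfolding s_squares ii_r3(2) by (simp add: algebra_simps)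
qed

lemma r3_delta: "\<i> * r3 * cbrt2 = (s2 - s3) * (s2 + s3)" "\<i> * r3 * (ww * cbrt2) = (s3 - s1) * (s1 + s3)"
  "\<i> * r3 * (ww\<^sup>2 * cbrt2) = (s1 - s2) * (s1 + s2)"
  unfolding s_diffs[symmetric] by (simp_all add: algebra_simps power2_eq_square)

text \<open>The three factors are proportional to the cube roots of unity, so the product of two of them is the
  square of the third.\<close>
lemma delta_rel:
  "(s1 - s2) * (s1 + s2) * ((s3 - s1) * (s1 + s3)) = ((s2 - s3) * (s2 + s3))\<^sup>2"
  "(s1 - s2) * (s1 + s2) * ((s2 - s3) * (s2 + s3)) = ((s3 - s1) * (s1 + s3))\<^sup>2"
  "(s2 - s3) * (s2 + s3) * ((s3 - s1) * (s1 + s3)) = ((s1 - s2) * (s1 + s2))\<^sup>2"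
proof -
  have w: "ww * ww\<^sup>2 = 1" "ww * (ww * ww) = 1" using ii_r3(2) by (auto simp: power2_eq_square)
  show "(s1 - s2) * (s1 + s2) * ((s3 - s1) * (s1 + s3)) = ((s2 - s3) * (s2 + s3))\<^sup>2"
    unfolding r3_delta[symmetric] using w by (simp add: power2_eq_square mult_ac)
  show "(s1 - s2) * (s1 + s2) * ((s2 - s3) * (s2 + s3)) = ((s3 - s1) * (s1 + s3))\<^sup>2"
    unfolding r3_delta[symmetric] by (simp add: power2_eq_square mult_ac)
  have "ww * (ww * (ww * ww)) = ww" using w by simp
  then show "(s2 - s3) * (s2 + s3) * ((s3 - s1) * (s1 + s3)) = ((s1 - s2) * (s1 + s2))\<^sup>2"
    unfolding r3_delta[symmetric] by (simp add: power2_eq_square mult_ac)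
qed

lemma th_squares:
  "th1\<^sup>2 = gam s1 (- s2) * rho" "th2\<^sup>2 = gam (- s1) s2 * rho" "th3\<^sup>2 = gam (- s1) (- s2) * rho"
proof -
  have *: "(rho * e * c / th0)\<^sup>2 = g * rho" if "e\<^sup>2 * c\<^sup>2 = g * gam s1 s2" for e c g
  proof -
    have "(rho * e * c / th0)\<^sup>2 = rho\<^sup>2 * (e\<^sup>2 * c\<^sup>2) / (gam s1 s2 * rho)"
      by (simp add: power_divide power_mult_distrib th0_sq mult_ac)
    also have "\<dots> = rho\<^sup>2 * (g * gam s1 s2) / (gam s1 s2 * rho)" by (simp only: that)
    also have "\<dots> = g * rho" using gam_nz by (simp add: power2_eq_square)
    finally show ?thesis .
  qed
  show "th1\<^sup>2 = gam s1 (- s2) * rho"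
    unfolding th1_def mult.assoc[of rho "\<i> * r3" cbrt2] r3_delta
    by (rule *) (simp only: delta_rel(1)[symmetric] gam_s, simp add: power2_eq_square algebra_simps)
  show "th2\<^sup>2 = gam (- s1) s2 * rho"
    unfolding th2_def mult.assoc[of rho "\<i> * r3" "ww * cbrt2"] r3_delta
    by (rule *) (simp only: delta_rel(2)[symmetric] gam_s, simp add: power2_eq_square algebra_simps)
  show "th3\<^sup>2 = gam (- s1) (- s2) * rho"
    unfolding th3_def mult.assoc[of rho "\<i> * r3" "ww\<^sup>2 * cbrt2"] r3_delta
    by (rule *) (simp only: delta_rel(3)[symmetric] gam_s, simp add: power2_eq_square algebra_simps)
qed

lemma F6_gens2: "s3 \<in> F6" "ww \<in> F6"
  unfolding s3_def ww_def by (simp_all add: cfield_intros[OF cfield_F6] om_in[OF cfield_F6] F6_gens)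

text \<open>A lift of the automorphism \<open>\<kappa>\<close> of \<open>F6\<close> to an extension by \<open>th0\<close> has order four, since it maps \<open>th0\<close> to
  a square root \<open>m / th0\<close> with \<open>\<kappa> m = -m\<close>.\<close>
lemma th0_notin_F6: "th0 \<notin> F6"
proof
  assume th: "th0 \<in> F6"
  obtain \<kappa> where \<kappa>: "chom F6 \<kappa>" "\<kappa> cbrt2 = cbrt2" "\<kappa> \<i> = \<i>" "\<kappa> r2 = r2" "\<kappa> r3 = r3" "\<kappa> rho = rho"
      "\<kappa> s1 = - s1" "\<kappa> s2 = - s2"
    using F6_hom_exists[of cbrt2 \<i> r2 r3 rho "- s1" "- s2"] by (auto simp: squares cbrt2_cubed)
  note hs = chom_simps[OF cfield_F6 \<kappa>(1)] and [simp] = cfield_intros[OF cfield_F6] F6_gens F6_gens2 th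
  have "\<kappa> ` F6 \<subseteq> F6"
    by (rule F6_hom_image[OF \<kappa>(1) cfield_F6]) (auto simp: \<kappa>)
  then have im: "\<kappa> x \<in> F6" if "x \<in> F6" for x using that by blast
  have kk: "chom F6 (\<lambda>x. \<kappa> (\<kappa> x))"
    using im by (auto simp: chom_def hs)
  have id: "chom F6 (\<lambda>x. x)" by (simp add: chom_def)
  have sub: "F0 \<subseteq> F1" "F1 \<subseteq> F2" "F2 \<subseteq> F3" "F3 \<subseteq> F4" "F4 \<subseteq> F5" "F5 \<subseteq> F6"
    using tower_mono adj_subset[OF cfield_F4, of s1] adj_subset[OF cfield_F5, of s2] by (auto simp: F5_def F6_def)
  have \<kappa>2: "\<kappa> (\<kappa> x) = x" if "x \<in> F6" for x
  proof -
    have 0: "\<kappa> x = x" if x: "x \<in> F0" for x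
    proof -
      obtain p where p: "x = rpoly p cbrt2" using x by (auto simp: F0_def qadj_def)
      have "\<kappa> x = rpoly p (\<kappa> cbrt2)" unfolding p using rpoly_hom[OF cfield_F6 \<kappa>(1) F6_gens(1)] by blast
      then show ?thesis by (simp add: p \<kappa>(2))
    qed
    have 1: "\<kappa> x = x" if x: "x \<in> F1" for x
      using chom_adj_eq[OF cfield_F0 tower_squares(1), of \<kappa> "\<lambda>x. x" x] chom_subset[OF \<kappa>(1), of F1] chom_subset[OF id, of F1]
        0 \<kappa>(3) x sub by (auto simp: F1_def)
    have 2: "\<kappa> x = x" if x: "x \<in> F2" for x
      using chom_adj_eq[OF cfield_F1 tower_squares(2), of \<kappa> "\<lambda>x. x" x] chom_subset[OF \<kappa>(1), of F2] chom_subset[OF id, of F2]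
        1 \<kappa>(4) x sub by (auto simp: F2_def)
    have 3: "\<kappa> x = x" if x: "x \<in> F3" for x
      using chom_adj_eq[OF cfield_F2 tower_squares(3), of \<kappa> "\<lambda>x. x" x] chom_subset[OF \<kappa>(1), of F3] chom_subset[OF id, of F3]
        2 \<kappa>(5) x sub by (auto simp: F3_def)
    have 4: "\<kappa> x = x" if x: "x \<in> F4" for x
      using chom_adj_eq[OF cfield_F3 tower_squares(4), of \<kappa> "\<lambda>x. x" x] chom_subset[OF \<kappa>(1), of F4] chom_subset[OF id, of F4]
        3 \<kappa>(6) x sub by (auto simp: F4_def)
    have 5: "\<kappa> (\<kappa> x) = x" if x: "x \<in> F5" for x
      using chom_adj_eq[OF cfield_F4 tower_squares(5), of "\<lambda>x. \<kappa> (\<kappa> x)" "\<lambda>x. x" x] chom_subset[OF kk, of F5] chom_subset[OF id, of F5]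
        4 \<kappa>(7) x sub by (auto simp: F5_def hs)
    have "\<kappa> (\<kappa> s2) = s2" by (simp add: hs \<kappa>)
    then show ?thesis
      using chom_adj_eq[OF cfield_F5 tower_squares(6), of "\<lambda>x. \<kappa> (\<kappa> x)" "\<lambda>x. x" x] kk id
        5 that by (auto simp: F6_def)
  qed
  define m where "m = rho * (\<i> * r3) * (ww\<^sup>2 * cbrt2) * (s1 + s2)"
  have m: "m \<noteq> 0" by (simp add: m_def ii_r3(4) s_sums_nz)
  have kw: "\<kappa> ww = ww" by (simp add: ww_def om_def hs \<kappa>)
  have km: "\<kappa> m = - m" by (simp add: m_def hs \<kappa> kw) (simp add: algebra_simps)
  have th3: "th3 = m / th0" by (simp add: th3_def m_def)
  have "(\<kappa> th0)\<^sup>2 = \<kappa> (th0\<^sup>2)" by (simp add: hs)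
  also have "\<dots> = \<kappa> (gam s1 s2 * rho)" by (simp only: th0_sq)
  also have "\<dots> = gam (- s1) (- s2) * rho" by (simp add: gam_def hs \<kappa>)
  finally have "(\<kappa> th0)\<^sup>2 = th3\<^sup>2" by (simp add: th_squares)
  then have "\<kappa> th0 = th3 \<or> \<kappa> th0 = - th3" by (simp add: power2_eq_iff)
  then obtain e where e: "\<kappa> th0 = e * (m / th0)" "e = 1 \<or> e = - 1"
    unfolding th3 by (metis mult_1 mult_minus1)
  have mF: "m \<in> F6" by (simp add: m_def)
  have "\<kappa> (\<kappa> th0) = e * (\<kappa> m / \<kappa> th0)" using e mF by (auto simp: hs)
  also have "\<dots> = - th0" using e m by (auto simp: km)
  finally show False using \<kappa>2[OF th] by simp
qed

section \<open>The Galois group of the top of the tower\<close>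

text \<open>The relations between the eight generators, transported to prospective images. As each
  step of the tower is proper, they are all that an embedding of \<open>L\<close> has to
  respect.\<close>

definition compatible :: "complex \<Rightarrow> complex \<Rightarrow> complex \<Rightarrow> complex \<Rightarrow> complex \<Rightarrow> complex \<Rightarrow> complex \<Rightarrow> complex \<Rightarrow> bool" where
  "compatible d i a b r u v t \<longleftrightarrow> d ^ 3 = 2 \<and> i\<^sup>2 = - 1 \<and> a\<^sup>2 = 2 \<and> b\<^sup>2 = 3 \<and> r\<^sup>2 = a * b \<and>
    u\<^sup>2 = d - 1 \<and> v\<^sup>2 = om i b * d - 1 \<and> t\<^sup>2 = gam u v * r"

lemma tower_subsets: "F0 \<subseteq> F1" "F1 \<subseteq> F2" "F2 \<subseteq> F3" "F3 \<subseteq> F4" "F4 \<subseteq> F5" "F5 \<subseteq> F6" "F6 \<subseteq> L"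
  using tower_mono adj_subset[OF cfield_F4, of s1] adj_subset[OF cfield_F5, of s2] adj_subset[OF cfield_F6, of th0]
  by (auto simp: F5_def F6_def L_def)

lemma tower_gens: "cbrt2 \<in> F0" "\<i> \<in> F1" "r2 \<in> F2" "r3 \<in> F3" "rho \<in> F4" "s1 \<in> F5" "s2 \<in> F6" "th0 \<in> L"
  using adj_gen[OF cfield_F0, of \<i>] adj_gen[OF cfield_F1, of r2] qadj_gen[of cbrt2] F3_gens F4_gens F5_gens F6_gens L_gens
  by (simp_all only: F0_def F1_def F2_def)

lemma L_hom_exists:
  assumes "compatible d i a b r u v t"
  shows "\<exists>\<sigma>. chom L \<sigma> \<and> \<sigma> cbrt2 = d \<and> \<sigma> \<i> = i \<and> \<sigma> r2 = a \<and> \<sigma> r3 = b \<and> \<sigma> rho = r \<and> \<sigma> s1 = u \<and> \<sigma> s2 = v \<and> \<sigma> th0 = t"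
proof -
  obtain \<sigma> where \<sigma>: "chom F6 \<sigma>" "\<sigma> cbrt2 = d" "\<sigma> \<i> = i" "\<sigma> r2 = a" "\<sigma> r3 = b" "\<sigma> rho = r" "\<sigma> s1 = u" "\<sigma> s2 = v"
    using F6_hom_exists[of d i a b r u v] assms by (auto simp: compatible_def)
  have "\<sigma> (th0\<^sup>2) = gam u v * r"
    by (simp add: th0_sq gam_def chom_simps[OF cfield_F6 \<sigma>(1)] cfield_intros[OF cfield_F6] F6_gens \<sigma>)
  then obtain \<tau> where "chom L \<tau>" "\<tau> th0 = t" "\<forall>x\<in>F6. \<tau> x = \<sigma> x"
    using adj_hom_extend[OF cfield_F6 th0_notin_F6 th0_square_in \<sigma>(1), of t] assms
    by (auto simp: L_def compatible_def)
  then show ?thesis using \<sigma> F6_gens by auto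
qed

lemma L_hom_image:
  assumes \<sigma>: "chom L \<sigma>" and M: "cfield M"
    and g: "\<sigma> cbrt2 \<in> M" "\<sigma> \<i> \<in> M" "\<sigma> r2 \<in> M" "\<sigma> r3 \<in> M" "\<sigma> rho \<in> M" "\<sigma> s1 \<in> M" "\<sigma> s2 \<in> M" "\<sigma> th0 \<in> M"
  shows "\<sigma> ` L \<subseteq> M"
  using chom_adj_image[OF cfield_F6 th0_square_in _ M F6_hom_image[OF chom_subset[OF \<sigma> tower_subsets(7)] M g(1-7)] g(8)] \<sigma>
  by (simp add: L_def)

lemma L_minimal:
  assumes "cfield M" "cbrt2 \<in> M" "\<i> \<in> M" "r2 \<in> M" "r3 \<in> M" "rho \<in> M" "s1 \<in> M" "s2 \<in> M" "th0 \<in> M"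
  shows "L \<subseteq> M"
  using L_hom_image[of id M] assms by (simp add: chom_def)

lemma L_finite_dimension: "CR.finite_dimension \<rat> L"
  unfolding L_def F6_def F5_def F4_def F3_def F2_def F1_def
  by (intro adj_finite_dimension; (intro cfield_F0 cfield_F1[unfolded F1_def]
      cfield_F2[unfolded F2_def F1_def] cfield_F3[unfolded F3_def F2_def F1_def]
      cfield_F4[unfolded F4_def F3_def F2_def F1_def] cfield_F5[unfolded F5_def F4_def F3_def F2_def F1_def]
      cfield_F6[unfolded F6_def F5_def F4_def F3_def F2_def F1_def]
      tower_squares[unfolded F6_def F5_def F4_def F3_def F2_def F1_def]
      CR.finite_dimensionI[OF qadj_dimension[OF cbrt2_min_poly, folded F0_def]])?)

lemma Gal_exists:
  assumes "compatible d i a b r u v t" "{d, i, a, b, r, u, v, t} \<subseteq> L"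
  shows "\<exists>\<sigma>\<in>Gal L. \<sigma> cbrt2 = d \<and> \<sigma> \<i> = i \<and> \<sigma> r2 = a \<and> \<sigma> r3 = b \<and> \<sigma> rho = r \<and> \<sigma> s1 = u \<and> \<sigma> s2 = v \<and> \<sigma> th0 = t"
proof -
  obtain \<sigma> where \<sigma>: "chom L \<sigma>" "\<sigma> cbrt2 = d" "\<sigma> \<i> = i" "\<sigma> r2 = a" "\<sigma> r3 = b" "\<sigma> rho = r" "\<sigma> s1 = u" "\<sigma> s2 = v" "\<sigma> th0 = t"
    using L_hom_exists[OF assms(1)] by blast
  have "\<sigma> ` L \<subseteq> L" by (rule L_hom_image[OF \<sigma>(1) cfield_L]) (use assms(2) \<sigma> in auto)
  then have "restrict \<sigma> L \<in> Gal L" by (rule Gal_restrict[OF cfield_L L_finite_dimension \<sigma>(1)])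
  then show ?thesis by (rule bexI[rotated]) (simp add: \<sigma> L_gens)
qed

lemma L_gens2: "s3 \<in> L" "ww \<in> L" "th1 \<in> L" "th2 \<in> L" "th3 \<in> L"
proof -
  show *: "s3 \<in> L" "ww \<in> L" using F6_gens2 tower_subsets by auto
  show "th1 \<in> L" "th2 \<in> L" "th3 \<in> L"
    unfolding th1_def th2_def th3_def by (simp_all add: cfield_intros[OF cfield_L] L_gens *)
qed

definition zeta :: complex where "zeta = (1 + \<i>) / r2"

lemma zeta_in_L: "zeta \<in> L"
  by (simp add: zeta_def cfield_intros[OF cfield_L] L_gens)

lemma zeta_sq: "zeta\<^sup>2 = \<i>"
  by (simp add: zeta_def power_divide squares) (simp add: power2_eq_square algebra_simps)

lemma om_ww: "om \<i> r3 = ww" "om (- \<i>) (- r3) = ww" "om (- \<i>) r3 = ww\<^sup>2" "om \<i> (- r3) = ww\<^sup>2"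
proof -
  show "om \<i> r3 = ww" "om (- \<i>) (- r3) = ww" by (simp_all add: ww_def om_def)
  have "om (- \<i>) r3 = - 1 - ww" "om \<i> (- r3) = - 1 - ww" by (simp_all add: ww_def om_def field_simps)
  then show "om (- \<i>) r3 = ww\<^sup>2" "om \<i> (- r3) = ww\<^sup>2" by (simp_all add: ww)
qed



lemmas compatible_simps = compatible_def cbrt2_cubed squares(1-4) om_ww s_squares gam_s th0_sq th_squares power_mult_distrib
  zeta_sq ww(2)

text \<open>The last tuple negates only \<open>th0\<close>. The tuples 9, 8, 7, 6, 5, 3 and 1 move
  \<open>s2\<close>, \<open>s1\<close>, \<open>rho\<close>, \<open>r3\<close>, \<open>r2\<close>,
  \<open>\<i>\<close> and \<open>cbrt2\<close> respectively and fix all generators adjoined earlier,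
  as the descent to the fixed field requires. The first five induce the five moves of
  labels.\<close>

lemma compatible_generators:
  "compatible (ww * cbrt2) \<i> r2 r3 rho s2 s3 th0"
  "compatible cbrt2 (- \<i>) (- r2) (- r3) rho s1 s2 th0"
  "compatible cbrt2 (- \<i>) r2 r3 rho s1 s3 th0"
  "compatible cbrt2 \<i> r2 r3 rho (- s1) (- s2) th3"
  "compatible cbrt2 \<i> (- r2) r3 (\<i> * rho) s1 s2 (zeta * th0)"
  "compatible cbrt2 \<i> r2 (- r3) (\<i> * rho) s1 s3 (zeta * th0)"
  "compatible cbrt2 \<i> r2 r3 (- rho) s1 s2 (\<i> * th0)"
  "compatible cbrt2 \<i> r2 r3 rho (- s1) s2 th2"
  "compatible cbrt2 \<i> r2 r3 rho s1 (- s2) th1"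
  "compatible cbrt2 \<i> r2 r3 rho s1 s2 (- th0)"
  by (simp_all add: compatible_simps) (simp_all add: power2_eq_square mult_ac)

lemma F0_fixed:
  assumes \<sigma>: "chom F0 \<sigma>" "\<sigma> cbrt2 = ww * cbrt2" and x: "x \<in> F0" "\<sigma> x = x"
  shows "x \<in> \<rat>"
proof -
  obtain a b c where abc: "x = of_rat a + of_rat b * cbrt2 + of_rat c * cbrt2\<^sup>2" using x(1) by (rule F0_cases)
  have "\<sigma> x = of_rat a + of_rat b * (ww * cbrt2) + of_rat c * (ww * cbrt2)\<^sup>2"
    unfolding abc by (simp add: chom_simps[OF cfield_F0 \<sigma>(1)] cfield_intros[OF cfield_F0] tower_gens(1) \<sigma>(2))
  then have "(of_rat b + of_rat c * (1 + ww) * cbrt2) * ((1 - ww) * cbrt2) = 0"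
    using x(2) unfolding abc by (simp add: algebra_simps power2_eq_square)
  then have "of_rat b + of_rat c * (1 + ww) * cbrt2 = 0" using ii_r3(3) by simp
  moreover have "1 + ww = - (ww\<^sup>2)" by (simp add: ww)
  ultimately have e: "of_rat b = of_rat c * (ww\<^sup>2 * cbrt2)" by (simp add: mult.assoc)
  have "(ww\<^sup>2) ^ 3 = 1" using ww(2) by (metis mult.commute power_mult power_one)
  then have "of_rat b ^ 3 = of_rat c ^ 3 * (2 :: complex)" unfolding e by (simp add: power_mult_distrib cbrt2_cubed)
  then have "(of_rat (b ^ 3) :: complex) = of_rat (c ^ 3 * 2)" by (simp add: of_rat_power of_rat_mult)
  then have "b ^ 3 = c ^ 3 * 2" by (simp only: of_rat_eq_iff)
  have "c = 0"
  proof (rule ccontr)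
    assume "c \<noteq> 0"
    then have "(b / c) ^ 3 = 2" using \<open>b ^ 3 = c ^ 3 * 2\<close> by (simp add: power_divide)
    then show False using no_rat_cbrt2 by blast
  qed
  then show ?thesis using e abc by simp
qed

lemma chom_fix_F0: "chom F0 \<sigma> \<Longrightarrow> \<sigma> cbrt2 = cbrt2 \<Longrightarrow> x \<in> F0 \<Longrightarrow> \<sigma> x = x"
  using rpoly_hom[OF cfield_F0 _ tower_gens(1), of \<sigma>] by (auto simp: F0_def qadj_def)

lemma chom_fix_adj:
  assumes "cfield F" "e\<^sup>2 \<in> F" "chom L \<sigma>" "adj F e \<subseteq> L" "\<And>u. u \<in> F \<Longrightarrow> \<sigma> u = u" "\<sigma> e = e" "x \<in> adj F e"
  shows "\<sigma> x = x"
  using chom_adj_eq[OF assms(1,2) chom_subset[OF assms(3,4)], of id x] assms(5-7) by (simp add: chom_def)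

lemma tower_in_L: "F0 \<subseteq> L" "F1 \<subseteq> L" "F2 \<subseteq> L" "F3 \<subseteq> L" "F4 \<subseteq> L" "F5 \<subseteq> L" "F6 \<subseteq> L"
  using tower_subsets by auto

lemma chom_fix_tower:
  assumes \<sigma>: "chom L \<sigma>"
  shows "\<sigma> cbrt2 = cbrt2 \<Longrightarrow> x \<in> F0 \<Longrightarrow> \<sigma> x = x"
    and "\<sigma> cbrt2 = cbrt2 \<Longrightarrow> \<sigma> \<i> = \<i> \<Longrightarrow> x \<in> F1 \<Longrightarrow> \<sigma> x = x"
    and "\<sigma> cbrt2 = cbrt2 \<Longrightarrow> \<sigma> \<i> = \<i> \<Longrightarrow> \<sigma> r2 = r2 \<Longrightarrow> x \<in> F2 \<Longrightarrow> \<sigma> x = x"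
    and "\<sigma> cbrt2 = cbrt2 \<Longrightarrow> \<sigma> \<i> = \<i> \<Longrightarrow> \<sigma> r2 = r2 \<Longrightarrow> \<sigma> r3 = r3 \<Longrightarrow> x \<in> F3 \<Longrightarrow> \<sigma> x = x"
    and "\<sigma> cbrt2 = cbrt2 \<Longrightarrow> \<sigma> \<i> = \<i> \<Longrightarrow> \<sigma> r2 = r2 \<Longrightarrow> \<sigma> r3 = r3 \<Longrightarrow> \<sigma> rho = rho \<Longrightarrow> x \<in> F4 \<Longrightarrow> \<sigma> x = x"
    and "\<sigma> cbrt2 = cbrt2 \<Longrightarrow> \<sigma> \<i> = \<i> \<Longrightarrow> \<sigma> r2 = r2 \<Longrightarrow> \<sigma> r3 = r3 \<Longrightarrow> \<sigma> rho = rho \<Longrightarrow> \<sigma> s1 = s1 \<Longrightarrow> x \<in> F5 \<Longrightarrow> \<sigma> x = x"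
    and "\<sigma> cbrt2 = cbrt2 \<Longrightarrow> \<sigma> \<i> = \<i> \<Longrightarrow> \<sigma> r2 = r2 \<Longrightarrow> \<sigma> r3 = r3 \<Longrightarrow> \<sigma> rho = rho \<Longrightarrow> \<sigma> s1 = s1 \<Longrightarrow> \<sigma> s2 = s2 \<Longrightarrow> x \<in> F6 \<Longrightarrow> \<sigma> x = x"
    and "\<sigma> cbrt2 = cbrt2 \<Longrightarrow> \<sigma> \<i> = \<i> \<Longrightarrow> \<sigma> r2 = r2 \<Longrightarrow> \<sigma> r3 = r3 \<Longrightarrow> \<sigma> rho = rho \<Longrightarrow> \<sigma> s1 = s1 \<Longrightarrow> \<sigma> s2 = s2 \<Longrightarrow> \<sigma> th0 = th0 \<Longrightarrow> x \<in> L \<Longrightarrow> \<sigma> x = x"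
proof -
  show 0: "\<sigma> cbrt2 = cbrt2 \<Longrightarrow> x \<in> F0 \<Longrightarrow> \<sigma> x = x" for x
    using chom_fix_F0[OF chom_subset[OF \<sigma> tower_in_L(1)]] .
  note st = chom_fix_adj[OF _ _ \<sigma>]
  show 1: "\<sigma> cbrt2 = cbrt2 \<Longrightarrow> \<sigma> \<i> = \<i> \<Longrightarrow> x \<in> F1 \<Longrightarrow> \<sigma> x = x" for x
    using st[OF cfield_F0 tower_squares(1), folded F1_def, OF tower_in_L(2) 0] by blast
  show 2: "\<sigma> cbrt2 = cbrt2 \<Longrightarrow> \<sigma> \<i> = \<i> \<Longrightarrow> \<sigma> r2 = r2 \<Longrightarrow> x \<in> F2 \<Longrightarrow> \<sigma> x = x" for x
    using st[OF cfield_F1 tower_squares(2), folded F2_def, OF tower_in_L(3) 1] by blast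
  show 3: "\<sigma> cbrt2 = cbrt2 \<Longrightarrow> \<sigma> \<i> = \<i> \<Longrightarrow> \<sigma> r2 = r2 \<Longrightarrow> \<sigma> r3 = r3 \<Longrightarrow> x \<in> F3 \<Longrightarrow> \<sigma> x = x" for x
    using st[OF cfield_F2 tower_squares(3), folded F3_def, OF tower_in_L(4) 2] by blast
  show 4: "\<sigma> cbrt2 = cbrt2 \<Longrightarrow> \<sigma> \<i> = \<i> \<Longrightarrow> \<sigma> r2 = r2 \<Longrightarrow> \<sigma> r3 = r3 \<Longrightarrow> \<sigma> rho = rho \<Longrightarrow> x \<in> F4 \<Longrightarrow> \<sigma> x = x" for x
    using st[OF cfield_F3 tower_squares(4), folded F4_def, OF tower_in_L(5) 3] by blast
  show 5: "\<sigma> cbrt2 = cbrt2 \<Longrightarrow> \<sigma> \<i> = \<i> \<Longrightarrow> \<sigma> r2 = r2 \<Longrightarrow> \<sigma> r3 = r3 \<Longrightarrow> \<sigma> rho = rho \<Longrightarrow> \<sigma> s1 = s1 \<Longrightarrow> x \<in> F5 \<Longrightarrow> \<sigma> x = x" for x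
    using st[OF cfield_F4 tower_squares(5), folded F5_def, OF tower_in_L(6) 4] by blast
  show 6: "\<sigma> cbrt2 = cbrt2 \<Longrightarrow> \<sigma> \<i> = \<i> \<Longrightarrow> \<sigma> r2 = r2 \<Longrightarrow> \<sigma> r3 = r3 \<Longrightarrow> \<sigma> rho = rho \<Longrightarrow> \<sigma> s1 = s1 \<Longrightarrow> \<sigma> s2 = s2 \<Longrightarrow> x \<in> F6 \<Longrightarrow> \<sigma> x = x" for x
    using st[OF cfield_F5 tower_squares(6), folded F6_def, OF tower_in_L(7) 5] by blast
  show "\<sigma> cbrt2 = cbrt2 \<Longrightarrow> \<sigma> \<i> = \<i> \<Longrightarrow> \<sigma> r2 = r2 \<Longrightarrow> \<sigma> r3 = r3 \<Longrightarrow> \<sigma> rho = rho \<Longrightarrow> \<sigma> s1 = s1 \<Longrightarrow> \<sigma> s2 = s2 \<Longrightarrow> \<sigma> th0 = th0 \<Longrightarrow> x \<in> L \<Longrightarrow> \<sigma> x = x"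
    using st[OF cfield_F6 tower_squares(7), folded L_def, OF order_refl 6] by blast
qed

text \<open>An element fixed by an automorphism that negates the top generator and fixes the field
  below lies in that field. Seven such descents lead to \<open>F0\<close>, where
  \<open>cbrt2 \<mapsto> ww * cbrt2\<close> leaves only the rationals.\<close>

lemma L_fixed_field:
  assumes x: "x \<in> L" "\<And>\<sigma>. \<sigma> \<in> Gal L \<Longrightarrow> \<sigma> x = x"
  shows "x \<in> \<rat>"
proof -
  note [simp] = L_gens L_gens2 zeta_in_L cfield_intros[OF cfield_L]
  have ch: "chom L \<sigma>" "chom F0 \<sigma>" "chom F1 \<sigma>" "chom F2 \<sigma>" "chom F3 \<sigma>" "chom F4 \<sigma>" "chom F5 \<sigma>" "chom F6 \<sigma>"
    if "\<sigma> \<in> Gal L" for \<sigma>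
    using Gal_chom[OF cfield_L that] chom_subset tower_in_L by blast+
  have "x \<in> F6"
  proof -
    obtain \<sigma> where \<sigma>: "\<sigma> \<in> Gal L" "\<sigma> cbrt2 = cbrt2" "\<sigma> \<i> = \<i>" "\<sigma> r2 = r2" "\<sigma> r3 = r3" "\<sigma> rho = rho" "\<sigma> s1 = s1" "\<sigma> s2 = s2" "\<sigma> th0 = - th0"
      using Gal_exists[OF compatible_generators(10)] by auto
    show ?thesis
      by (rule adj_fixed[OF cfield_F6 tower_squares(7) ch(1)[OF \<sigma>(1), unfolded L_def] _ \<sigma>(9)])
        (use chom_fix_tower(7)[OF ch(1)[OF \<sigma>(1)] \<sigma>(2-8)] x \<sigma>(1) in \<open>auto simp flip: L_def\<close>)
  qed
  have "x \<in> F5"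
  proof -
    obtain \<sigma> where \<sigma>: "\<sigma> \<in> Gal L" "\<sigma> cbrt2 = cbrt2" "\<sigma> \<i> = \<i>" "\<sigma> r2 = r2" "\<sigma> r3 = r3" "\<sigma> rho = rho" "\<sigma> s1 = s1" "\<sigma> s2 = - s2"
      using Gal_exists[OF compatible_generators(9)] by auto
    show ?thesis
      by (rule adj_fixed[OF cfield_F5 tower_squares(6) ch(8)[OF \<sigma>(1), unfolded F6_def] _ \<sigma>(8)])
        (use chom_fix_tower(6)[OF ch(1)[OF \<sigma>(1)] \<sigma>(2-7)] x \<sigma>(1) \<open>x \<in> F6\<close> in \<open>auto simp flip: F6_def\<close>)
  qed
  have "x \<in> F4"
  proof -
    obtain \<sigma> where \<sigma>: "\<sigma> \<in> Gal L" "\<sigma> cbrt2 = cbrt2" "\<sigma> \<i> = \<i>" "\<sigma> r2 = r2" "\<sigma> r3 = r3" "\<sigma> rho = rho" "\<sigma> s1 = - s1"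
      using Gal_exists[OF compatible_generators(8)] by auto
    show ?thesis
      by (rule adj_fixed[OF cfield_F4 tower_squares(5) ch(7)[OF \<sigma>(1), unfolded F5_def] _ \<sigma>(7)])
        (use chom_fix_tower(5)[OF ch(1)[OF \<sigma>(1)] \<sigma>(2-6)] x \<sigma>(1) \<open>x \<in> F5\<close> in \<open>auto simp flip: F5_def\<close>)
  qed
  have "x \<in> F3"
  proof -
    obtain \<sigma> where \<sigma>: "\<sigma> \<in> Gal L" "\<sigma> cbrt2 = cbrt2" "\<sigma> \<i> = \<i>" "\<sigma> r2 = r2" "\<sigma> r3 = r3" "\<sigma> rho = - rho"
      using Gal_exists[OF compatible_generators(7)] by auto
    show ?thesis
      by (rule adj_fixed[OF cfield_F3 tower_squares(4) ch(6)[OF \<sigma>(1), unfolded F4_def] _ \<sigma>(6)])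
        (use chom_fix_tower(4)[OF ch(1)[OF \<sigma>(1)] \<sigma>(2-5)] x \<sigma>(1) \<open>x \<in> F4\<close> in \<open>auto simp flip: F4_def\<close>)
  qed
  have "x \<in> F2"
  proof -
    obtain \<sigma> where \<sigma>: "\<sigma> \<in> Gal L" "\<sigma> cbrt2 = cbrt2" "\<sigma> \<i> = \<i>" "\<sigma> r2 = r2" "\<sigma> r3 = - r3"
      using Gal_exists[OF compatible_generators(6)] by auto
    show ?thesis
      by (rule adj_fixed[OF cfield_F2 tower_squares(3) ch(5)[OF \<sigma>(1), unfolded F3_def] _ \<sigma>(5)])
        (use chom_fix_tower(3)[OF ch(1)[OF \<sigma>(1)] \<sigma>(2-4)] x \<sigma>(1) \<open>x \<in> F3\<close> in \<open>auto simp flip: F3_def\<close>)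
  qed
  have "x \<in> F1"
  proof -
    obtain \<sigma> where \<sigma>: "\<sigma> \<in> Gal L" "\<sigma> cbrt2 = cbrt2" "\<sigma> \<i> = \<i>" "\<sigma> r2 = - r2"
      using Gal_exists[OF compatible_generators(5)] by auto
    show ?thesis
      by (rule adj_fixed[OF cfield_F1 tower_squares(2) ch(4)[OF \<sigma>(1), unfolded F2_def] _ \<sigma>(4)])
        (use chom_fix_tower(2)[OF ch(1)[OF \<sigma>(1)] \<sigma>(2-3)] x \<sigma>(1) \<open>x \<in> F2\<close> in \<open>auto simp flip: F2_def\<close>)
  qed
  have "x \<in> F0"
  proof -
    obtain \<sigma> where \<sigma>: "\<sigma> \<in> Gal L" "\<sigma> cbrt2 = cbrt2" "\<sigma> \<i> = - \<i>"
      using Gal_exists[OF compatible_generators(3)] by auto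
    show ?thesis
      by (rule adj_fixed[OF cfield_F0 tower_squares(1) ch(3)[OF \<sigma>(1), unfolded F1_def] _ \<sigma>(3)])
        (use chom_fix_tower(1)[OF ch(1)[OF \<sigma>(1)] \<sigma>(2)] x \<sigma>(1) \<open>x \<in> F1\<close> in \<open>auto simp flip: F1_def\<close>)
  qed
  obtain \<sigma> where \<sigma>: "\<sigma> \<in> Gal L" "\<sigma> cbrt2 = ww * cbrt2"
    using Gal_exists[OF compatible_generators(1)] by auto
  show ?thesis using F0_fixed[OF ch(2)[OF \<sigma>(1)] \<sigma>(2) \<open>x \<in> F0\<close>] x(2)[OF \<sigma>(1)] by blast
qed

lemma L_galois: "galois_extension L \<rat>"
  unfolding galois_extension_def
proof (intro conjI)
  show "{x \<in> L. \<forall>\<sigma>\<in>Gal L. \<sigma> x = x} = \<rat>"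
    using L_fixed_field chom_Rats[OF cfield_L Gal_chom[OF cfield_L]] cfield_Rats[OF cfield_L] by blast
qed (use cfield_L cfield_Rats_cfield L_finite_dimension cfield_Rats[OF cfield_L] in \<open>auto simp: cfield_iff_subfield\<close>)

section \<open>A combinatorial model of the two actions\<close>

text \<open>The label \<open>(j, n)\<close> stands for \<open>zeta ^ n * th j\<close> in the first action and for \<open>r2\<close> times this number in the
  second one. The maps below describe how five automorphisms move the labels; the parameter \<open>e\<close>
  is \<open>0\<close> in the first action and \<open>4\<close> in the second one, \<open>zeta ^ 4 = -1\<close> being the factor that \<open>r2\<close>
  picks up.\<close>

type_synonym label = "nat \<times> nat"

definition Labels :: "label set" where "Labels = {0..<4} \<times> {0..<8}"

fun rotate_label :: "label \<Rightarrow> label" where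
  "rotate_label (j, n) = (if j = 0 then 0 else if j = 3 then 1 else j + 1, n)"

fun triple_label :: "nat \<Rightarrow> label \<Rightarrow> label" where
  "triple_label e (j, n) = (j, (3 * n + e) mod 8)"

text \<open>The automorphism negates \<open>\<i>\<close> and exchanges \<open>s2\<close> and
  \<open>s3\<close>: the factor 7 inverts \<open>zeta\<close>, and 4 is the sign that
  \<open>\<i> * r3\<close> brings into \<open>th1\<close>, \<open>th2\<close> and
  \<open>th3\<close>.\<close>

fun cnj_label :: "label \<Rightarrow> label" where
  "cnj_label (j, n) = (if j = 0 then (0, 7 * n mod 8) else (if j = 1 then 1 else 5 - j, (7 * n + 4) mod 8))"

text \<open>\<open>th0\<close> goes to \<open>th3\<close> and \<open>th3\<close> to
  \<open>- th0\<close>, while \<open>th2\<close> goes to \<open>th1\<close> and \<open>th1\<close>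
  to \<open>- th2\<close>. Applied twice it is multiplication by -1.\<close>

fun flip_label :: "label \<Rightarrow> label" where
  "flip_label (j, n) = (3 - j, if j = 0 \<or> j = 2 then n else (n + 4) mod 8)"

fun shift_label :: "nat \<Rightarrow> label \<Rightarrow> label" where
  "shift_label e (j, n) = (j, (5 * n + 1 + e) mod 8)"

definition label_moves :: "((label \<Rightarrow> label) \<times> (label \<Rightarrow> label)) list" where
  "label_moves = [(rotate_label, rotate_label), (triple_label 0, triple_label 4), (cnj_label, cnj_label),
    (flip_label, flip_label), (shift_label 0, shift_label 4)]"

text \<open>The values 1 to 5 name five of the eight orbits of pairs, one label being taken in each
  action; the other three orbits receive the entry 0 in the matrices used and share the value 0.
  Within a fibre the orbits are told apart by the difference up to sign. Between different fibres, 2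
  and 6 are separated by a sign that depends on the parity of \<open>n\<close> and on the cyclic
  order of the fibres 1, 2, 3. The summand 8 keeps the subtraction of naturals from
  truncating.\<close>

fun pair_type :: "label \<Rightarrow> label \<Rightarrow> nat" where
  "pair_type (j, n) (l, m) = (let d = (m + 8 - n) mod 8 in
    if j = l then (if d = 1 \<or> d = 7 then 1 else if d = 2 \<or> d = 6 then 2 else if d = 3 \<or> d = 5 then 3 else 0)
    else (if d = 2 \<or> d = 6 then
      (if (d = 2) = (even n = (j = 0 \<or> (l = j + 1 \<or> (j = 3 \<and> l = 1)))) then 4 else 5) else 0))"

definition kernel :: "int \<Rightarrow> int \<Rightarrow> int \<Rightarrow> int \<Rightarrow> int \<Rightarrow> label \<Rightarrow> label \<Rightarrow> int" where
  "kernel x1 x2 x3 a b p q = [0, x1, x2, x3, a, b] ! pair_type p q"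

abbreviation "label_list \<equiv> List.product [0..<4] [0..<8]"

lemma set_label_list: "set label_list = Labels"
  by (auto simp: Labels_def)

lemma finite_Labels: "finite Labels"
  by (simp add: Labels_def)

text \<open>A finite check. Both placements of \<open>f\<close> and \<open>f'\<close> are included
  because the same \<open>pair_type\<close> describes matrices from the first action to the second
  and back.\<close>

lemma label_moves_invariant:
  "list_all (\<lambda>(f, f'). list_all (\<lambda>x. f x \<in> set label_list \<and> f' x \<in> set label_list \<and>
    list_all (\<lambda>y. pair_type (f x) (f' y) = pair_type x y \<and> pair_type (f' x) (f y) = pair_type x y)
    label_list) label_list) label_moves"
  by code_simp

text \<open>The matrix \<open>kernel x1 x2 x3 a b\<close> has fibre sums
  \<open>D = 2 * (x1 + x2 + x3)\<close> and \<open>U = a + b\<close>. The values of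
  \<open>D + 3 * U\<close> and \<open>D - U\<close> are 3, -1 and 1, -3 for the pair with product 3,
  and 5, 1 and 11, 55 for the pair with product 55. Only the row of the base label is computed;
  transitivity supplies the others.\<close>

lemma kernel_products_at_0:
  "list_all (\<lambda>z. (\<Sum>y\<leftarrow>label_list. kernel 0 0 0 1 0 (0, 0) y * kernel 0 (-1) 0 1 0 y z) = (if z = (0, 0) then 3 else 0) \<and>
    (\<Sum>y\<leftarrow>label_list. kernel 0 (-1) 0 1 0 (0, 0) y * kernel 0 0 0 1 0 y z) = (if z = (0, 0) then 3 else 0) \<and>
    (\<Sum>y\<leftarrow>label_list. kernel 1 1 (-1) 1 0 (0, 0) y * kernel 5 22 (-5) (-3) (-8) y z) = (if z = (0, 0) then 55 else 0) \<and>
    (\<Sum>y\<leftarrow>label_list. kernel 5 22 (-5) (-3) (-8) (0, 0) y * kernel 1 1 (-1) 1 0 y z) = (if z = (0, 0) then 55 else 0)) label_list"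
  by code_simp

lemma less_4_8:
  "(j::nat) < 4 \<longleftrightarrow> j = 0 \<or> j = 1 \<or> j = 2 \<or> j = 3"
  "(n::nat) < 8 \<longleftrightarrow> n = 0 \<or> n = 1 \<or> n = 2 \<or> n = 3 \<or> n = 4 \<or> n = 5 \<or> n = 6 \<or> n = 7"
  by auto

lemma sum_4_8:
  "(\<Sum>j\<in>{0..<4::nat}. g j) = g 0 + g 1 + g 2 + (g 3 :: int)"
  "(\<Sum>n\<in>{0..<8::nat}. h n) = h 0 + h 1 + h 2 + h 3 + h 4 + h 5 + h 6 + (h 7 :: int)"
  by (simp_all add: eval_nat_numeral)

text \<open>The shift permutes the eight labels of a fibre cyclically in both actions, so the sum
  does not depend on \<open>m\<close>. Rotation and flip act on the four fibres as the alternating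
  group, which is doubly transitive; so only the alternative between \<open>j = l\<close> and
  \<open>j \<noteq> l\<close> remains.\<close>

lemma fibre_sums:
  fixes M :: "label \<Rightarrow> label \<Rightarrow> int"
  assumes e: "e = 0 \<and> e' = 4 \<or> e = 4 \<and> e' = 0"
    and rot: "\<And>x y. x \<in> Labels \<Longrightarrow> y \<in> Labels \<Longrightarrow> M (rotate_label x) (rotate_label y) = M x y"
    and flip: "\<And>x y. x \<in> Labels \<Longrightarrow> y \<in> Labels \<Longrightarrow> M (flip_label x) (flip_label y) = M x y"
    and shift: "\<And>x y. x \<in> Labels \<Longrightarrow> y \<in> Labels \<Longrightarrow> M (shift_label e x) (shift_label e' y) = M x y"
  shows "\<exists>D U. \<forall>j<4. \<forall>l<4. \<forall>m<8. (\<Sum>n\<in>{0..<8}. M (j, n) (l, m)) = (if j = l then D else U)"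
proof -
  define R where "R j l m = (\<Sum>n\<in>{0..<8}. M (j, n) (l, m))" for j l m
  have mem: "(j, n) \<in> Labels \<longleftrightarrow> j < 4 \<and> n < 8" for j n by (simp add: Labels_def)
  have step: "R j l ((5 * m + 1 + e') mod 8) = R j l m" if "j < 4" "l < 4" "m < 8" for j l m
  proof -
    have "R j l m = (\<Sum>n\<in>{0..<8}. M (j, (5 * n + 1 + e) mod 8) (l, (5 * m + 1 + e') mod 8))"
      unfolding R_def using shift[of "(j, _)" "(l, m)"] that by (intro sum.cong) (auto simp: mem)
    also have "\<dots> = R j l ((5 * m + 1 + e') mod 8)"
      unfolding R_def sum_4_8 using e by auto
    finally show ?thesis by simp
  qed
  have const: "R j l m = R j l 0" if jl: "j < 4" "l < 4" and m: "m < 8" for j l m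
    using e step[OF jl, of 0] step[OF jl, of 1] step[OF jl, of 2] step[OF jl, of 3]
      step[OF jl, of 4] step[OF jl, of 5] step[OF jl, of 6] step[OF jl, of 7] m
    unfolding less_4_8 by auto
  have r: "R (fst (rotate_label (j, 0))) (fst (rotate_label (l, 0))) 0 = R j l 0" if "j < 4" "l < 4" for j l
    unfolding R_def using rot[of "(j, _)" "(l, 0)"] that by (intro sum.cong) (auto simp: mem)
  have f: "R (3 - j) (3 - l) 0 = R j l 0" if jl: "j < 4" "l < 4" for j l
  proof -
    have "R j l 0 = (\<Sum>n\<in>{0..<8}. M (flip_label (j, n)) (flip_label (l, 0)))"
      unfolding R_def using flip[of "(j, _)" "(l, 0)"] that by (intro sum.cong) (auto simp: mem)
    also have "\<dots> = R (3 - j) (3 - l) (snd (flip_label (l, 0)))"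
      unfolding R_def sum_4_8 by auto
    also have "\<dots> = R (3 - j) (3 - l) 0"
      using jl by (intro const) auto
    finally show ?thesis by simp
  qed
  have "R j l 0 = (if j = l then R 0 0 0 else R 0 1 0)" if "j < 4" "l < 4" for j l
    using that r[of 0 1] r[of 0 2] r[of 1 0] r[of 2 0] r[of 1 1] r[of 2 2] r[of 1 2] r[of 2 3] r[of 2 1] r[of 3 2]
      f[of 0 0] f[of 0 1] f[of 0 2] f[of 0 3] f[of 1 0]  f[of 1 2]
    unfolding less_4_8 by (auto simp: numeral_2_eq_2 numeral_3_eq_3)
  then show ?thesis using const unfolding R_def by metis
qed

lemma no_integral_matrices:
  fixes M N :: "label \<Rightarrow> label \<Rightarrow> int"
  assumes M: "\<And>f f' x y. (f, f') \<in> set label_moves \<Longrightarrow> x \<in> Labels \<Longrightarrow> y \<in> Labels \<Longrightarrow> M (f x) (f' y) = M x y"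
    and N: "\<And>f f' x y. (f, f') \<in> set label_moves \<Longrightarrow> x \<in> Labels \<Longrightarrow> y \<in> Labels \<Longrightarrow> N (f' x) (f y) = N x y"
    and MN: "\<And>x z. x \<in> Labels \<Longrightarrow> z \<in> Labels \<Longrightarrow> (\<Sum>y\<in>Labels. M x y * N y z) = (if x = z then 1 else 0)"
  shows False
proof -
  obtain D U where DU: "\<And>j l m. j < 4 \<Longrightarrow> l < 4 \<Longrightarrow> m < 8 \<Longrightarrow> (\<Sum>n\<in>{0..<8}. M (j, n) (l, m)) = (if j = l then D else U)"
    using fibre_sums[of 0 4 M] M unfolding label_moves_def by force
  obtain D' U' where DU': "\<And>j l m. j < 4 \<Longrightarrow> l < 4 \<Longrightarrow> m < 8 \<Longrightarrow> (\<Sum>n\<in>{0..<8}. N (j, n) (l, m)) = (if j = l then D' else U')"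
    using fibre_sums[of 4 0 N] N unfolding label_moves_def by force
  have mem: "(j, n) \<in> Labels \<longleftrightarrow> j < 4 \<and> n < 8" for j n by (simp add: Labels_def)
  \<comment> \<open>Taking fibre sums is multiplicative, because those of \<open>M\<close> do not
    depend on the label \<open>m\<close> inside the target fibre. The two 4 by 4 images are
    therefore inverse to each other.\<close>
  have prod: "(\<Sum>l\<in>{0..<4}. (if j = l then D else U) * (if l = k then D' else U')) = (if j = k then 1 else 0)"
    if jk: "j < 4" "k < 4" for j k :: nat
  proof -
    have "(\<Sum>l\<in>{0..<4}. (if j = l then D else U) * (if l = k then D' else U'))
        = (\<Sum>l\<in>{0..<4}. \<Sum>m\<in>{0..<8}. (if j = l then D else U) * N (l, m) (k, 0))"
      using jk by (intro sum.cong) (auto simp: DU' simp flip: sum_distrib_left)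
    also have "\<dots> = (\<Sum>l\<in>{0..<4}. \<Sum>m\<in>{0..<8}. \<Sum>n\<in>{0..<8}. M (j, n) (l, m) * N (l, m) (k, 0))"
      using jk by (intro sum.cong) (auto simp: DU simp flip: sum_distrib_right)
    also have "\<dots> = (\<Sum>y\<in>Labels. \<Sum>n\<in>{0..<8}. M (j, n) y * N y (k, 0))"
      unfolding Labels_def by (subst sum.cartesian_product) (simp add: case_prod_unfold)
    also have "\<dots> = (\<Sum>n\<in>{0..<8}. \<Sum>y\<in>Labels. M (j, n) y * N y (k, 0))"
      by (rule sum.swap)
    also have "\<dots> = (\<Sum>n\<in>{0..<8}. if j = k \<and> n = (0::nat) then 1 else 0)"
      using jk by (intro sum.cong) (auto simp: MN mem)
    also have "\<dots> = (if j = k then 1 else 0)" by (simp add: sum_4_8)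
    finally show ?thesis .
  qed
  have 1: "D * D' + 3 * (U * U') = 1" using prod[of 0 0] by (simp add: sum_4_8 algebra_simps)
  have 2: "D * U' + U * D' + 2 * (U * U') = 0" using prod[of 0 1] by (simp add: sum_4_8 algebra_simps)
  \<comment> \<open>The two images commute and have common eigenvectors, so corresponding
    eigenvalues multiply to 1.\<close>
  have "(D - U) * (D' - U') = 1" "(D + 3 * U) * (D' + 3 * U') = 1"
    using 1 2 by (simp_all add: algebra_simps)
  then have u: "D - U = 1 \<or> D - U = - 1" "D + 3 * U = 1 \<or> D + 3 * U = - 1"
    by (auto simp: zmult_eq_1_iff)
  text \<open>No point of a fibre is fixed by the stabiliser of a point in the same fibre, so \<open>D\<close> is even.\<close>
  have *: "M (0, (3 * n + 4) mod 8) (0, 0) = M (0, n) (0, 0)" "M (0, 7 * n mod 8) (0, 0) = M (0, n) (0, 0)"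
    if "n < 8" for n
  proof -
    have [simp]: "(j, n) \<in> Labels \<longleftrightarrow> j < 4 \<and> n < 8" for j n by (simp add: Labels_def)
    have "M (triple_label 0 (0, n)) (triple_label 4 (0, 0)) = M (0, n) (0, 0)"
      using that by (intro M) (auto simp: label_moves_def)
    \<comment> \<open>The double flip adds 4 to both exponents. It takes the target
      \<open>(0, 4)\<close>, the image of \<open>(0, 0)\<close> under \<open>triple_label 4\<close>,
      back to \<open>(0, 0)\<close> and turns the source exponent \<open>3 * n\<close> into
      \<open>3 * n + 4\<close>.\<close>
    moreover have "M (flip_label (flip_label (0, 3 * n mod 8))) (flip_label (flip_label (0, 4))) = M (flip_label (0, 3 * n mod 8)) (flip_label (0, 4))"
      by (intro M) (auto simp: label_moves_def)
    moreover have "M (flip_label (0, 3 * n mod 8)) (flip_label (0, 4)) = M (0, 3 * n mod 8) (0, 4)"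
      by (intro M) (auto simp: label_moves_def)
    ultimately show "M (0, (3 * n + 4) mod 8) (0, 0) = M (0, n) (0, 0)"
      by (simp add: mod_add_left_eq)
    have "M (cnj_label (0, n)) (cnj_label (0, 0)) = M (0, n) (0, 0)"
      using that by (intro M) (auto simp: label_moves_def)
    then show "M (0, 7 * n mod 8) (0, 0) = M (0, n) (0, 0)" by simp
  qed
  \<comment> \<open>The exponents pair off as 0 with 4, 1 with 7, 2 with 6 and 3 with 5.\<close>
  have "D = 2 * (M (0, 0) (0, 0) + M (0, 1) (0, 0) + M (0, 2) (0, 0) + M (0, 3) (0, 0))"
    using DU[of 0 0 0] *(1)[of 0] *(2)[of 1] *(2)[of 2] *(2)[of 3] by (simp add: sum_4_8)
  then show False using u by presburger
qed

section \<open>The two orbits of the Galois group\<close>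

definition th :: "nat \<Rightarrow> complex" where
  "th j = (if j = 0 then th0 else if j = 1 then th1 else if j = 2 then th2 else th3)"

definition pt :: "label \<Rightarrow> complex" where "pt x = zeta ^ snd x * th (fst x)"

lemma zeta_powers: "zeta ^ 4 = - 1" "zeta ^ 8 = 1" "zeta \<noteq> 0"
proof -
  show 4: "zeta ^ 4 = - 1" using zeta_sq power_mult[of zeta 2 2] by simp
  show "zeta ^ 8 = 1" using power_mult[of zeta 4 2] 4 by simp
  then show "zeta \<noteq> 0" by auto
qed

lemma zeta_mod: "zeta ^ (n mod 8) = zeta ^ n"
proof -
  have "zeta ^ n = zeta ^ (8 * (n div 8) + n mod 8)" by simp
  also have "\<dots> = zeta ^ (n mod 8)" by (simp only: power_add power_mult zeta_powers(2)) simp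
  finally show ?thesis by simp
qed

lemma zeta_order: assumes "zeta ^ n = 1" "n < 8" shows "n = 0"
proof -
  have i: "\<i> ^ n = 1" using assms(1) zeta_sq by (metis mult.commute power_mult power_one)
  have z1: "zeta \<noteq> 1" using zeta_sq by (metis complex_i_not_one power_one)
  have pw: "\<i> ^ 2 = - 1" "\<i> ^ 3 = - \<i>" "\<i> ^ 4 = 1" "\<i> ^ 5 = \<i>" "\<i> ^ 6 = - 1" "\<i> ^ 7 = - \<i>"
    by (simp_all add: eval_nat_numeral)
  have "- \<i> \<noteq> 1" by (simp add: complex_eq_iff)
  then show ?thesis using assms(2) i assms(1) zeta_powers(1) pw unfolding less_4_8 by auto
qed

lemma th_in_L: "th j \<in> L"
  by (simp add: th_def L_gens L_gens2)

lemma pt_in_L: "pt x \<in> L" "r2 * pt x \<in> L"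
  by (simp_all add: pt_def th_in_L zeta_in_L L_gens cfield_intros[OF cfield_L])

lemma th_nz: "th1 \<noteq> 0" "th2 \<noteq> 0" "th3 \<noteq> 0"
  by (auto simp: th1_def th2_def th3_def s_sums_nz ii_r3(4))

lemma th0_products:
  "th1 * th0 = rho * (\<i> * r3) * cbrt2 * (s2 + s3)"
  "th2 * th0 = rho * (\<i> * r3) * (ww * cbrt2) * (s1 + s3)"
  "th3 * th0 = rho * (\<i> * r3) * (ww\<^sup>2 * cbrt2) * (s1 + s2)"
  by (simp_all add: th1_def th2_def th3_def)

text \<open>The sides are compared after multiplication by \<open>th0 * th0\<close>: the left one
  becomes a product of two of the \<open>th0_products\<close>, in which \<open>delta_rel\<close>
  replaces two of the differences of squares by the square of the third.\<close>

lemma th_products: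
  "th1 * th2 = rho * (\<i> * r3) * (ww\<^sup>2 * cbrt2) * (s1 - s2)"
  "th2 * th3 = rho * (\<i> * r3) * cbrt2 * (s2 - s3)"
  "th3 * th1 = rho * (\<i> * r3) * (ww * cbrt2) * (s3 - s1)"
proof -
  have cancel: "x = y" if "x * (th0 * th0) = y * (th0 * th0)" for x y using that by simp
  have t: "th0 * th0 = (s1 + s2) * (s2 + s3) * (s3 + s1) * rho" using th0_sq by (simp add: gam_s power2_eq_square)
  note d = r3_delta[unfolded mult.assoc]
  show "th1 * th2 = rho * (\<i> * r3) * (ww\<^sup>2 * cbrt2) * (s1 - s2)"
  proof (rule cancel)
    have "th1 * th2 * (th0 * th0) = (th1 * th0) * (th2 * th0)" by simp
    also have "\<dots> = rho * rho * ((s2 - s3) * (s2 + s3) * ((s3 - s1) * (s1 + s3))) * ((s2 + s3) * (s1 + s3))"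
      unfolding th0_products mult.assoc d by (simp add: mult_ac)
    also have "\<dots> = rho * (\<i> * r3) * (ww\<^sup>2 * cbrt2) * (s1 - s2) * (th0 * th0)"
      unfolding delta_rel(3) unfolding t mult.assoc d by (simp add: power2_eq_square algebra_simps)
    finally show "th1 * th2 * (th0 * th0) = rho * (\<i> * r3) * (ww\<^sup>2 * cbrt2) * (s1 - s2) * (th0 * th0)" .
  qed
  show "th2 * th3 = rho * (\<i> * r3) * cbrt2 * (s2 - s3)"
  proof (rule cancel)
    have "th2 * th3 * (th0 * th0) = (th2 * th0) * (th3 * th0)" by simp
    also have "\<dots> = rho * rho * ((s1 - s2) * (s1 + s2) * ((s3 - s1) * (s1 + s3))) * ((s1 + s3) * (s1 + s2))"
      unfolding th0_products mult.assoc d by (simp add: mult_ac)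
    also have "\<dots> = rho * (\<i> * r3) * cbrt2 * (s2 - s3) * (th0 * th0)"
      unfolding delta_rel(1) unfolding t mult.assoc d by (simp add: power2_eq_square algebra_simps)
    finally show "th2 * th3 * (th0 * th0) = rho * (\<i> * r3) * cbrt2 * (s2 - s3) * (th0 * th0)" .
  qed
  show "th3 * th1 = rho * (\<i> * r3) * (ww * cbrt2) * (s3 - s1)"
  proof (rule cancel)
    have "th3 * th1 * (th0 * th0) = (th3 * th0) * (th1 * th0)" by simp
    also have "\<dots> = rho * rho * ((s1 - s2) * (s1 + s2) * ((s2 - s3) * (s2 + s3))) * ((s2 + s3) * (s1 + s2))"
      unfolding th0_products mult.assoc d by (simp add: mult_ac)
    also have "\<dots> = rho * (\<i> * r3) * (ww * cbrt2) * (s3 - s1) * (th0 * th0)"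
      unfolding delta_rel(2) unfolding t mult.assoc d by (simp add: power2_eq_square algebra_simps)
    finally show "th3 * th1 * (th0 * th0) = rho * (\<i> * r3) * (ww * cbrt2) * (s3 - s1) * (th0 * th0)" .
  qed
qed

text \<open>On exponents of \<open>zeta\<close> the automorphism is the affine map
  \<open>n \<mapsto> e * n + a\<close>. In the second action the constant grows by \<open>b\<close>;
  a sign change of \<open>r2\<close> is \<open>b = 4\<close>.\<close>

lemma Gal_pt:
  assumes \<sigma>: "\<sigma> \<in> Gal L" "\<sigma> zeta = zeta ^ e" "\<sigma> (th j) = zeta ^ a * th k" "\<sigma> r2 = zeta ^ b * r2"
  shows "\<sigma> (pt (j, n)) = pt (k, (e * n + a) mod 8)" "\<sigma> (r2 * pt (j, n)) = r2 * pt (k, (e * n + a + b) mod 8)"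
proof -
  note [simp] = chom_simps[OF cfield_L Gal_chom[OF cfield_L \<sigma>(1)]] cfield_intros[OF cfield_L] zeta_in_L th_in_L pt_in_L L_gens
  show 1: "\<sigma> (pt (j, n)) = pt (k, (e * n + a) mod 8)"
    by (simp add: pt_def \<sigma> zeta_mod power_add power_mult)
  have "\<sigma> (r2 * pt (j, n)) = \<sigma> r2 * \<sigma> (pt (j, n))" by simp
  then show "\<sigma> (r2 * pt (j, n)) = r2 * pt (k, (e * n + a + b) mod 8)"
    unfolding 1 by (simp add: pt_def \<sigma> zeta_mod power_add)
qed

definition lifts :: "(complex \<Rightarrow> complex) \<Rightarrow> (label \<Rightarrow> label) \<times> (label \<Rightarrow> label) \<Rightarrow> bool" where
  "lifts \<sigma> ff \<longleftrightarrow> (\<forall>x\<in>Labels. \<sigma> (pt x) = pt (fst ff x) \<and> \<sigma> (r2 * pt x) = r2 * pt (snd ff x))"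

lemma lifts_generators:
  assumes \<sigma>: "\<sigma> \<in> Gal L"
  shows "\<sigma> cbrt2 = ww * cbrt2 \<Longrightarrow> \<sigma> \<i> = \<i> \<Longrightarrow> \<sigma> r2 = r2 \<Longrightarrow> \<sigma> r3 = r3 \<Longrightarrow> \<sigma> rho = rho \<Longrightarrow> \<sigma> s1 = s2 \<Longrightarrow> \<sigma> s2 = s3 \<Longrightarrow>
      \<sigma> th0 = th0 \<Longrightarrow> lifts \<sigma> (rotate_label, rotate_label)"
    and "\<sigma> cbrt2 = cbrt2 \<Longrightarrow> \<sigma> \<i> = - \<i> \<Longrightarrow> \<sigma> r2 = - r2 \<Longrightarrow> \<sigma> r3 = - r3 \<Longrightarrow> \<sigma> rho = rho \<Longrightarrow> \<sigma> s1 = s1 \<Longrightarrow> \<sigma> s2 = s2 \<Longrightarrow>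
      \<sigma> th0 = th0 \<Longrightarrow> lifts \<sigma> (triple_label 0, triple_label 4)"
    and "\<sigma> cbrt2 = cbrt2 \<Longrightarrow> \<sigma> \<i> = - \<i> \<Longrightarrow> \<sigma> r2 = r2 \<Longrightarrow> \<sigma> r3 = r3 \<Longrightarrow> \<sigma> rho = rho \<Longrightarrow> \<sigma> s1 = s1 \<Longrightarrow> \<sigma> s2 = s3 \<Longrightarrow>
      \<sigma> th0 = th0 \<Longrightarrow> lifts \<sigma> (cnj_label, cnj_label)"
    and "\<sigma> cbrt2 = cbrt2 \<Longrightarrow> \<sigma> \<i> = \<i> \<Longrightarrow> \<sigma> r2 = r2 \<Longrightarrow> \<sigma> r3 = r3 \<Longrightarrow> \<sigma> rho = rho \<Longrightarrow> \<sigma> s1 = - s1 \<Longrightarrow> \<sigma> s2 = - s2 \<Longrightarrow>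
      \<sigma> th0 = th3 \<Longrightarrow> lifts \<sigma> (flip_label, flip_label)"
    and "\<sigma> cbrt2 = cbrt2 \<Longrightarrow> \<sigma> \<i> = \<i> \<Longrightarrow> \<sigma> r2 = - r2 \<Longrightarrow> \<sigma> r3 = r3 \<Longrightarrow> \<sigma> rho = \<i> * rho \<Longrightarrow> \<sigma> s1 = s1 \<Longrightarrow> \<sigma> s2 = s2 \<Longrightarrow>
      \<sigma> th0 = zeta * th0 \<Longrightarrow> lifts \<sigma> (shift_label 0, shift_label 4)"
proof -
  note hs = chom_simps[OF cfield_L Gal_chom[OF cfield_L \<sigma>]] cfield_intros[OF cfield_L] L_gens L_gens2 zeta_in_L
  have lift: "lifts \<sigma> (f, f')"
    if z: "\<sigma> zeta = zeta ^ e" and r: "\<sigma> r2 = zeta ^ b * r2"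
      and t: "\<And>j. j < 4 \<Longrightarrow> \<sigma> (th j) = zeta ^ a j * th (p j)"
      and f: "\<And>j n. j < 4 \<Longrightarrow> n < 8 \<Longrightarrow> f (j, n) = (p j, (e * n + a j) mod 8)"
      and f': "\<And>j n. j < 4 \<Longrightarrow> n < 8 \<Longrightarrow> f' (j, n) = (p j, (e * n + a j + b) mod 8)"
    for f f' e b a p
    unfolding lifts_def Labels_def using Gal_pt[OF \<sigma> z t r] by (auto simp: f f')
  have s3: "\<sigma> s3 = 1 / (\<sigma> s1 * \<sigma> s2)" by (simp add: s3_def hs)
  have w: "\<sigma> ww = om (\<sigma> \<i>) (\<sigma> r3)" by (simp add: ww_def om_def hs)
  have z: "\<sigma> zeta = (1 + \<sigma> \<i>) / \<sigma> r2" by (simp add: zeta_def hs)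
  have zs: "zeta = (1 + \<i>) / r2" "zeta ^ 3 = (1 - \<i>) / (- r2)" "zeta ^ 7 = (1 - \<i>) / r2" "zeta ^ 5 = (1 + \<i>) / (- r2)"
  proof -
    show z0: "zeta = (1 + \<i>) / r2" by (simp add: zeta_def)
    have e: "zeta ^ 3 = \<i> * zeta" "zeta ^ 7 = - (zeta ^ 3)" "zeta ^ 5 = - zeta"
      using zeta_sq zeta_powers(1) power_add[of zeta 2 1] power_add[of zeta 4 3] power_add[of zeta 4 1]
      by simp_all
    have "\<i> * (1 + \<i>) = - (1 - \<i>)" by (simp add: algebra_simps)
    then have iz: "\<i> * zeta = - (1 - \<i>) / r2" by (simp only: z0 times_divide_eq_right)
    show "zeta ^ 3 = (1 - \<i>) / (- r2)" unfolding e iz by (simp only: divide_minus_right minus_divide_left)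
    show "zeta ^ 7 = (1 - \<i>) / r2" unfolding e iz by (simp only: minus_divide_left[symmetric] minus_minus)
    show "zeta ^ 5 = (1 + \<i>) / (- r2)" unfolding e(3) by (simp only: z0 divide_minus_right)
  qed
  have ths: "\<sigma> th1 = \<sigma> rho * (\<sigma> \<i> * \<sigma> r3) * \<sigma> cbrt2 * (\<sigma> s2 + \<sigma> s3) / \<sigma> th0"
      "\<sigma> th2 = \<sigma> rho * (\<sigma> \<i> * \<sigma> r3) * (\<sigma> ww * \<sigma> cbrt2) * (\<sigma> s1 + \<sigma> s3) / \<sigma> th0"
      "\<sigma> th3 = \<sigma> rho * (\<sigma> \<i> * \<sigma> r3) * ((\<sigma> ww)\<^sup>2 * \<sigma> cbrt2) * (\<sigma> s1 + \<sigma> s2) / \<sigma> th0"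
    by (simp_all add: th1_def th2_def th3_def hs)
  have w3: "ww * ww\<^sup>2 = 1" "ww\<^sup>2 * ww = 1" "(ww\<^sup>2)\<^sup>2 = ww"
    using ii_r3(2) by (simp_all add: mult.commute power2_eq_square mult.assoc)
  { assume v: "\<sigma> cbrt2 = ww * cbrt2" "\<sigma> \<i> = \<i>" "\<sigma> r2 = r2" "\<sigma> r3 = r3" "\<sigma> rho = rho" "\<sigma> s1 = s2" "\<sigma> s2 = s3" "\<sigma> th0 = th0"
    have ww': "\<sigma> ww = ww" and s3': "\<sigma> s3 = s1" by (simp_all add: w v om_ww s3 s_inverse)
    have c: "ww\<^sup>2 * (ww * cbrt2) = cbrt2" "ww * (ww * cbrt2) = ww\<^sup>2 * cbrt2"
      using w3(2) by (simp_all add: power2_eq_square flip: mult.assoc)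
    have "\<sigma> th1 = th2" "\<sigma> th2 = th3" "\<sigma> th3 = th1"
      unfolding ths v ww' s3' c by (simp_all add: th1_def th2_def th3_def add.commute)
    then show "lifts \<sigma> (rotate_label, rotate_label)"
      by (intro lift[of 1 0 "\<lambda>j. 0" "\<lambda>j. if j = 0 then 0 else if j = 3 then 1 else j + 1"])
        (auto simp: z v th_def less_4_8(1) simp flip: zs(1)) }
  { assume v: "\<sigma> cbrt2 = cbrt2" "\<sigma> \<i> = - \<i>" "\<sigma> r2 = - r2" "\<sigma> r3 = - r3" "\<sigma> rho = rho" "\<sigma> s1 = s1" "\<sigma> s2 = s2" "\<sigma> th0 = th0"
    have ww': "\<sigma> ww = ww" and s3': "\<sigma> s3 = s3" by (simp_all add: w v om_ww s3 s_inverse)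
    have "\<sigma> th1 = th1" "\<sigma> th2 = th2" "\<sigma> th3 = th3"
      unfolding ths v ww' s3' by (simp_all add: th1_def th2_def th3_def)
    then show "lifts \<sigma> (triple_label 0, triple_label 4)"
      by (intro lift[of 3 4 "\<lambda>j. 0" "\<lambda>j. j"])
        (auto simp: z v th_def less_4_8(1) zs(2) zeta_powers(1)) }
  { assume v: "\<sigma> cbrt2 = cbrt2" "\<sigma> \<i> = - \<i>" "\<sigma> r2 = r2" "\<sigma> r3 = r3" "\<sigma> rho = rho" "\<sigma> s1 = s1" "\<sigma> s2 = s3" "\<sigma> th0 = th0"
    have ww': "\<sigma> ww = ww\<^sup>2" and s3': "\<sigma> s3 = s2" by (simp_all add: w v om_ww s3 s_inverse)
    have "\<sigma> th1 = - th1" "\<sigma> th2 = - th3" "\<sigma> th3 = - th2"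
      unfolding ths v ww' s3' w3(3) by (simp_all add: th1_def th2_def th3_def add.commute)
    then show "lifts \<sigma> (cnj_label, cnj_label)"
      by (intro lift[of 7 0 "\<lambda>j. if j = 0 then 0 else 4" "\<lambda>j. if j = 0 then 0 else if j = 1 then 1 else 5 - j"])
        (auto simp: z v th_def less_4_8(1) zs(3) zeta_powers(1)) }
  { assume v: "\<sigma> cbrt2 = cbrt2" "\<sigma> \<i> = \<i>" "\<sigma> r2 = r2" "\<sigma> r3 = r3" "\<sigma> rho = rho" "\<sigma> s1 = - s1" "\<sigma> s2 = - s2" "\<sigma> th0 = th3"
    have ww': "\<sigma> ww = ww" and s3': "\<sigma> s3 = s3" by (simp_all add: w v om_ww s3 s_inverse)
    \<comment> \<open>The denominator \<open>th0\<close> is sent to \<open>th3\<close>;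
      multiplication by \<open>th3\<close> clears it, and the products of the square roots identify
      the result.\<close>
    have "\<sigma> th1 * th3 = - th2 * th3" "\<sigma> th2 * th3 = th1 * th3" "\<sigma> th3 * th3 = - th0 * th3"
      unfolding ths v ww' s3' using th_products(2,3) th0_products(3) th_nz
      by (simp_all add: mult_ac) (simp_all add: algebra_simps)
    then have "\<sigma> th1 = - th2" "\<sigma> th2 = th1" "\<sigma> th3 = - th0"
      by (simp_all only: mult_right_cancel[OF th_nz(3)])
    then show "lifts \<sigma> (flip_label, flip_label)"
      by (intro lift[of 1 0 "\<lambda>j. if j = 0 \<or> j = 2 then 0 else 4" "\<lambda>j. 3 - j"])
        (auto simp: z v th_def less_4_8(1) zeta_powers(1) simp flip: zs(1)) }
  { assume v: "\<sigma> cbrt2 = cbrt2" "\<sigma> \<i> = \<i>" "\<sigma> r2 = - r2" "\<sigma> r3 = r3" "\<sigma> rho = \<i> * rho" "\<sigma> s1 = s1" "\<sigma> s2 = s2" "\<sigma> th0 = zeta * th0"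
    have ww': "\<sigma> ww = ww" and s3': "\<sigma> s3 = s3" by (simp_all add: w v om_ww s3 s_inverse)
    \<comment> \<open>The factor \<open>\<i> = zeta\<^sup>2\<close> from the image of
      \<open>rho\<close> meets the factor \<open>zeta\<close> from the image of the denominator
      \<open>th0\<close>.\<close>
    have "\<i> * x / (zeta * y) = zeta * (x / y)" for x y
      using zeta_powers(3) by (simp add: field_simps flip: zeta_sq) (simp add: power2_eq_square)
    then have "\<sigma> th1 = zeta * th1" "\<sigma> th2 = zeta * th2" "\<sigma> th3 = zeta * th3"
      unfolding ths v ww' s3' by (simp_all add: th1_def th2_def th3_def mult.assoc)
    then show "lifts \<sigma> (shift_label 0, shift_label 4)"
      by (intro lift[of 5 4 "\<lambda>j. 1" "\<lambda>j. j"])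
        (auto simp: z v th_def less_4_8(1) zs(4) zeta_powers(1)) }
qed

lemma Gal_eqI:
  assumes "\<sigma> \<in> Gal L" "\<tau> \<in> Gal L" "\<And>x. x \<in> L \<Longrightarrow> \<sigma> x = \<tau> x"
  shows "\<sigma> = \<tau>"
  using assms by (intro extensionalityI[of \<sigma> L \<tau>]) (auto simp: Gal_mem[OF cfield_L])

lemma move_lifts:
  "\<exists>\<sigma>\<in>Gal L. lifts \<sigma> (rotate_label, rotate_label) \<and> \<sigma> cbrt2 = ww * cbrt2 \<and> \<sigma> \<i> = \<i> \<and> \<sigma> r2 = r2 \<and> \<sigma> r3 = r3 \<and>
    \<sigma> rho = rho \<and> \<sigma> s1 = s2 \<and> \<sigma> s2 = s3 \<and> \<sigma> th0 = th0"
  "\<exists>\<sigma>\<in>Gal L. lifts \<sigma> (triple_label 0, triple_label 4) \<and> \<sigma> cbrt2 = cbrt2 \<and> \<sigma> \<i> = - \<i> \<and> \<sigma> r2 = - r2 \<and> \<sigma> r3 = - r3 \<and>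
    \<sigma> rho = rho \<and> \<sigma> s1 = s1 \<and> \<sigma> s2 = s2 \<and> \<sigma> th0 = th0"
  "\<exists>\<sigma>\<in>Gal L. lifts \<sigma> (cnj_label, cnj_label) \<and> \<sigma> cbrt2 = cbrt2 \<and> \<sigma> \<i> = - \<i> \<and> \<sigma> r2 = r2 \<and> \<sigma> r3 = r3 \<and>
    \<sigma> rho = rho \<and> \<sigma> s1 = s1 \<and> \<sigma> s2 = s3 \<and> \<sigma> th0 = th0"
  "\<exists>\<sigma>\<in>Gal L. lifts \<sigma> (flip_label, flip_label) \<and> \<sigma> cbrt2 = cbrt2 \<and> \<sigma> \<i> = \<i> \<and> \<sigma> r2 = r2 \<and> \<sigma> r3 = r3 \<and>
    \<sigma> rho = rho \<and> \<sigma> s1 = - s1 \<and> \<sigma> s2 = - s2 \<and> \<sigma> th0 = th3"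
  "\<exists>\<sigma>\<in>Gal L. lifts \<sigma> (shift_label 0, shift_label 4) \<and> \<sigma> cbrt2 = cbrt2 \<and> \<sigma> \<i> = \<i> \<and> \<sigma> r2 = - r2 \<and> \<sigma> r3 = r3 \<and>
    \<sigma> rho = \<i> * rho \<and> \<sigma> s1 = s1 \<and> \<sigma> s2 = s2 \<and> \<sigma> th0 = zeta * th0"
proof -
  note [simp] = L_gens L_gens2 zeta_in_L cfield_intros[OF cfield_L]
  show "\<exists>\<sigma>\<in>Gal L. lifts \<sigma> (rotate_label, rotate_label) \<and> \<sigma> cbrt2 = ww * cbrt2 \<and> \<sigma> \<i> = \<i> \<and> \<sigma> r2 = r2 \<and> \<sigma> r3 = r3 \<and>
    \<sigma> rho = rho \<and> \<sigma> s1 = s2 \<and> \<sigma> s2 = s3 \<and> \<sigma> th0 = th0"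
    using Gal_exists[OF compatible_generators(1)] lifts_generators(1) by fastforce
  show "\<exists>\<sigma>\<in>Gal L. lifts \<sigma> (triple_label 0, triple_label 4) \<and> \<sigma> cbrt2 = cbrt2 \<and> \<sigma> \<i> = - \<i> \<and> \<sigma> r2 = - r2 \<and> \<sigma> r3 = - r3 \<and>
    \<sigma> rho = rho \<and> \<sigma> s1 = s1 \<and> \<sigma> s2 = s2 \<and> \<sigma> th0 = th0"
    using Gal_exists[OF compatible_generators(2)] lifts_generators(2) by fastforce
  show "\<exists>\<sigma>\<in>Gal L. lifts \<sigma> (cnj_label, cnj_label) \<and> \<sigma> cbrt2 = cbrt2 \<and> \<sigma> \<i> = - \<i> \<and> \<sigma> r2 = r2 \<and> \<sigma> r3 = r3 \<and>
    \<sigma> rho = rho \<and> \<sigma> s1 = s1 \<and> \<sigma> s2 = s3 \<and> \<sigma> th0 = th0"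
    using Gal_exists[OF compatible_generators(3)] lifts_generators(3) by fastforce
  show "\<exists>\<sigma>\<in>Gal L. lifts \<sigma> (flip_label, flip_label) \<and> \<sigma> cbrt2 = cbrt2 \<and> \<sigma> \<i> = \<i> \<and> \<sigma> r2 = r2 \<and> \<sigma> r3 = r3 \<and>
    \<sigma> rho = rho \<and> \<sigma> s1 = - s1 \<and> \<sigma> s2 = - s2 \<and> \<sigma> th0 = th3"
    using Gal_exists[OF compatible_generators(4)] lifts_generators(4) by fastforce
  show "\<exists>\<sigma>\<in>Gal L. lifts \<sigma> (shift_label 0, shift_label 4) \<and> \<sigma> cbrt2 = cbrt2 \<and> \<sigma> \<i> = \<i> \<and> \<sigma> r2 = - r2 \<and> \<sigma> r3 = r3 \<and>
    \<sigma> rho = \<i> * rho \<and> \<sigma> s1 = s1 \<and> \<sigma> s2 = s2 \<and> \<sigma> th0 = zeta * th0"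
    using Gal_exists[OF compatible_generators(5)] lifts_generators(5) by fastforce
qed

lemma lifts_exists:
  assumes "ff \<in> set label_moves" shows "\<exists>\<sigma>\<in>Gal L. lifts \<sigma> ff"
  using assms move_lifts unfolding label_moves_def by (simp; blast)

text \<open>Each generator has only a few possible images. Left multiplication by elements of
  \<open>Q\<close> makes \<open>\<i>\<close>, then \<open>rho\<close>, then \<open>r2\<close> and
  \<open>r3\<close>, then \<open>cbrt2\<close>, then \<open>s1\<close> and \<open>s2\<close>, and
  finally \<open>th0\<close> fixed. Stating this for an arbitrary subgroup \<open>Q\<close> lets any
  property closed under products and inverses pass from the five moves to the whole group.\<close>

lemma Gal_generated:
  assumes Q: "subgroup Q (galois_group L \<rat>)"
    and gens: "\<And>\<sigma> ff. \<sigma> \<in> Gal L \<Longrightarrow> ff \<in> set label_moves \<Longrightarrow> lifts \<sigma> ff \<Longrightarrow> \<sigma> \<in> Q"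
  shows "Gal L \<subseteq> Q"
proof -
  interpret G: group "galois_group L \<rat>" by (rule galois_group_group[OF cfield_L])
  interpret Q: subgroup Q "galois_group L \<rat>" by (rule Q)
  let ?m = "\<lambda>\<sigma> \<tau>. \<sigma> \<otimes>\<^bsub>galois_group L \<rat>\<^esub> \<tau>"
  obtain gr where gr: "gr \<in> Gal L" "lifts gr (rotate_label, rotate_label)" "gr cbrt2 = ww * cbrt2" "gr \<i> = \<i>" "gr r2 = r2"
      "gr r3 = r3" "gr rho = rho" "gr s1 = s2" "gr s2 = s3" "gr th0 = th0"
    using move_lifts(1) by blast
  obtain gz where gz: "gz \<in> Gal L" "lifts gz (triple_label 0, triple_label 4)" "gz cbrt2 = cbrt2" "gz \<i> = - \<i>" "gz r2 = - r2"
      "gz r3 = - r3" "gz rho = rho" "gz s1 = s1" "gz s2 = s2" "gz th0 = th0"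
    using move_lifts(2) by blast
  obtain gq where gq: "gq \<in> Gal L" "lifts gq (cnj_label, cnj_label)" "gq cbrt2 = cbrt2" "gq \<i> = - \<i>" "gq r2 = r2"
      "gq r3 = r3" "gq rho = rho" "gq s1 = s1" "gq s2 = s3" "gq th0 = th0"
    using move_lifts(3) by blast
  obtain gf where gf: "gf \<in> Gal L" "lifts gf (flip_label, flip_label)" "gf cbrt2 = cbrt2" "gf \<i> = \<i>" "gf r2 = r2"
      "gf r3 = r3" "gf rho = rho" "gf s1 = - s1" "gf s2 = - s2" "gf th0 = th3"
    using move_lifts(4) by blast
  obtain gt where gt: "gt \<in> Gal L" "lifts gt (shift_label 0, shift_label 4)" "gt cbrt2 = cbrt2" "gt \<i> = \<i>" "gt r2 = - r2"
      "gt r3 = r3" "gt rho = \<i> * rho" "gt s1 = s1" "gt s2 = s2" "gt th0 = zeta * th0"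
    using move_lifts(5) by blast
  have inQ: "gr \<in> Q" "gz \<in> Q" "gq \<in> Q" "gf \<in> Q" "gt \<in> Q"
    using gens gr(1,2) gz(1,2) gq(1,2) gf(1,2) gt(1,2) by (auto simp: label_moves_def)
  note ap = Gal_apply_mult[OF cfield_L] and cl = G.m_closed
  note in_L = L_gens L_gens2 zeta_in_L
  have hs: "chom L \<sigma>" if "\<sigma> \<in> Gal L" for \<sigma> using Gal_chom[OF cfield_L that] .
  have peel: "\<sigma> \<in> Q" if "g \<in> Q" "\<sigma> \<in> Gal L" "?m g \<sigma> \<in> Q" for g \<sigma>
  proof -
    have "\<sigma> = ?m (inv\<^bsub>galois_group L \<rat>\<^esub> g) (?m g \<sigma>)"
      using that by (simp add: G.m_assoc[symmetric] Q.mem_carrier)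
    then show ?thesis using that by (metis Q.m_closed Q.m_inv_closed)
  qed
  note cs = chom_simps[OF cfield_L hs]
  note ms = cfield_intros[OF cfield_L] in_L
  have gfth3: "gf th3 = - th0"
    using bspec[OF gf(2)[unfolded lifts_def], of "(3, 0)"] by (simp add: Labels_def pt_def th_def zeta_powers)
  have "gr s3 = 1 / (gr s1 * gr s2)" by (simp add: s3_def cs[OF gr(1)] ms)
  then have grs3: "gr s3 = s1" by (simp only: gr s_inverse)
  have gfs3: "gf s3 = s3" by (simp add: s3_def cs[OF gf(1)] ms gf)
  have grw: "gr ww = ww" by (simp add: ww_def om_def cs[OF gr(1)] ms gr)
  have gfw: "gf ww = ww" by (simp add: ww_def om_def cs[OF gf(1)] ms gf)
  have pm: "\<sigma> x = x \<or> \<sigma> x = - x" if "\<sigma> \<in> Gal L" "x \<in> L" "\<sigma> (x\<^sup>2) = x\<^sup>2" for \<sigma> x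
    using that by (simp add: cs power2_eq_iff)
  have 8: "\<sigma> \<in> Q" if "\<sigma> \<in> Gal L" "\<sigma> cbrt2 = cbrt2" "\<sigma> \<i> = \<i>" "\<sigma> r2 = r2" "\<sigma> r3 = r3" "\<sigma> rho = rho" "\<sigma> s1 = s1" "\<sigma> s2 = s2"
      "\<sigma> th0 = th0" for \<sigma>
  proof -
    have "\<sigma> = \<one>\<^bsub>galois_group L \<rat>\<^esub>"
      using that chom_fix_tower(8)[OF hs[OF that(1)]]
      by (intro Gal_eqI) (auto simp: Gal_apply_one[OF cfield_L])
    then show ?thesis using Q.one_closed by simp
  qed
  have 7: "\<sigma> \<in> Q" if \<sigma>: "\<sigma> \<in> Gal L" "\<sigma> cbrt2 = cbrt2" "\<sigma> \<i> = \<i>" "\<sigma> r2 = r2" "\<sigma> r3 = r3" "\<sigma> rho = rho" "\<sigma> s1 = s1" "\<sigma> s2 = s2" for \<sigma>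
  proof -
    have "\<sigma> (th0\<^sup>2) = th0\<^sup>2" unfolding th0_sq by (simp add: gam_def cs[OF \<sigma>(1)] ms \<sigma>)
    then consider "\<sigma> th0 = th0" | "\<sigma> th0 = - th0" using pm[OF \<sigma>(1)] ms by blast
    then show ?thesis
    proof cases
      case 2
      \<comment> \<open>The square of \<open>gf\<close> negates \<open>th0\<close> and fixes the
        other seven generators.\<close>
      have "?m gf (?m gf \<sigma>) \<in> Q"
        by (rule 8) (simp_all add: cl ap ms \<sigma> gf 2 gfth3 cs[OF gf(1)])
      then show ?thesis using peel inQ \<sigma>(1) cl gf(1) by metis
    qed (use 8 \<sigma> in auto)
  qed
  have 6: "\<sigma> \<in> Q" if \<sigma>: "\<sigma> \<in> Gal L" "\<sigma> cbrt2 = cbrt2" "\<sigma> \<i> = \<i>" "\<sigma> r2 = r2" "\<sigma> r3 = r3" "\<sigma> rho = rho" for \<sigma>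
  proof -
    have "\<sigma> (s1\<^sup>2) = s1\<^sup>2" "\<sigma> (s2\<^sup>2) = s2\<^sup>2"
      unfolding squares om_def by (simp_all add: cs[OF \<sigma>(1)] ms \<sigma>)
    then have s12: "\<sigma> s1 = s1 \<or> \<sigma> s1 = - s1" "\<sigma> s2 = s2 \<or> \<sigma> s2 = - s2" using pm[OF \<sigma>(1)] ms by blast+
    \<comment> \<open>A conjugate of \<open>gf\<close>, as \<open>gr\<close> has order 3: it changes
      the signs of \<open>s2\<close> and \<open>s3\<close> instead of those of \<open>s1\<close> and
      \<open>s2\<close>.\<close>
    define h where "h = ?m gr (?m gf (?m gr gr))"
    have w3: "ww * (ww * (ww * cbrt2)) = cbrt2" using ii_r3(2) by (simp add: power2_eq_square flip: mult.assoc)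
    have h: "h \<in> Gal L" "h \<in> Q" "h cbrt2 = cbrt2" "h \<i> = \<i>" "h r2 = r2" "h r3 = r3" "h rho = rho" "h s1 = s1" "h s2 = - s2"
      using inQ unfolding h_def
      by (simp_all add: cl ap ms gr gf grs3 gfs3 grw gfw w3 cs[OF gr(1)] cs[OF gf(1)] Q.m_closed)
    consider "\<sigma> s1 = s1" "\<sigma> s2 = s2" | "\<sigma> s1 = - s1" "\<sigma> s2 = - s2" | "\<sigma> s1 = s1" "\<sigma> s2 = - s2" | "\<sigma> s1 = - s1" "\<sigma> s2 = s2"
      using s12 by blast
    then show ?thesis
    proof cases
      case 1
      then show ?thesis using 7 \<sigma> by blast
    next
      case 2
      have "?m gf \<sigma> \<in> Q"
        by (rule 7) (simp_all add: cl ap ms \<sigma> gf 2 cs[OF gf(1)])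
      then show ?thesis using peel inQ \<sigma>(1) by blast
    next
      case 3
      have "?m h \<sigma> \<in> Q"
        by (rule 7) (simp_all add: cl ap ms \<sigma> h 3 cs[OF h(1)])
      then show ?thesis using peel h(2) \<sigma>(1) by blast
    next
      case 4
      have "?m gf (?m h \<sigma>) \<in> Q"
        by (rule 7) (simp_all add: cl ap ms \<sigma> h gf 4 cs[OF h(1)] cs[OF gf(1)])
      then show ?thesis using peel h(1,2) inQ \<sigma>(1) cl by metis
    qed
  qed
  have 5: "\<sigma> \<in> Q" if \<sigma>: "\<sigma> \<in> Gal L" "\<sigma> \<i> = \<i>" "\<sigma> r2 = r2" "\<sigma> r3 = r3" "\<sigma> rho = rho" for \<sigma>
  proof -
    have c3: "(\<sigma> cbrt2) ^ 3 = 2"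
      using arg_cong[OF cbrt2_cubed, of \<sigma>] by (simp add: cs[OF \<sigma>(1)] ms)
    have w: "ww\<^sup>2 = - 1 - ww" "ww * ww = - 1 - ww" using ww by (auto simp: power2_eq_square)
    have "(\<sigma> cbrt2 - cbrt2) * (\<sigma> cbrt2 - ww * cbrt2) * (\<sigma> cbrt2 - ww\<^sup>2 * cbrt2) =
        (\<sigma> cbrt2) ^ 3 - (1 + ww + ww\<^sup>2) * (\<sigma> cbrt2)\<^sup>2 * cbrt2 + (1 + ww + ww\<^sup>2) * ww * \<sigma> cbrt2 * cbrt2\<^sup>2 - ww ^ 3 * cbrt2 ^ 3"
      by (simp add: algebra_simps power2_eq_square power3_eq_cube)
    then have "(\<sigma> cbrt2 - cbrt2) * (\<sigma> cbrt2 - ww * cbrt2) * (\<sigma> cbrt2 - ww\<^sup>2 * cbrt2) = 0"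
      by (simp add: c3 ww cbrt2_cubed)
    then consider "\<sigma> cbrt2 = cbrt2" | "\<sigma> cbrt2 = ww * cbrt2" | "\<sigma> cbrt2 = ww\<^sup>2 * cbrt2" by auto
    then show ?thesis
    proof cases
      case 1
      then show ?thesis using 6 \<sigma> by blast
    next
      case 2
      have w3: "ww * (ww * (ww * cbrt2)) = cbrt2" using ii_r3(2) by (simp add: power2_eq_square flip: mult.assoc)
      have "?m gr (?m gr \<sigma>) \<in> Q"
        by (rule 6) (simp_all add: cl ap ms \<sigma> gr 2 grw w3 cs[OF gr(1)])
      then show ?thesis using peel inQ \<sigma>(1) cl gr(1) by metis
    next
      case 3
      have w3: "ww\<^sup>2 * (ww * cbrt2) = cbrt2" using ii_r3(2) by (simp add: mult.commute mult.left_commute flip: mult.assoc)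
      have "?m gr \<sigma> \<in> Q"
        by (rule 6) (simp_all add: cl ap ms \<sigma> gr 3 grw w3 cs[OF gr(1)])
      then show ?thesis using peel inQ \<sigma>(1) by blast
    qed
  qed
  have 4: "\<sigma> \<in> Q" if \<sigma>: "\<sigma> \<in> Gal L" "\<sigma> \<i> = \<i>" "\<sigma> rho = rho" for \<sigma>
  proof -
    have "\<sigma> (r2\<^sup>2) = r2\<^sup>2" unfolding squares by (simp add: cs[OF \<sigma>(1)])
    then have r2: "\<sigma> r2 = r2 \<or> \<sigma> r2 = - r2" using pm[OF \<sigma>(1)] ms by blast
    have "\<sigma> (rho\<^sup>2) = rho\<^sup>2" by (simp add: cs[OF \<sigma>(1)] ms \<sigma>)
    then have "\<sigma> r2 * \<sigma> r3 = r2 * r3" unfolding squares by (simp add: cs[OF \<sigma>(1)] ms)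
    then have "\<sigma> r2 = - r2 \<Longrightarrow> r2 * \<sigma> r3 = r2 * (- r3)" by (simp add: minus_equation_iff)
    then consider "\<sigma> r2 = r2" "\<sigma> r3 = r3" | "\<sigma> r2 = - r2" "\<sigma> r3 = - r3"
      using r2 \<open>\<sigma> r2 * \<sigma> r3 = r2 * r3\<close> by (metis mult_left_cancel r2_nz)
    then show ?thesis
    proof cases
      case 2
      \<comment> \<open>Both \<open>gz\<close> and \<open>gq\<close> negate \<open>\<i>\<close>, but
        only \<open>gz\<close> negates \<open>r2\<close> and \<open>r3\<close>; both fix
        \<open>rho\<close>.\<close>
      have "?m gz (?m gq \<sigma>) \<in> Q"
        by (rule 5) (simp_all add: cl ap ms \<sigma> gz gq 2 cs[OF gz(1)] cs[OF gq(1)])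
      then show ?thesis using peel inQ \<sigma>(1) cl gq(1) by metis
    qed (use 5 \<sigma> in auto)
  qed
  have 3: "\<sigma> \<in> Q" if \<sigma>: "\<sigma> \<in> Gal L" "\<sigma> \<i> = \<i>" for \<sigma>
  proof -
    \<comment> \<open>The image of \<open>rho\<close> is a fourth root of 6, hence
      \<open>rho\<close> times a power of \<open>\<i>\<close>; the powers of \<open>gt\<close>,
      which multiplies \<open>rho\<close> by \<open>\<i>\<close>, undo all of these.\<close>
    have r4: "rho ^ 4 = 6" using power_mult[of rho 2 2] by (simp add: squares power_mult_distrib)
    have "(\<sigma> rho) ^ 4 = 6" using arg_cong[OF r4, of \<sigma>] by (simp add: cs[OF \<sigma>(1)] ms)
    then have "((\<sigma> rho)\<^sup>2)\<^sup>2 = (rho\<^sup>2)\<^sup>2" using r4 by (simp flip: power_mult)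
    then have "(\<sigma> rho)\<^sup>2 = rho\<^sup>2 \<or> (\<sigma> rho)\<^sup>2 = - rho\<^sup>2" by (simp only: power2_eq_iff)
    then have "(\<sigma> rho)\<^sup>2 = rho\<^sup>2 \<or> (\<sigma> rho)\<^sup>2 = (\<i> * rho)\<^sup>2" by (simp add: power_mult_distrib)
    then consider "\<sigma> rho = rho" | "\<sigma> rho = - rho" | "\<sigma> rho = \<i> * rho" | "\<sigma> rho = - (\<i> * rho)" by (auto simp: power2_eq_iff)
    then show ?thesis
    proof cases
      case 1
      then show ?thesis using 4 \<sigma> by blast
    next
      case 2
      have "?m gt (?m gt \<sigma>) \<in> Q"
        by (rule 4) (simp_all add: cl ap ms \<sigma> gt 2 cs[OF gt(1)])
      then show ?thesis using peel inQ \<sigma>(1) cl gt(1) by metis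
    next
      case 3
      have "?m gt (?m gt (?m gt \<sigma>)) \<in> Q"
        by (rule 4) (simp_all add: cl ap ms \<sigma> gt 3 cs[OF gt(1)])
      then show ?thesis using peel inQ \<sigma>(1) cl gt(1) by metis
    next
      case 4
      have "?m gt \<sigma> \<in> Q"
        by (rule \<open>\<And>\<sigma>. \<sigma> \<in> Gal L \<Longrightarrow> \<sigma> \<i> = \<i> \<Longrightarrow> \<sigma> rho = rho \<Longrightarrow> \<sigma> \<in> Q\<close>) (simp_all add: cl ap ms \<sigma> gt 4 cs[OF gt(1)])
      then show ?thesis using peel inQ \<sigma>(1) by blast
    qed
  qed
  show ?thesis
  proof
    fix \<sigma> assume \<sigma>: "\<sigma> \<in> Gal L"
    have "\<sigma> (\<i>\<^sup>2) = \<i>\<^sup>2" by (simp add: cs[OF \<sigma>] ms)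
    then consider "\<sigma> \<i> = \<i>" | "\<sigma> \<i> = - \<i>" using pm[OF \<sigma>] ms by blast
    then show "\<sigma> \<in> Q"
    proof cases
      case 2
      have "?m gq \<sigma> \<in> Q"
        by (rule 3) (simp_all add: cl ap ms \<sigma> gq 2 cs[OF gq(1)])
      then show ?thesis using peel inQ \<sigma> by blast
    qed (use 3 \<sigma> in auto)
  qed
qed

lemma lifts_pt_eq:
  assumes "\<sigma> \<in> Gal L" "lifts \<sigma> (f, f')" "x \<in> Labels" "y \<in> Labels" "pt x = pt y"
  shows "pt (f x) = pt (f y)"
proof -
  have "pt (f z) = \<sigma> (pt z)" if "z \<in> Labels" for z using assms(2) that by (simp add: lifts_def)
  then show ?thesis using assms by simp
qed

text \<open>After multiplication by \<open>th0\<close> and cancellation, an equality would express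
  \<open>(s2 + s3) * (s3 + s1)\<close> through elements fixed by \<open>gf\<close>, whereas
  \<open>gf\<close> changes this product by the nonzero amount
  \<open>2 * s3 * (s1 + s2)\<close>.\<close>

lemma pt_0_3: "n < 8 \<Longrightarrow> m < 8 \<Longrightarrow> pt (0, n) \<noteq> pt (3, m)"
proof
  assume nm: "n < 8" "m < 8" and eq: "pt (0, n) = pt (3, m)"
  obtain gf where gf: "gf \<in> Gal L" "gf cbrt2 = cbrt2" "gf \<i> = \<i>" "gf r2 = r2"
      "gf r3 = r3" "gf rho = rho" "gf s1 = - s1" "gf s2 = - s2"
    using move_lifts(4) by blast
  note hs = chom_simps[OF cfield_L Gal_chom[OF cfield_L gf(1)]] cfield_intros[OF cfield_L] L_gens L_gens2 zeta_in_L
  have "zeta ^ n * (th0 * th0) = zeta ^ m * (th3 * th0)" using eq by (simp add: pt_def th_def)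
  then have "zeta ^ n * ((s1 + s2) * (s2 + s3) * (s3 + s1) * rho) = zeta ^ m * (rho * (\<i> * r3) * (ww\<^sup>2 * cbrt2) * (s1 + s2))"
    unfolding th0_products using th0_sq by (simp add: gam_s power2_eq_square)
  then have "(rho * (s1 + s2)) * (zeta ^ n * ((s2 + s3) * (s3 + s1))) = (rho * (s1 + s2)) * (zeta ^ m * (\<i> * r3 * (ww\<^sup>2 * cbrt2)))"
    by (simp only: mult_ac)
  then have e: "zeta ^ n * ((s2 + s3) * (s3 + s1)) = zeta ^ m * (\<i> * r3 * (ww\<^sup>2 * cbrt2))"
    using s_sums_nz by (simp only: mult_cancel_left mult_eq_0_iff) simp
  have gs3: "gf s3 = s3" by (simp add: s3_def hs gf)
  have gw: "gf ww = ww" by (simp add: ww_def om_def hs gf)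
  have gz: "gf zeta = zeta" by (simp add: zeta_def hs gf)
  have "zeta ^ n * ((- s2 + s3) * (s3 + - s1)) = zeta ^ m * (\<i> * r3 * (ww\<^sup>2 * cbrt2))"
    using arg_cong[OF e, of gf] by (simp add: hs gf gs3 gw gz)
  then have "zeta ^ n * ((s2 + s3) * (s3 + s1)) = zeta ^ n * ((- s2 + s3) * (s3 + - s1))" using e by simp
  then have "(s2 + s3) * (s3 + s1) = (- s2 + s3) * (s3 + - s1)" using zeta_powers(3) by simp
  then have "2 * s3 * (s1 + s2) = 0" by (simp add: algebra_simps)
  then show False using s_sums_nz s_prod by simp
qed

text \<open>Sharing a point is a symmetric relation between fibres that rotation and flip respect,
  and these moves reduce every pair of different fibres to 0 and 3.\<close>

lemma pt_distinct_fibres: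
  assumes "j < 4" "k < 4" "n < 8" "m < 8" "pt (j, n) = pt (k, m)"
  shows "j = k"
proof -
  define same where "same j k \<longleftrightarrow> (\<exists>n<8. \<exists>m<8. pt (j, n) = pt (k, m))" for j k
  obtain gr gf where g: "gr \<in> Gal L" "lifts gr (rotate_label, rotate_label)" "gf \<in> Gal L" "lifts gf (flip_label, flip_label)"
    using move_lifts(1,4) by blast
  have sym: "same j k \<Longrightarrow> same k j" for j k unfolding same_def by metis
  have rot: "same (fst (rotate_label (j, 0))) (fst (rotate_label (k, 0)))" if "same j k" "j < 4" "k < 4" for j k
  proof -
    obtain n m where nm: "n < 8" "m < 8" "pt (j, n) = pt (k, m)" using \<open>same j k\<close> by (auto simp: same_def)
    then have "pt (rotate_label (j, n)) = pt (rotate_label (k, m))"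
      using that by (intro lifts_pt_eq[OF g(1,2)]) (auto simp: Labels_def)
    then have "pt (fst (rotate_label (j, 0)), n) = pt (fst (rotate_label (k, 0)), m)" by simp
    then show ?thesis unfolding same_def using nm by blast
  qed
  have flip: "same (3 - j) (3 - k)" if "same j k" "j < 4" "k < 4" for j k
  proof -
    obtain n m where nm: "n < 8" "m < 8" "pt (j, n) = pt (k, m)" using \<open>same j k\<close> by (auto simp: same_def)
    then have "pt (flip_label (j, n)) = pt (flip_label (k, m))"
      using that by (intro lifts_pt_eq[OF g(3,4)]) (auto simp: Labels_def)
    then have "pt (3 - j, snd (flip_label (j, n))) = pt (3 - k, snd (flip_label (k, m)))" by simp
    moreover have "snd (flip_label (j, n)) < 8" "snd (flip_label (k, m)) < 8" using nm by simp_all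
    ultimately show ?thesis unfolding same_def by blast
  qed
  have "\<not> same 0 3" unfolding same_def using pt_0_3 by blast
  then have 1: "\<not> same 0 1" "\<not> same 0 2" "\<not> same 0 3" using rot[of 0 1] rot[of 0 2] by (auto simp: numeral_2_eq_2 numeral_3_eq_3)
  have 2: "\<not> same 3 1" using flip[of 3 1] 1 by (auto simp: numeral_2_eq_2)
  then have 3: "\<not> same 1 2" "\<not> same 2 3" using rot[of 1 2] rot[of 2 3] by (auto simp: numeral_2_eq_2 numeral_3_eq_3)
  have 4: "\<not> same 1 0" "\<not> same 2 0" "\<not> same 3 0" "\<not> same 1 3" "\<not> same 2 1" "\<not> same 3 2"
    using 1 2 3 sym by blast+
  have "same j k" unfolding same_def using assms by blast
  then show ?thesis using assms(1,2) 1 2 3 4 unfolding less_4_8 by auto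
qed

lemma pt_inj: "inj_on pt Labels"
proof (rule inj_onI)
  fix x y assume x: "x \<in> Labels" and y: "y \<in> Labels" and eq: "pt x = pt y"
  obtain j n k m where xy: "x = (j, n)" "y = (k, m)" by (cases x; cases y)
  have b: "j < 4" "k < 4" "n < 8" "m < 8" using x y by (auto simp: xy Labels_def)
  have jk: "j = k" using pt_distinct_fibres[OF b] eq by (simp add: xy)
  have "th j \<noteq> 0" using th_nz by (simp add: th_def)
  then have z: "zeta ^ n = zeta ^ m" using eq by (simp add: xy jk pt_def)
  have "a = b'" if "a \<le> b'" "b' < 8" "zeta ^ a = zeta ^ b'" for a b'
  proof -
    have "zeta ^ b' = zeta ^ a * zeta ^ (b' - a)" using power_add[of zeta a "b' - a"] that(1) by simp
    then have "zeta ^ (b' - a) = 1" using that zeta_powers(3) by simp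
    then have "b' - a = 0" using zeta_order[of "b' - a"] that by linarith
    then show ?thesis using that(1) by simp
  qed
  then have "n = m" using z b by (metis nat_le_linear)
  then show "x = y" by (simp add: xy jk)
qed

definition label_pair :: "(label \<Rightarrow> label) \<times> (label \<Rightarrow> label) \<Rightarrow> bool" where
  "label_pair ff \<longleftrightarrow> (\<forall>x\<in>Labels. fst ff x \<in> Labels \<and> snd ff x \<in> Labels \<and>
    (\<forall>y\<in>Labels. pair_type (fst ff x) (snd ff y) = pair_type x y \<and> pair_type (snd ff x) (fst ff y) = pair_type x y))"

lemma label_pair_moves: "ff \<in> set label_moves \<Longrightarrow> label_pair ff"
  using label_moves_invariant unfolding list_all_iff set_label_list label_pair_def by (cases ff) auto

text \<open>The automorphisms that act through label maps preserving \<open>pair_type\<close> form a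
  subgroup containing the five moves. For inverses, injectivity of \<open>pt\<close> makes the label
  maps injective, hence bijective on the finite set of labels.\<close>

lemma Gal_lifts:
  assumes "\<sigma> \<in> Gal L"
  shows "\<exists>ff. label_pair ff \<and> lifts \<sigma> ff"
proof -
  interpret G: group "galois_group L \<rat>" by (rule galois_group_group[OF cfield_L])
  define Q where "Q = {\<sigma> \<in> Gal L. \<exists>ff. label_pair ff \<and> lifts \<sigma> ff}"
  have "subgroup Q (galois_group L \<rat>)"
  proof (rule G.subgroupI)
    show "Q \<subseteq> Gal L" by (auto simp: Q_def)
    have "\<one>\<^bsub>galois_group L \<rat>\<^esub> \<in> Q"
      unfolding Q_def
      by (auto simp: label_pair_def lifts_def Gal_apply_one[OF cfield_L] pt_in_L intro!: exI[of _ id])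
    then show "Q \<noteq> {}" by blast
  next
    fix \<sigma> \<tau> assume "\<sigma> \<in> Q" "\<tau> \<in> Q"
    then obtain f f' g g' where "\<sigma> \<in> Gal L" "\<tau> \<in> Gal L" "label_pair (f, f')" "lifts \<sigma> (f, f')" "label_pair (g, g')" "lifts \<tau> (g, g')"
      by (auto simp: Q_def)
    then have "label_pair (f \<circ> g, f' \<circ> g')" "lifts (\<sigma> \<otimes>\<^bsub>galois_group L \<rat>\<^esub> \<tau>) (f \<circ> g, f' \<circ> g')"
        "\<sigma> \<otimes>\<^bsub>galois_group L \<rat>\<^esub> \<tau> \<in> Gal L"
      by (auto simp: label_pair_def lifts_def Gal_apply_mult[OF cfield_L] pt_in_L)
    then show "\<sigma> \<otimes>\<^bsub>galois_group L \<rat>\<^esub> \<tau> \<in> Q" unfolding Q_def by blast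
  next
    fix \<sigma> assume "\<sigma> \<in> Q"
    then obtain f f' where \<sigma>: "\<sigma> \<in> Gal L" and ff: "label_pair (f, f')" "lifts \<sigma> (f, f')" by (auto simp: Q_def)
    have L: "x \<in> L" if "x \<in> pt ` Labels \<union> (\<lambda>x. r2 * pt x) ` Labels" for x using that pt_in_L by auto
    have inj: "inj_on \<sigma> L" by (rule chom_inj[OF cfield_L Gal_chom[OF cfield_L \<sigma>]])
    have "inj_on f Labels" "inj_on f' Labels"
    proof (rule_tac [!] inj_onI)
      fix x y assume x: "x \<in> Labels" and y: "y \<in> Labels"
      show "x = y" if "f x = f y"
        using that ff(2) x y inj pt_in_L(1) inj_onD[OF pt_inj _ x y] by (auto simp: lifts_def inj_on_def)
      show "x = y" if "f' x = f' y"
      proof -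
        have "\<sigma> (r2 * pt x) = \<sigma> (r2 * pt y)" using that ff(2) x y by (simp add: lifts_def)
        then have "r2 * pt x = r2 * pt y" using inj_onD[OF inj _ pt_in_L(2) pt_in_L(2)] by blast
        then show ?thesis using inj_onD[OF pt_inj _ x y] by simp
      qed
    qed
    moreover have "f ` Labels \<subseteq> Labels" "f' ` Labels \<subseteq> Labels" using ff(1) by (auto simp: label_pair_def)
    ultimately have im: "f ` Labels = Labels" "f' ` Labels = Labels"
      using endo_inj_surj[OF finite_Labels] by auto
    define g g' where "g = inv_into Labels f" and "g' = inv_into Labels f'"
    have g: "g x \<in> Labels" "f (g x) = x" "g' x \<in> Labels" "f' (g' x) = x" if "x \<in> Labels" for x
      using that im by (auto simp: g_def g'_def intro: inv_into_into f_inv_into_f)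
    have "label_pair (g, g')"
      using ff(1) g unfolding label_pair_def by (metis fst_conv snd_conv)
    moreover have "lifts (inv\<^bsub>galois_group L \<rat>\<^esub> \<sigma>) (g, g')"
    proof -
      have "(inv\<^bsub>galois_group L \<rat>\<^esub> \<sigma>) (pt x) = pt (g x) \<and> (inv\<^bsub>galois_group L \<rat>\<^esub> \<sigma>) (r2 * pt x) = r2 * pt (g' x)"
        if x: "x \<in> Labels" for x
      proof -
        have "\<sigma> (pt (g x)) = pt x" "\<sigma> (r2 * pt (g' x)) = r2 * pt x"
          using ff(2) g[OF x] by (auto simp: lifts_def)
        then show ?thesis
          using Gal_apply_inv[OF cfield_L \<sigma> pt_in_L(1)[of "g x"]] Gal_apply_inv[OF cfield_L \<sigma> pt_in_L(2)[of "g' x"]] by simp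
      qed
      then show ?thesis by (simp add: lifts_def)
    qed
    ultimately show "inv\<^bsub>galois_group L \<rat>\<^esub> \<sigma> \<in> Q" using \<sigma> by (auto simp: Q_def)
  qed
  moreover have "\<sigma> \<in> Q" if "\<sigma> \<in> Gal L" "ff \<in> set label_moves" "lifts \<sigma> ff" for \<sigma> ff
    using that label_pair_moves unfolding Q_def by blast
  ultimately have "Gal L \<subseteq> Q" by (rule Gal_generated)
  then show ?thesis using assms by (auto simp: Q_def)
qed

section \<open>The two transitive actions and their stabilisers\<close>

definition act1 :: "(complex \<Rightarrow> complex) \<Rightarrow> label \<Rightarrow> label" where
  "act1 \<sigma> x = inv_into Labels pt (\<sigma> (pt x))"

definition act2 :: "(complex \<Rightarrow> complex) \<Rightarrow> label \<Rightarrow> label" where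
  "act2 \<sigma> x = inv_into Labels pt (\<sigma> (r2 * pt x) / r2)"

lemma act_lifts:
  assumes "label_pair ff" "lifts \<sigma> ff" "x \<in> Labels"
  shows "act1 \<sigma> x = fst ff x" "act2 \<sigma> x = snd ff x"
  using assms pt_inj by (auto simp: act1_def act2_def lifts_def label_pair_def)

lemma act_props:
  assumes \<sigma>: "\<sigma> \<in> Gal L" and x: "x \<in> Labels"
  shows "act1 \<sigma> x \<in> Labels" "act2 \<sigma> x \<in> Labels" "pt (act1 \<sigma> x) = \<sigma> (pt x)" "r2 * pt (act2 \<sigma> x) = \<sigma> (r2 * pt x)"
    and "y \<in> Labels \<Longrightarrow> pair_type (act1 \<sigma> x) (act2 \<sigma> y) = pair_type x y"
    and "y \<in> Labels \<Longrightarrow> pair_type (act2 \<sigma> x) (act1 \<sigma> y) = pair_type x y"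
proof -
  obtain ff where ff: "label_pair ff" "lifts \<sigma> ff" using Gal_lifts[OF \<sigma>] by blast
  note a = act_lifts[OF ff]
  show "act1 \<sigma> x \<in> Labels" "act2 \<sigma> x \<in> Labels" "pt (act1 \<sigma> x) = \<sigma> (pt x)" "r2 * pt (act2 \<sigma> x) = \<sigma> (r2 * pt x)"
    "y \<in> Labels \<Longrightarrow> pair_type (act1 \<sigma> x) (act2 \<sigma> y) = pair_type x y"
    "y \<in> Labels \<Longrightarrow> pair_type (act2 \<sigma> x) (act1 \<sigma> y) = pair_type x y"
    using ff x by (auto simp: a label_pair_def lifts_def)
qed

text \<open>\<open>T\<close> stands for the labels that can be moved to \<open>(0, 0)\<close>. The
  shift runs through all of fibre 0, the flip links fibre 3 to it, and the rotation links 2 to 3 and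
  1 to 2.\<close>

lemma labels_connected:
  assumes e: "e = 0 \<or> e = 4" and T: "(0, 0) \<in> T"
    and shift: "\<And>x. x \<in> Labels \<Longrightarrow> shift_label e x \<in> T \<Longrightarrow> x \<in> T"
    and rot: "\<And>x. x \<in> Labels \<Longrightarrow> rotate_label x \<in> T \<Longrightarrow> x \<in> T"
    and flip: "\<And>x. x \<in> Labels \<Longrightarrow> flip_label x \<in> T \<Longrightarrow> x \<in> T"
  shows "Labels \<subseteq> T"
proof -
  have mem: "(j, n) \<in> Labels \<longleftrightarrow> j < 4 \<and> n < 8" for j n by (simp add: Labels_def)
  have 0: "(0, n) \<in> T" if "n < 8" for n
    using e T that shift[of "(0, 0)"] shift[of "(0, 1)"] shift[of "(0, 2)"] shift[of "(0, 3)"] shift[of "(0, 4)"]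
      shift[of "(0, 5)"] shift[of "(0, 6)"] shift[of "(0, 7)"]
    unfolding less_4_8 by (auto simp: mem)
  have 3: "(3, n) \<in> T" if "n < 8" for n using flip[of "(3, n)"] 0 that by (simp add: mem)
  have 2: "(2, n) \<in> T" if "n < 8" for n using rot[of "(2, n)"] 3 that by (simp add: mem)
  have 1: "(1, n) \<in> T" if "n < 8" for n using rot[of "(1, n)"] 2 that by (simp add: mem numeral_2_eq_2)
  show ?thesis using 0 1 2 3 by (auto simp: Labels_def less_4_8(1))
qed

lemma act_pointed:
  "pointed_action (galois_group L \<rat>) Labels act1 (0, 0)"
  "pointed_action (galois_group L \<rat>) Labels act2 (0, 0)"
proof -
  interpret G: group "galois_group L \<rat>" by (rule galois_group_group[OF cfield_L])
  have r2: "r2 \<noteq> 0" by simp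
  have m1: "act1 (\<sigma> \<otimes>\<^bsub>galois_group L \<rat>\<^esub> \<tau>) x = act1 \<sigma> (act1 \<tau> x)"
    and m2: "act2 (\<sigma> \<otimes>\<^bsub>galois_group L \<rat>\<^esub> \<tau>) x = act2 \<sigma> (act2 \<tau> x)"
    if "\<sigma> \<in> Gal L" "\<tau> \<in> Gal L" "x \<in> Labels" for \<sigma> \<tau> x
    using that act_props(3,4)[of \<tau> x] by (simp_all add: act1_def[of _ x] act1_def[of \<sigma>] act2_def[of _ x] act2_def[of \<sigma>]
        Gal_apply_mult[OF cfield_L] pt_in_L)
  have o1: "act1 \<one>\<^bsub>galois_group L \<rat>\<^esub> x = x" and o2: "act2 \<one>\<^bsub>galois_group L \<rat>\<^esub> x = x" if "x \<in> Labels" for x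
    using that pt_inj by (simp_all add: act1_def act2_def Gal_apply_one[OF cfield_L] pt_in_L)
  have move: "\<exists>\<tau>\<in>Gal L. act1 \<tau> x = (0, 0)"
    if ff: "ff \<in> set label_moves" and x: "x \<in> Labels" and ex: "\<exists>\<tau>\<in>Gal L. act1 \<tau> (fst ff x) = (0, 0)" for ff x
  proof -
    obtain \<sigma> where \<sigma>: "\<sigma> \<in> Gal L" "lifts \<sigma> ff" using lifts_exists[OF ff] by blast
    have "fst ff x = act1 \<sigma> x" using act_lifts(1)[OF label_pair_moves[OF ff] \<sigma>(2) x] by simp
    then show ?thesis using x ex m1 \<sigma>(1) G.m_closed by metis
  qed
  have move': "\<exists>\<tau>\<in>Gal L. act2 \<tau> x = (0, 0)"
    if ff: "ff \<in> set label_moves" and x: "x \<in> Labels" and ex: "\<exists>\<tau>\<in>Gal L. act2 \<tau> (snd ff x) = (0, 0)" for ff x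
  proof -
    obtain \<sigma> where \<sigma>: "\<sigma> \<in> Gal L" "lifts \<sigma> ff" using lifts_exists[OF ff] by blast
    have "snd ff x = act2 \<sigma> x" using act_lifts(2)[OF label_pair_moves[OF ff] \<sigma>(2) x] by simp
    then show ?thesis using x ex m2 \<sigma>(1) G.m_closed by metis
  qed
  have z: "(0, 0) \<in> Labels" by (simp add: Labels_def)
  have t1: "Labels \<subseteq> {x. \<exists>\<sigma>\<in>Gal L. act1 \<sigma> x = (0, 0)}"
  proof (rule labels_connected[of 0])
    show "(0, 0) \<in> {x. \<exists>\<sigma>\<in>Gal L. act1 \<sigma> x = (0, 0)}" using o1[OF z] G.one_closed by blast
    fix x assume "x \<in> Labels"
    then show "shift_label 0 x \<in> {x. \<exists>\<sigma>\<in>Gal L. act1 \<sigma> x = (0, 0)} \<Longrightarrow> x \<in> {x. \<exists>\<sigma>\<in>Gal L. act1 \<sigma> x = (0, 0)}"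
      "rotate_label x \<in> {x. \<exists>\<sigma>\<in>Gal L. act1 \<sigma> x = (0, 0)} \<Longrightarrow> x \<in> {x. \<exists>\<sigma>\<in>Gal L. act1 \<sigma> x = (0, 0)}"
      "flip_label x \<in> {x. \<exists>\<sigma>\<in>Gal L. act1 \<sigma> x = (0, 0)} \<Longrightarrow> x \<in> {x. \<exists>\<sigma>\<in>Gal L. act1 \<sigma> x = (0, 0)}"
      using move[of "(shift_label 0, shift_label 4)" x] move[of "(rotate_label, rotate_label)" x]
        move[of "(flip_label, flip_label)" x] by (simp_all add: label_moves_def)
  qed simp
  have t2: "Labels \<subseteq> {x. \<exists>\<sigma>\<in>Gal L. act2 \<sigma> x = (0, 0)}"
  proof (rule labels_connected[of 4])
    show "(0, 0) \<in> {x. \<exists>\<sigma>\<in>Gal L. act2 \<sigma> x = (0, 0)}" using o2[OF z] G.one_closed by blast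
    fix x assume "x \<in> Labels"
    then show "shift_label 4 x \<in> {x. \<exists>\<sigma>\<in>Gal L. act2 \<sigma> x = (0, 0)} \<Longrightarrow> x \<in> {x. \<exists>\<sigma>\<in>Gal L. act2 \<sigma> x = (0, 0)}"
      "rotate_label x \<in> {x. \<exists>\<sigma>\<in>Gal L. act2 \<sigma> x = (0, 0)} \<Longrightarrow> x \<in> {x. \<exists>\<sigma>\<in>Gal L. act2 \<sigma> x = (0, 0)}"
      "flip_label x \<in> {x. \<exists>\<sigma>\<in>Gal L. act2 \<sigma> x = (0, 0)} \<Longrightarrow> x \<in> {x. \<exists>\<sigma>\<in>Gal L. act2 \<sigma> x = (0, 0)}"
      using move'[of "(shift_label 0, shift_label 4)" x] move'[of "(rotate_label, rotate_label)" x]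
        move'[of "(flip_label, flip_label)" x] by (simp_all add: label_moves_def)
  qed simp
  show "pointed_action (galois_group L \<rat>) Labels act1 (0, 0)"
    by unfold_locales (use finite_Labels z act_props(1) m1 o1 t1 in auto)
  show "pointed_action (galois_group L \<rat>) Labels act2 (0, 0)"
    by unfold_locales (use finite_Labels z act_props(2) m2 o2 t2 in auto)
qed

interpretation E: two_actions "galois_group L \<rat>" Labels act1 "(0, 0)" Labels act2 "(0, 0)"
  by (rule two_actions.intro; rule act_pointed)

interpretation E': two_actions "galois_group L \<rat>" Labels act2 "(0, 0)" Labels act1 "(0, 0)"
  by (rule two_actions.intro; rule act_pointed)

lemma pt_0: "pt (0, 0) = th0"
  by (simp add: pt_def th_def)

lemma zero_label: "(0, 0) \<in> Labels"
  by (simp add: Labels_def)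

lemma stabilizers:
  "E.a1.stab = carrier (galois_group L (qadj th0))" "E.a2.stab = carrier (galois_group L (qadj (r2 * th0)))"
proof -
  have "act1 \<sigma> (0, 0) = (0, 0) \<longleftrightarrow> \<sigma> th0 = th0" if "\<sigma> \<in> Gal L" for \<sigma>
    using act_props(1,3)[OF that zero_label] pt_inj zero_label by (metis inj_onD pt_0)
  then show "E.a1.stab = carrier (galois_group L (qadj th0))"
    unfolding E.a1.stab_def Gal_qadj[OF cfield_L L_gens(8)] by auto
  have "act2 \<sigma> (0, 0) = (0, 0) \<longleftrightarrow> \<sigma> (r2 * th0) = r2 * th0" if "\<sigma> \<in> Gal L" for \<sigma>
    using act_props(2,4)[OF that zero_label] pt_inj zero_label by (metis inj_onD pt_0 mult_left_cancel r2_nz)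
  moreover have "r2 * th0 \<in> L" using pt_in_L(2)[of "(0, 0)"] by (simp add: pt_0)
  ultimately show "E.a2.stab = carrier (galois_group L (qadj (r2 * th0)))"
    unfolding E.a2.stab_def by (subst Gal_qadj[OF cfield_L]) auto
qed

lemma conjugates_th0:
  "conjugates L th0 = pt ` Labels" "conjugates L (r2 * th0) = (\<lambda>x. r2 * pt x) ` Labels"
proof -
  note inv_closed = group.inv_closed[OF galois_group_group[OF cfield_L]]
  show "conjugates L th0 = pt ` Labels"
  proof (intro equalityI subsetI)
    fix y assume "y \<in> conjugates L th0"
    then show "y \<in> pt ` Labels"
      using act_props(1,3)[OF _ zero_label] by (auto simp: conjugates_def simp flip: pt_0) (metis image_eqI)
  next
    fix y assume "y \<in> pt ` Labels"
    then obtain x where x: "x \<in> Labels" "y = pt x" by blast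
    obtain \<sigma> where \<sigma>: "\<sigma> \<in> Gal L" "act1 \<sigma> x = (0, 0)" using E.a1.act_transitive[OF x(1)] by blast
    then have "(inv\<^bsub>galois_group L \<rat>\<^esub> \<sigma>) th0 = y"
      using act_props(3)[OF \<sigma>(1) x(1)] Gal_apply_inv[OF cfield_L \<sigma>(1) pt_in_L(1)[of x]] x by (simp add: pt_0)
    then show "y \<in> conjugates L th0" unfolding conjugates_def using inv_closed[OF \<sigma>(1)] by blast
  qed
  show "conjugates L (r2 * th0) = (\<lambda>x. r2 * pt x) ` Labels"
  proof (intro equalityI subsetI)
    fix y assume "y \<in> conjugates L (r2 * th0)"
    then show "y \<in> (\<lambda>x. r2 * pt x) ` Labels"
      using act_props(2,4)[OF _ zero_label] by (auto simp: conjugates_def simp flip: pt_0) (metis image_eqI)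
  next
    fix y assume "y \<in> (\<lambda>x. r2 * pt x) ` Labels"
    then obtain x where x: "x \<in> Labels" "y = r2 * pt x" by blast
    obtain \<sigma> where \<sigma>: "\<sigma> \<in> Gal L" "act2 \<sigma> x = (0, 0)" using E.a2.act_transitive[OF x(1)] by blast
    then have "(inv\<^bsub>galois_group L \<rat>\<^esub> \<sigma>) (r2 * th0) = y"
      using act_props(4)[OF \<sigma>(1) x(1)] Gal_apply_inv[OF cfield_L \<sigma>(1) pt_in_L(2)[of x]] x by (simp add: pt_0)
    then show "y \<in> conjugates L (r2 * th0)" unfolding conjugates_def using inv_closed[OF \<sigma>(1)] by blast
  qed
qed

lemma card_conjugates: "card (conjugates L th0) = 32" "card (conjugates L (r2 * th0)) = 32"
proof -
  have c: "card Labels = 32" by (simp add: Labels_def card_cartesian_product)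
  show "card (conjugates L th0) = 32" unfolding conjugates_th0 card_image[OF pt_inj] by (rule c)
  have "inj_on (\<lambda>x. r2 * pt x) Labels" using pt_inj by (auto simp: inj_on_def)
  then show "card (conjugates L (r2 * th0)) = 32" unfolding conjugates_th0 by (simp add: card_image c)
qed

text \<open>A quotient inside a fibre is \<open>zeta\<close>, which yields \<open>\<i>\<close> and
  \<open>r2\<close>. Sums and differences of products of two of \<open>th0\<close>,
  \<open>th1\<close>, \<open>th2\<close>, \<open>th3\<close> isolate multiples of single roots
  \<open>s1\<close>, \<open>s2\<close>, \<open>s3\<close>, and quotients of these give
  \<open>ww\<close> and hence \<open>r3\<close>. Then \<open>rho\<close>, \<open>cbrt2\<close> and
  the roots themselves are separated.\<close>

lemma L_generated:
  assumes M: "cfield M" and pt: "pt ` Labels \<subseteq> M"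
  shows "L \<subseteq> M"
proof -
  note [intro] = cfield_intros[OF M]
  have p: "zeta ^ n * th j \<in> M" if "j < 4" "n < 8" for j n
  proof -
    have "pt (j, n) \<in> M" using pt that by (auto simp: Labels_def)
    then show ?thesis by (simp add: pt_def)
  qed
  have t: "th0 \<in> M" "th1 \<in> M" "th2 \<in> M" "th3 \<in> M"
    using p[of 0 0] p[of 1 0] p[of 2 0] p[of 3 0] by (auto simp: th_def)
  have "zeta = (zeta ^ 1 * th 0) / th0" by (simp add: th_def)
  also have "\<dots> \<in> M" using p[of 0 1] t by (intro cfield_divide[OF M]) auto
  finally have z: "zeta \<in> M" .
  then have i: "\<i> \<in> M" using cfield_power[OF M z, of 2] by (simp add: zeta_sq)
  have "r2 = (1 + \<i>) / zeta" using zeta_powers(3) by (auto simp: zeta_def)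
  also have "\<dots> \<in> M" using i z by auto
  finally have r2: "r2 \<in> M" .
  define E where "E = rho * (\<i> * r3) * cbrt2"
  have E0: "E \<noteq> 0" by (simp add: E_def)
  have P: "th1 * th0 = E * (s2 + s3)" "th2 * th0 = E * ww * (s1 + s3)" "th3 * th0 = E * ww\<^sup>2 * (s1 + s2)"
      "th1 * th2 = E * ww\<^sup>2 * (s1 - s2)" "th2 * th3 = E * (s2 - s3)" "th3 * th1 = E * ww * (s3 - s1)"
    unfolding th0_products th_products by (simp_all add: E_def mult_ac)
  have Es: "E * s2 \<in> M" "E * ww * s1 \<in> M" "E * ww\<^sup>2 * s1 \<in> M" "E * s3 \<in> M"
  proof -
    have e: "E * s2 = (th1 * th0 + th2 * th3) / 2" "E * s3 = (th1 * th0 - th2 * th3) / 2"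
       "E * ww * s1 = (th2 * th0 - th3 * th1) / 2" "E * ww\<^sup>2 * s1 = (th3 * th0 + th1 * th2) / 2"
      unfolding P by (simp_all add: algebra_simps)
    show "E * s2 \<in> M" "E * ww * s1 \<in> M" "E * ww\<^sup>2 * s1 \<in> M" "E * s3 \<in> M" unfolding e using t by auto
  qed
  have "ww = (E * ww\<^sup>2 * s1) / (E * ww * s1)" using E0 ii_r3(4) by (simp add: power2_eq_square)
  then have w: "ww \<in> M" using Es by (metis cfield_divide[OF M])
  have "E * s1 = (E * ww * s1) / ww" using ii_r3(4) by simp
  then have Es1: "E * s1 \<in> M" using Es w by (metis cfield_divide[OF M])
  have ir: "\<i> * r3 \<in> M" unfolding ii_r3(1) using w by auto
  have "r3 = (\<i> * r3) / \<i>" by simp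
  then have r3: "r3 \<in> M" using ir i by (metis cfield_divide[OF M])
  have s: "rho * cbrt2 * s \<in> M" if "E * s \<in> M" for s
  proof -
    have "rho * cbrt2 * s = (E * s) / (\<i> * r3)" by (simp add: E_def)
    then show ?thesis using that ir by (metis cfield_divide[OF M])
  qed
  have rs: "rho * cbrt2 * s1 \<in> M" "rho * cbrt2 * s2 \<in> M" using s Es Es1 by auto
  have rs3: "rho * cbrt2 * s3 \<in> M" using s Es by auto
  \<comment> \<open>The product eliminates the roots, since \<open>s1 * s2 * s3 = 1\<close>, and
    leaves \<open>2 * rho ^ 3\<close>, which is \<open>rho\<close> times the known element
    \<open>2 * (r2 * r3)\<close>.\<close>
  have "(rho * cbrt2 * s1) * (rho * cbrt2 * s2) * (rho * cbrt2 * s3) = rho ^ 3 * cbrt2 ^ 3 * (s1 * s2 * s3)"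
    by (simp add: power3_eq_cube)
  also have "\<dots> = rho ^ 3 * 2" by (simp only: s_prod cbrt2_cubed mult_1_right)
  also have "\<dots> = rho * (2 * rho\<^sup>2)" by (simp add: power3_eq_cube power2_eq_square)
  finally have p: "(rho * cbrt2 * s1) * (rho * cbrt2 * s2) * (rho * cbrt2 * s3) = rho * (2 * (r2 * r3))"
    by (simp only: squares(3))
  have "rho = (rho * cbrt2 * s1) * (rho * cbrt2 * s2) * (rho * cbrt2 * s3) / (2 * (r2 * r3))"
    unfolding p by simp
  also have "\<dots> \<in> M" using rs rs3 r2 r3 by auto
  finally have rho: "rho \<in> M" .
  have cs: "cbrt2 * s1 \<in> M" "cbrt2 * s2 \<in> M"
  proof -
    have "cbrt2 * s1 = (rho * cbrt2 * s1) / rho" "cbrt2 * s2 = (rho * cbrt2 * s2) / rho" by simp_all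
    then show "cbrt2 * s1 \<in> M" "cbrt2 * s2 \<in> M" using rs rho by (metis cfield_divide[OF M])+
  qed
  \<comment> \<open>The square equals \<open>2 - cbrt2\<^sup>2\<close>, so it isolates
    \<open>cbrt2\<^sup>2\<close>, and \<open>cbrt2\<close> is 2 divided by that.\<close>
  have "(cbrt2 * s1)\<^sup>2 = cbrt2\<^sup>2 * (cbrt2 - 1)" by (simp only: power_mult_distrib squares(4))
  also have "\<dots> = cbrt2 ^ 3 - cbrt2\<^sup>2" by (simp add: algebra_simps power2_eq_square power3_eq_cube)
  finally have "(cbrt2 * s1)\<^sup>2 = cbrt2 ^ 3 - cbrt2\<^sup>2" .
  then have "cbrt2\<^sup>2 = 2 - (cbrt2 * s1)\<^sup>2" by (simp add: cbrt2_cubed)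
  also have "\<dots> \<in> M" using cs by auto
  finally have c2: "cbrt2\<^sup>2 \<in> M" .
  have "cbrt2 * cbrt2\<^sup>2 = cbrt2 ^ 3" by (simp add: power2_eq_square power3_eq_cube)
  then have "cbrt2 * cbrt2\<^sup>2 = 2" by (simp only: cbrt2_cubed)
  then have "cbrt2 = 2 / cbrt2\<^sup>2" by (simp add: nonzero_eq_divide_eq)
  also have "\<dots> \<in> M" using c2 by auto
  finally have c: "cbrt2 \<in> M" .
  have "s1 = (cbrt2 * s1) / cbrt2" "s2 = (cbrt2 * s2) / cbrt2" by simp_all
  then have "s1 \<in> M" "s2 \<in> M" using cs c by (metis cfield_divide[OF M])+
  then show ?thesis using L_minimal[OF M c i r2 r3 rho] t by blast
qed

lemma galois_closures: "galois_closure L (qadj th0) \<rat>" "galois_closure L (qadj (r2 * th0)) \<rat>"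
proof -
  have rt: "r2 * th0 \<in> L" using pt_in_L(2)[of "(0, 0)"] by (simp add: pt_0)
  show "galois_closure L (qadj th0) \<rat>"
    by (rule galois_closure_qadj[OF L_galois L_gens(8)]) (use L_generated conjugates_th0 in simp)
  show "galois_closure L (qadj (r2 * th0)) \<rat>"
  proof (rule galois_closure_qadj[OF L_galois rt])
    fix M assume M: "cfield M" and c: "conjugates L (r2 * th0) \<subseteq> M"
    have m: "r2 * pt x \<in> M" if "x \<in> Labels" for x using c that by (auto simp: conjugates_th0)
    have "r2 * pt (0, 0) \<in> M" "r2 * pt (0, 1) \<in> M" "r2 * pt (0, 2) \<in> M" using m by (auto simp: Labels_def)
    \<comment> \<open>Quotients of conjugates do not see the common factor \<open>r2\<close>; so
      \<open>zeta\<close> is available, then \<open>r2\<close> as \<open>zeta\<close> plus its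
      inverse, and the factor can be removed.\<close>
    moreover have "zeta = r2 * pt (0, 1) / (r2 * pt (0, 0))" by (simp add: pt_def th_def)
    ultimately have z: "zeta \<in> M" by (metis cfield_divide[OF M])
    have "r2 = (1 + zeta\<^sup>2) / zeta" unfolding zeta_sq using zeta_powers(3) by (auto simp: zeta_def)
    then have r: "r2 \<in> M" using z by (metis cfield_add[OF M] cfield_1[OF M] cfield_power[OF M] cfield_divide[OF M])
    have "pt x \<in> M" if "x \<in> Labels" for x
    proof -
      have "pt x = r2 * pt x / r2" by simp
      then show ?thesis using m[OF that] r by (metis cfield_divide[OF M])
    qed
    then show "L \<subseteq> M" using L_generated[OF M] by blast
  qed
qed

section \<open>Local and integral equivalence\<close>

lemma kernel_invariant: "E.invariant (kernel x1 x2 x3 a b)" "E'.invariant (kernel x1 x2 x3 a b)"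
  by (auto simp: E.invariant_def E'.invariant_def kernel_def act_props)

text \<open>An automorphism that takes \<open>x\<close> to the base label turns row \<open>x\<close>
  of the product into the row at \<open>(0, 0)\<close>, by invariance of both matrices and
  reindexing of the sum.\<close>

lemma kernel_product:
  assumes at_0: "\<And>z. z \<in> Labels \<Longrightarrow> (\<Sum>y\<leftarrow>label_list. kernel x1 x2 x3 a b (0, 0) y * kernel x1' x2' x3' a' b' y z) =
      (if z = (0, 0) then m else 0)"
    and x: "x \<in> Labels" and z: "z \<in> Labels"
  shows "(\<Sum>y\<in>Labels. kernel x1 x2 x3 a b x y * kernel x1' x2' x3' a' b' y z) = (if x = z then m else 0)"
    (is "(\<Sum>y\<in>Labels. ?K x y * ?K' y z) = _")
proof -
  obtain \<sigma> where \<sigma>: "\<sigma> \<in> Gal L" "act1 \<sigma> x = (0, 0)" using E.a1.act_transitive[OF x] by blast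
  have "(\<Sum>y\<in>Labels. ?K x y * ?K' y z) = (\<Sum>y\<in>Labels. ?K (act1 \<sigma> x) (act2 \<sigma> y) * ?K' (act2 \<sigma> y) (act1 \<sigma> z))"
    using kernel_invariant \<sigma>(1) x z by (intro sum.cong) (auto simp: E.invariant_def E'.invariant_def)
  also have "\<dots> = (\<Sum>y\<in>Labels. ?K (0, 0) y * ?K' y (act1 \<sigma> z))"
    using E.a2.sum_act[OF \<sigma>(1), of "\<lambda>y. ?K (0, 0) y * ?K' y (act1 \<sigma> z)"] by (simp add: \<sigma>(2))
  also have "\<dots> = (if act1 \<sigma> z = (0, 0) then m else 0)"
  proof -
    have "distinct label_list" by (simp add: distinct_product)
    then have "sum_list (map F label_list) = sum F Labels" for F :: "label \<Rightarrow> int"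
      using sum_list_distinct_conv_sum_set[of label_list F] by (simp only: set_label_list)
    then show ?thesis using at_0[OF act_props(1)[OF \<sigma>(1) z]] by simp
  qed
  also have "act1 \<sigma> z = (0, 0) \<longleftrightarrow> x = z"
    using \<sigma> x z E.a1.act_inv by metis
  finally show ?thesis .
qed

lemma locally_equivalent:
  "locally_integrally_equivalent (galois_group L \<rat>) (carrier (galois_group L (qadj th0))) (carrier (galois_group L (qadj (r2 * th0))))"
  unfolding locally_integrally_equivalent_def
proof (intro allI impI)
  fix p :: nat assume p: "Factorial_Ring.prime p"
  note at_0 = kernel_products_at_0[unfolded list_all_iff set_label_list, THEN bspec]
  show "perm_modules_isomorphic (padic_int_ring p) (galois_group L \<rat>) (carrier (galois_group L (qadj th0)))
      (carrier (galois_group L (qadj (r2 * th0))))"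
  proof (cases "p = 3")
    case False
    have "Factorial_Ring.prime (3::nat)" by simp
    then have "coprime 3 p" using p False primes_coprime by blast
    then have m: "coprime 3 (int p)" by (metis coprime_int_iff of_nat_numeral)
    show ?thesis
      unfolding stabilizers[symmetric]
      by (rule E.padic_isomorphic[OF p m kernel_invariant(1)]; rule kernel_product; use at_0 in blast)
  next
    case True
    have m: "coprime 55 (int p)"
    proof (rule coprimeI)
      fix c assume "c dvd 55" "c dvd int p"
      \<comment> \<open>For \<open>p = 3\<close> this difference is 1.\<close>
      then have "c dvd 55 - int p * 18" by (intro dvd_diff dvd_mult2)
      then show "is_unit c" by (simp add: True)
    qed
    show ?thesis
      unfolding stabilizers[symmetric]
      by (rule E.padic_isomorphic[OF p m kernel_invariant(1)]; rule kernel_product; use at_0 in blast)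
  qed
qed

lemma not_equivalent:
  "\<not> integrally_equivalent (galois_group L \<rat>) (carrier (galois_group L (qadj th0))) (carrier (galois_group L (qadj (r2 * th0))))"
proof
  assume "integrally_equivalent (galois_group L \<rat>) (carrier (galois_group L (qadj th0))) (carrier (galois_group L (qadj (r2 * th0))))"
  then have "perm_modules_isomorphic int_ring (galois_group L \<rat>) E.a1.stab E.a2.stab"
    by (simp add: integrally_equivalent_def stabilizers)
  then obtain M N where MN: "E.invariant M" "E'.invariant N"
    "\<And>x z. x \<in> Labels \<Longrightarrow> z \<in> Labels \<Longrightarrow> (\<Sum>y\<in>Labels. M x y * N y z) = (if x = z then 1 else 0)"
    using E.integral_matrices by blast
  have mv: "\<exists>\<sigma>\<in>Gal L. \<forall>x\<in>Labels. act1 \<sigma> x = f x \<and> act2 \<sigma> x = f' x" if ff: "(f, f') \<in> set label_moves" for f f'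
  proof -
    obtain \<sigma> where \<sigma>: "\<sigma> \<in> Gal L" "lifts \<sigma> (f, f')" using lifts_exists[OF ff] by blast
    then show ?thesis using act_lifts[OF label_pair_moves[OF ff] \<sigma>(2)] by (intro bexI[of _ \<sigma>]) simp_all
  qed
  show False
  proof (rule no_integral_matrices[OF _ _ MN(3)])
    fix f f' x y assume ff: "(f, f') \<in> set label_moves" and xy: "x \<in> Labels" "y \<in> Labels"
    obtain \<sigma> where \<sigma>: "\<sigma> \<in> Gal L" "\<forall>x\<in>Labels. act1 \<sigma> x = f x \<and> act2 \<sigma> x = f' x" using mv[OF ff] by blast
    show "M (f x) (f' y) = M x y" using MN(1) \<sigma> xy by (auto simp: E.invariant_def)
    show "N (f' x) (f y) = N x y" using MN(2) \<sigma> xy by (auto simp: E'.invariant_def)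
  qed
qed

theorem mainTheorem5:
  shows "\<exists>K1 K2 L :: complex set.
    number_field_of_degree 32 K1 \<and> number_field_of_degree 32 K2 \<and>
    galois_closure L K1 \<rat> \<and> galois_closure L K2 \<rat> \<and>
    locally_integrally_equivalent (galois_group L \<rat>)
      (carrier (galois_group L K1)) (carrier (galois_group L K2)) \<and>
    \<not> integrally_equivalent (galois_group L \<rat>)
      (carrier (galois_group L K1)) (carrier (galois_group L K2))"
proof (intro exI conjI)
  show "number_field_of_degree 32 (qadj th0)"
    using number_field_qadj[OF L_galois L_gens(8)] by (simp only: card_conjugates)
  have "r2 * th0 \<in> L" using pt_in_L(2)[of "(0, 0)"] by (simp add: pt_0)
  then show "number_field_of_degree 32 (qadj (r2 * th0))"
    using number_field_qadj[OF L_galois] by (metis card_conjugates(2))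
qed (rule galois_closures locally_equivalent not_equivalent)+

end
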